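(* Let $\beta \in \mathbb{Z}[i]$ and $k \in \mathbb{Z}$ be such that each of the four Gaussian integers $$\beta + k(1+i), \quad \beta + k i(1+i), \quad \beta - k(1+i), \quad \beta - k i(1+i)$$ is a Gaussian prime congruent to $-1-6i$ modulo $16$. If $E$ is the elliptic curve given by $$y^2 = x^3 - (\beta^4 + 4k^4)^2 x,$$ then $E$ is genuinely defined over $\mathbb{Q}(i)$ and $E(\mathbb{Q}(i)) \cong \mathbb{Z}^2 \oplus (\mathbb{Z}/2\mathbb{Z})^2$.
   Context: For a number field $K$, an elliptic curve $E/K$ is called genuinely defined over $K$ if it is not the base change of an elliptic curve over a proper subfield of $K$. Here $E$ is regarded as an elliptic curve over $\mathbb{Q}(i)$, and $E(\mathbb{Q}(i))$ denotes its group of $\mathbb{Q}(i)$-rational points. A Gaussian prime is a prime element of the ring of Gaussian integers $\mathbb{Z}[i]$, and the congruence modulo $16$ is in $\mathbb{Z}[i]$.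
   Formalization: The integer k is assumed nonzero; for k = 0 the claim is false, e.g. β = −1−6i gives y² = x³ − β⁸x, which is isomorphic over Q(i) to y² = x³ − x, defined over Q and of rank 0. *)

theory Defs
  imports
    Complex_Main
    "HOL-Algebra.Algebra"
    "HOL-Algebra.Algebraic_Closure_Type"
begin

section \<open>Weierstrass curves\<close>

text \<open>
  \<open>Weierstrass a1 a2 a3 a4 a6\<close> stands for the curve
  \<open>y\<^sup>2 + a1 x y + a3 y = x\<^sup>3 + a2 x\<^sup>2 + a4 x + a6\<close>.  The ambient type \<open>'a\<close> is a field (for number
  fields: the complex numbers), and the fields of definition are subfields of it, given as sets.
  All formulas are the classical ones (Silverman, The Arithmetic of Elliptic Curves, Chapter III).
\<close>

datatype 'a weierstrass = Weierstrass 'a 'a 'a 'a 'a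

fun weierstrass_coeffs :: "'a weierstrass \<Rightarrow> 'a set" where
  "weierstrass_coeffs (Weierstrass a1 a2 a3 a4 a6) = {a1, a2, a3, a4, a6}"

fun weierstrass_eq :: "'a::field weierstrass \<Rightarrow> 'a \<Rightarrow> 'a \<Rightarrow> bool" where
  "weierstrass_eq (Weierstrass a1 a2 a3 a4 a6) x y \<longleftrightarrow>
     y^2 + a1 * x * y + a3 * y = x^3 + a2 * x^2 + a4 * x + a6"

fun weierstrass_disc :: "'a::field weierstrass \<Rightarrow> 'a" where
  "weierstrass_disc (Weierstrass a1 a2 a3 a4 a6) =
     (let b2 = a1^2 + 4 * a2;
          b4 = 2 * a4 + a1 * a3;
          b6 = a3^2 + 4 * a6;
          b8 = a1^2 * a6 + 4 * a2 * a6 - a1 * a3 * a4 + a2 * a3^2 - a4^2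
      in - (b2^2) * b8 - 8 * b4^3 - 27 * b6^2 + 9 * b2 * b4 * b6)"

definition elliptic_curve_over :: "'a::field set \<Rightarrow> 'a weierstrass \<Rightarrow> bool" where
  "elliptic_curve_over K E \<longleftrightarrow>
     subfield K ring_of_type_algebra \<and> weierstrass_coeffs E \<subseteq> K \<and> weierstrass_disc E \<noteq> 0"


section \<open>Isomorphism, base change, genuine field of definition\<close>

text \<open>
  \<open>weierstrass_change u r s t E E'\<close>: the admissible substitution
  \<open>x = u\<^sup>2 x' + r\<close>, \<open>y = u\<^sup>3 y' + u\<^sup>2 s x' + t\<close> carries the equation of \<open>E\<close> to the equation of \<open>E'\<close>.
  The isomorphisms over \<open>K\<close> of elliptic curves in Weierstrass form are exactly these substitutions
  with \<open>u, r, s, t\<close> in \<open>K\<close> and \<open>u\<close> nonzero.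
\<close>

fun weierstrass_change ::
  "'a::field \<Rightarrow> 'a \<Rightarrow> 'a \<Rightarrow> 'a \<Rightarrow> 'a weierstrass \<Rightarrow> 'a weierstrass \<Rightarrow> bool" where
  "weierstrass_change u r s t (Weierstrass a1 a2 a3 a4 a6) (Weierstrass a1' a2' a3' a4' a6') \<longleftrightarrow>
     u * a1' = a1 + 2 * s \<and>
     u^2 * a2' = a2 - s * a1 + 3 * r - s^2 \<and>
     u^3 * a3' = a3 + r * a1 + 2 * t \<and>
     u^4 * a4' = a4 - s * a3 + 2 * r * a2 - (t + r * s) * a1 + 3 * r^2 - 2 * s * t \<and>
     u^6 * a6' = a6 + r * a4 + r^2 * a2 + r^3 - t * a3 - t^2 - r * t * a1"

lemma weierstrass_change_eq_iff:
  fixes u :: "'a::field"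
  assumes "weierstrass_change u r s t E E'" and "u \<noteq> 0"
  shows "weierstrass_eq E (u^2 * x + r) (u^3 * y + u^2 * s * x + t) \<longleftrightarrow> weierstrass_eq E' x y"
proof -
  obtain a1 a2 a3 a4 a6 where E: "E = Weierstrass a1 a2 a3 a4 a6" by (cases E)
  obtain b1 b2 b3 b4 b6 where E': "E' = Weierstrass b1 b2 b3 b4 b6" by (cases E')
  let ?X = "u^2 * x + r" and ?Y = "u^3 * y + u^2 * s * x + t"
  have h: "u * b1 = a1 + 2 * s" "u^2 * b2 = a2 - s * a1 + 3 * r - s^2"
    "u^3 * b3 = a3 + r * a1 + 2 * t"
    "u^4 * b4 = a4 - s * a3 + 2 * r * a2 - (t + r * s) * a1 + 3 * r^2 - 2 * s * t"
    "u^6 * b6 = a6 + r * a4 + r^2 * a2 + r^3 - t * a3 - t^2 - r * t * a1"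
    using assms(1) by (simp_all add: E E')
  have "?Y^2 + a1 * ?X * ?Y + a3 * ?Y - (?X^3 + a2 * ?X^2 + a4 * ?X + a6) =
      u^6 * y^2 + u^5 * x * y * (u * b1) + u^3 * y * (u^3 * b3)
      - (u^6 * x^3 + u^4 * x^2 * (u^2 * b2) + u^2 * x * (u^4 * b4) + u^6 * b6)"
    unfolding h by (simp add: eval_nat_numeral algebra_simps)
  also have "\<dots> = u^6 * (y^2 + b1 * x * y + b3 * y - (x^3 + b2 * x^2 + b4 * x + b6))"
    by (simp add: eval_nat_numeral algebra_simps)
  finally have "?Y^2 + a1 * ?X * ?Y + a3 * ?Y - (?X^3 + a2 * ?X^2 + a4 * ?X + a6) = 0 \<longleftrightarrow>
      y^2 + b1 * x * y + b3 * y - (x^3 + b2 * x^2 + b4 * x + b6) = 0"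
    using assms(2) by simp
  thus ?thesis by (simp add: E E')
qed

definition weierstrass_isomorphic_over :: "'a::field set \<Rightarrow> 'a weierstrass \<Rightarrow> 'a weierstrass \<Rightarrow> bool"
  where "weierstrass_isomorphic_over K E E' \<longleftrightarrow>
    (\<exists>u\<in>K. \<exists>r\<in>K. \<exists>s\<in>K. \<exists>t\<in>K. u \<noteq> 0 \<and> weierstrass_change u r s t E E')"

text \<open>
  The base change to \<open>K\<close> of a curve over \<open>F \<subseteq> K\<close> has the same coefficients, regarded as elements
  of \<open>K\<close>.  As always for elliptic curves, being a base change is understood up to isomorphism
  over \<open>K\<close>.
\<close>

definition is_base_change :: "'a::field set \<Rightarrow> 'a set \<Rightarrow> 'a weierstrass \<Rightarrow> bool" where
  "is_base_change F K E \<longleftrightarrow>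
     (\<exists>E'. elliptic_curve_over F E' \<and> weierstrass_isomorphic_over K E' E)"

definition genuinely_defined_over :: "'a::field set \<Rightarrow> 'a weierstrass \<Rightarrow> bool" where
  "genuinely_defined_over K E \<longleftrightarrow>
     elliptic_curve_over K E \<and>
     \<not> (\<exists>F. subfield F ring_of_type_algebra \<and> F \<subset> K \<and> is_base_change F K E)"


section \<open>The group of rational points\<close>

datatype 'a ec_point = Infinity | Affine 'a 'a

fun ec_add :: "'a::field weierstrass \<Rightarrow> 'a ec_point \<Rightarrow> 'a ec_point \<Rightarrow> 'a ec_point" where
  "ec_add E Infinity Q = Q"
| "ec_add E P Infinity = P"
| "ec_add (Weierstrass a1 a2 a3 a4 a6) (Affine x1 y1) (Affine x2 y2) =
     (if x1 = x2 \<and> y1 + y2 + a1 * x2 + a3 = 0 then Infinity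
      else let
        l = (if x1 = x2
             then (3 * x1^2 + 2 * a2 * x1 + a4 - a1 * y1) / (2 * y1 + a1 * x1 + a3)
             else (y2 - y1) / (x2 - x1));
        n = y1 - l * x1;
        x3 = l^2 + a1 * l - a2 - x1 - x2
      in Affine x3 (- (l + a1) * x3 - n - a3))"

definition ec_points :: "'a::field weierstrass \<Rightarrow> 'a set \<Rightarrow> 'a ec_point set" where
  "ec_points E K = insert Infinity {Affine x y | x y. x \<in> K \<and> y \<in> K \<and> weierstrass_eq E x y}"

definition ec_group :: "'a::field weierstrass \<Rightarrow> 'a set \<Rightarrow> 'a ec_point monoid" where
  "ec_group E K = \<lparr>carrier = ec_points E K, monoid.mult = ec_add E, one = Infinity\<rparr>"


section \<open>Gaussian integers and Gaussian rationals\<close>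

definition gaussian_ints :: "complex set" where
  "gaussian_ints = {z. Re z \<in> \<int> \<and> Im z \<in> \<int>}"

definition gaussian_rats :: "complex set" where
  "gaussian_rats = {z. Re z \<in> \<rat> \<and> Im z \<in> \<rat>}"

definition gaussian_ring :: "complex ring" where
  "gaussian_ring = ring_of_type_algebra\<lparr>carrier := gaussian_ints\<rparr>"

definition gaussian_prime :: "complex \<Rightarrow> bool" where
  "gaussian_prime p \<longleftrightarrow> p \<in> gaussian_ints \<and> ring_prime\<^bsub>gaussian_ring\<^esub> p"

definition gaussian_cong :: "complex \<Rightarrow> complex \<Rightarrow> complex \<Rightarrow> bool" where
  "gaussian_cong a b m \<longleftrightarrow> m divides\<^bsub>gaussian_ring\<^esub> (a - b)"

lemma subfield_gaussian_rats: "subfield gaussian_rats ring_of_type_algebra"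
proof -
  interpret C: field "ring_of_type_algebra :: complex ring" by rule
  have a_inv: "\<ominus>\<^bsub>ring_of_type_algebra\<^esub> z = - z" for z :: complex
    by (rule C.sum_zero_eq_neg[symmetric]) (simp_all add: ring_of_type_algebra_def)
  have m_inv: "inv\<^bsub>ring_of_type_algebra\<^esub> z = inverse z" if "z \<noteq> 0" for z :: complex
    using that by (intro C.comm_inv_char) (simp_all add: ring_of_type_algebra_def)
  show ?thesis
  proof (rule C.subfieldI')
    show "subring gaussian_rats ring_of_type_algebra"
      by (rule C.subringI)
        (auto simp: a_inv, auto simp: gaussian_rats_def ring_of_type_algebra_def)
  next
    fix k :: complex
    assume "k \<in> gaussian_rats - {\<zero>\<^bsub>ring_of_type_algebra\<^esub>}"
    thus "inv\<^bsub>ring_of_type_algebra\<^esub> k \<in> gaussian_rats"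
      using m_inv[of k] by (auto simp: gaussian_rats_def ring_of_type_algebra_def)
  qed
qed

end

theory Submission
  imports Defs "HOL-Number_Theory.Number_Theory"
begin

text \<open>
  Put \<open>\<pi>\<^sub>j = \<beta> + \<i>\<^sup>j k (1 + \<i>)\<close> and \<open>n = \<beta>\<^sup>4 + 4 k\<^sup>4 = \<pi>\<^sub>0 \<pi>\<^sub>1 \<pi>\<^sub>2 \<pi>\<^sub>3\<close>.  The curve \<open>y\<^sup>2 = x\<^sup>3 - n\<^sup>2 x\<close> has complex
  multiplication by \<open>\<int>[\<i>]\<close>, and one descends along \<open>1 + \<i>\<close>, whose kernel is \<open>{O, (0, 0)}\<close>.  Quadratic residue
  symbols of the \<open>\<pi>\<^sub>j\<close> (reciprocity makes the symbols of \<open>k\<close> over \<open>\<pi>\<^sub>0\<close> and \<open>\<pi>\<^sub>2\<close> agree, and likewise over \<open>\<pi>\<^sub>1\<close> and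
  \<open>\<pi>\<^sub>3\<close>) show that abscissas of points lie only in the square classes of \<open>1, n, \<i> \<pi>\<^sub>1 \<pi>\<^sub>3, \<i> \<pi>\<^sub>0 \<pi>\<^sub>2\<close>, which are
  generated by \<open>(n, 0)\<close> and an explicit point.  Heights then give \<open>E(\<rat>(\<i>)) = \<int>[\<i>] P\<^sub>0 \<oplus> E[2]\<close>.  The curve is genuinely
  defined over \<open>\<rat>(\<i>)\<close> since a real \<open>c\<^sub>4\<close> would make the norm of \<open>n\<close> a square.
\<close>


text \<open>Over the complex numbers each of these curves becomes \<open>y^2 = x^3 - x\<close>, so
  the group law is established once, for the complex points of that fixed curve, and the twist by n
  survives only as a rationality condition involving a square root of n. The class of -1-6i modulo
  16 makes i and 2 nonresidues and 1+i a residue modulo each of the four primes. Their differences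
  are units times 2k or 2k(1+i), so every symbol between two of them is, up to a known sign, a
  symbol of k. The residue conditions only bound the points modulo multiplication by 1+i. The module
  structure is then obtained with neither canonical heights nor a structure theorem: naive heights
  show that a single nonzero D carries every rational point into Z[i]Q, where Q is the explicit
  point, and Euclidean division among the resulting multipliers yields a generator modulo torsion.
  Odd torsion is excluded by a filtration of the denominators at 1+i; what remains is killed by 2
  because T and iT, with T = (n, 0), are not multiples of 1+i.\<close>

section \<open>Chords and tangents of y^2 = x^3 + a x + b\<close>

text \<open>Coefficient comparison between \<open>x^3 + a x + b - (l x + m)^2\<close> and the
  product of the \<open>x - xj\<close>: the line of slope \<open>l\<close> and intercept
  \<open>m\<close> meets the curve at these three abscissas, counted with multiplicity. Chords and
  tangents are thereby treated alike.\<close>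

definition vieta :: "complex \<Rightarrow> complex \<Rightarrow> complex \<Rightarrow> complex \<Rightarrow> complex \<Rightarrow> complex \<Rightarrow> complex \<Rightarrow> bool" where
  "vieta a b l m x1 x2 x3 \<longleftrightarrow>
     x1 + x2 + x3 = l^2 \<and> x1 * x2 + x2 * x3 + x3 * x1 = a - 2 * l * m \<and> x1 * x2 * x3 = m^2 - b"

lemma vieta_permute:
  assumes "vieta a b l m x1 x2 x3"
  shows "vieta a b l m x2 x1 x3" "vieta a b l m x3 x1 x2" "vieta a b l m x1 x3 x2"
  using assms by (simp_all add: vieta_def algebra_simps)

lemma vieta_on_curve:
  assumes "vieta a b l m x1 x2 x3"
  shows "(l * x1 + m)^2 = x1^3 + a * x1 + b" "(l * x2 + m)^2 = x2^3 + a * x2 + b"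
    "(l * x3 + m)^2 = x3^3 + a * x3 + b"
  using assms unfolding vieta_def by Groebner_Basis.algebra+

lemma vieta_chord:
  assumes "(l * x1 + m)^2 = x1^3 + a * x1 + b" "(l * x2 + m)^2 = x2^3 + a * x2 + b" "x1 \<noteq> x2"
  shows "vieta a b l m x1 x2 (l^2 - x1 - x2)"
proof -
  have "(x1 - x2) * (l^2 * (x1 + x2) + 2 * l * m) = (x1 - x2) * (x1^2 + x1 * x2 + x2^2 + a)"
    using assms(1,2) by Groebner_Basis.algebra
  hence e2: "l^2 * (x1 + x2) + 2 * l * m = x1^2 + x1 * x2 + x2^2 + a"
    using assms(3) by simp
  show ?thesis
    unfolding vieta_def
  proof (intro conjI)
    show "x1 * x2 + x2 * (l^2 - x1 - x2) + (l^2 - x1 - x2) * x1 = a - 2 * l * m"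
      using e2 by Groebner_Basis.algebra
    show "x1 * x2 * (l^2 - x1 - x2) = m^2 - b"
      using e2 assms(1) by Groebner_Basis.algebra
  qed simp
qed

lemma vieta_tangent:
  assumes "(l * x + m)^2 = x^3 + a * x + b" "2 * l * (l * x + m) = 3 * x^2 + a"
  shows "vieta a b l m x x (l^2 - x - x)"
  unfolding vieta_def
proof (intro conjI)
  show "x * x + x * (l^2 - x - x) + (l^2 - x - x) * x = a - 2 * l * m"
    using assms by Groebner_Basis.algebra
  show "x * x * (l^2 - x - x) = m^2 - b"
    using assms by Groebner_Basis.algebra
qed simp

text \<open>The case distinction of \<open>ec_add\<close> is absorbed here: afterwards a sum is
  described by a line and \<open>vieta\<close>. The last clause keeps the tangent slope available,
  since a double point on a line carries it.\<close>

lemma ec_add_affine: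
  fixes x1 y1 x2 y2 :: complex
  assumes "y1^2 = x1^3 + a * x1 + b" "y2^2 = x2^3 + a * x2 + b" "\<not> (x1 = x2 \<and> y1 + y2 = 0)"
  obtains l m x3 where "y1 = l * x1 + m" "y2 = l * x2 + m" "vieta a b l m x1 x2 x3"
    "ec_add (Weierstrass 0 0 0 a b) (Affine x1 y1) (Affine x2 y2) = Affine x3 (- (l * x3 + m))"
    "x1 = x2 \<Longrightarrow> 2 * l * y1 = 3 * x1^2 + a"
proof -
  define l where "l = (if x1 = x2 then (3 * x1^2 + a) / (2 * y1) else (y2 - y1) / (x2 - x1))"
  define m where "m = y1 - l * x1"
  have y1: "y1 = l * x1 + m" by (simp add: m_def)
  have add: "ec_add (Weierstrass 0 0 0 a b) (Affine x1 y1) (Affine x2 y2)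
      = Affine (l^2 - x1 - x2) (- (l * (l^2 - x1 - x2) + m))"
    using assms(3) by (auto simp: Let_def l_def m_def)
  show ?thesis
  proof (cases "x1 = x2")
    case True
    have "(y1 - y2) * (y1 + y2) = 0" using assms(1,2) True by Groebner_Basis.algebra
    hence y2: "y2 = y1" using assms(3) True by auto
    hence "y1 \<noteq> 0" using assms(3) True by auto
    hence t: "2 * l * y1 = 3 * x1^2 + a" using True by (simp add: l_def)
    have "vieta a b l m x1 x1 (l^2 - x1 - x1)"
      using t assms(1) by (intro vieta_tangent) (simp_all flip: y1)
    thus ?thesis using that[OF y1 _ _ add] y2 y1 True t by simp
  next
    case False
    have "l * (x2 - x1) = y2 - y1" using False by (simp add: l_def)
    hence y2: "y2 = l * x2 + m" unfolding m_def by (simp add: algebra_simps)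
    show ?thesis
      by (rule that[OF y1 y2 _ add]) (use False assms y1 y2 in \<open>auto intro!: vieta_chord\<close>)
  qed
qed

lemma ec_add_eqI:
  assumes "y1^2 = x1^3 + a * x1 + b" "y2^2 = x2^3 + a * x2 + b" "vieta a b l m x1 x2 x3"
    "y1 = l * x1 + m" "y2 = l * x2 + m" "x1 \<noteq> x2"
  shows "ec_add (Weierstrass 0 0 0 a b) (Affine x1 y1) (Affine x2 y2) = Affine x3 (- (l * x3 + m))"
proof -
  from ec_add_affine[OF assms(1,2)] assms(6)
  obtain l' m' x3' where *: "y1 = l' * x1 + m'" "y2 = l' * x2 + m'" "vieta a b l' m' x1 x2 x3'"
    "ec_add (Weierstrass 0 0 0 a b) (Affine x1 y1) (Affine x2 y2) = Affine x3' (- (l' * x3' + m'))"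
    by metis
  have "(l - l') * (x1 - x2) = 0" using *(1,2) assms(4,5) by Groebner_Basis.algebra
  hence "l' = l" using assms(6) by simp
  moreover from this have "m' = m" using * assms(4) by simp
  moreover from calculation have "x3' = x3" using * assms(3) by (auto simp: vieta_def) (metis add_left_cancel)
  ultimately show ?thesis using * by simp
qed

text \<open>
  With \<open>D\<close> the common point of two lines, dividing the product of the lines by \<open>x - xD\<close> gives the function \<open>x\<^sup>2 + c1 x + c2 y + c0\<close> on the curve, which vanishes at the four
  remaining points.  Two ways of bracketing a sum of three points give the same function.
\<close>

lemma conic_vanishes:
  assumes "vieta a b l m x1 x2 xD" "l * xD + m = - (l' * xD + m')"
  shows "x1^2 + (xD + l * l') * x1 - (l + l') * (l * x1 + m)
           + (xD^2 + a + l' * (l * xD + m) + l * (l' * xD + m') - l * l' * xD) = 0"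
  using assms unfolding vieta_def by Groebner_Basis.algebra

text \<open>When both lines pass through the same point, the product of the lines vanishes there to
  order two, so the derivative of the conic along the tangent of slope \<open>k\<close> is zero.
  This replaces the second point of a chord when two of the points coincide.\<close>

lemma conic_tangent:
  assumes "vieta a b l m x1 x2 xD" "l * xD + m = - (l' * xD + m')" "l' * x1 + m' = l * x1 + m" 
    "2 * k * (l * x1 + m) = 3 * x1^2 + a" "x1 \<noteq> xD"
  shows "xD + l * l' - (l + l') * k = - (x1 + x1)"
proof -
  have "(x1 - xD) * (xD + l * l' - (l + l') * k + x1 + x1) = 0"
    using assms(1-4) unfolding vieta_def by Groebner_Basis.algebra
  thus ?thesis using assms(5) by (simp add: eq_neg_iff_add_eq_0 add.assoc)
qed

text \<open>Lines: \<open>l1\<close> through \<open>A, B, -D\<close>, \<open>l2\<close> through \<open>D, R, -F\<close>, \<open>l3\<close> through \<open>B, R, -E\<close>, \<open>l4\<close> through \<open>A, E, -F'\<close>,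
  where \<open>F = (A + B) + R\<close> and \<open>F' = A + (B + R)\<close>.\<close>

lemma vieta_assoc:
  assumes 1: "vieta a b l1 m1 xA xB xD" "yA = l1 * xA + m1" "yB = l1 * xB + m1" "- yD = l1 * xD + m1"
    and 2: "vieta a b l2 m2 xD xR xF" "yD = l2 * xD + m2" "yR = l2 * xR + m2" "- yF = l2 * xF + m2"
    and 3: "vieta a b l3 m3 xB xR xE" "yB = l3 * xB + m3" "yR = l3 * xR + m3" "- yE = l3 * xE + m3"
    and 4: "vieta a b l4 m4 xA xE xF'" "yA = l4 * xA + m4" "yE = l4 * xE + m4" "- yF' = l4 * xF' + m4"
    and tangent: "xA = xB \<Longrightarrow> yA = yB \<and> 2 * l1 * yA = 3 * xA^2 + a"
    and generic: "xR \<noteq> xA" "xR \<noteq> xB" "xR \<noteq> xD" "xE \<noteq> xA"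
  shows "xF = xF' \<and> yF = yF'"
proof -
  define c1 c2 c0 where "c1 = xD + l1 * l2" and "c2 = l1 + l2"
    and "c0 = xD^2 + a + l2 * (l1 * xD + m1) + l1 * (l2 * xD + m2) - l1 * l2 * xD"
  define d1 d2 d0 where "d1 = xE + l3 * l4" and "d2 = l3 + l4"
    and "d0 = xE^2 + a + l4 * (l3 * xE + m3) + l3 * (l4 * xE + m4) - l3 * l4 * xE"
  note c_defs = c1_def c2_def c0_def and d_defs = d1_def d2_def d0_def
  have cA: "xA^2 + c1 * xA - c2 * yA + c0 = 0" and cB: "xB^2 + c1 * xB - c2 * yB + c0 = 0"
    using conic_vanishes[OF 1(1), of l2 m2] conic_vanishes[OF vieta_permute(1)[OF 1(1)], of l2 m2] 1 2
    by (simp_all add: c_defs algebra_simps)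
  have cR: "xR^2 + c1 * xR - c2 * yR + c0 = 0" and cF: "xF^2 + c1 * xF + c2 * yF + c0 = 0"
  proof -
    have v: "vieta a b l2 m2 xR xF xD" "vieta a b l2 m2 xF xR xD" using 2(1) by (simp_all add: vieta_def algebra_simps)
    have e: "l2 * xD + m2 = - (l1 * xD + m1)" using 1(4) 2(2) by Groebner_Basis.algebra
    show "xR^2 + c1 * xR - c2 * yR + c0 = 0"
      using conic_vanishes[OF v(1) e] 2(3) by (simp add: c_defs algebra_simps)
    have yF: "yF = - (l2 * xF + m2)" using 2(4) by Groebner_Basis.algebra
    show "xF^2 + c1 * xF + c2 * yF + c0 = 0"
      using conic_vanishes[OF v(2) e] unfolding yF by (simp add: c_defs algebra_simps)
  qed
  have dB: "xB^2 + d1 * xB - d2 * yB + d0 = 0" and dR: "xR^2 + d1 * xR - d2 * yR + d0 = 0"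
    using conic_vanishes[OF 3(1), of l4 m4] conic_vanishes[OF vieta_permute(1)[OF 3(1)], of l4 m4] 3 4
    by (simp_all add: d_defs algebra_simps)
  have dA: "xA^2 + d1 * xA - d2 * yA + d0 = 0" and dF: "xF'^2 + d1 * xF' + d2 * yF' + d0 = 0"
  proof -
    have v: "vieta a b l4 m4 xA xF' xE" "vieta a b l4 m4 xF' xA xE" using 4(1) by (simp_all add: vieta_def algebra_simps)
    have e: "l4 * xE + m4 = - (l3 * xE + m3)" using 3(4) 4(3) by Groebner_Basis.algebra
    show "xA^2 + d1 * xA - d2 * yA + d0 = 0"
      using conic_vanishes[OF v(1) e] 4(2) by (simp add: d_defs algebra_simps)
    have yF: "yF' = - (l4 * xF' + m4)" using 4(4) by Groebner_Basis.algebra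
    show "xF'^2 + d1 * xF' + d2 * yF' + d0 = 0"
      using conic_vanishes[OF v(2) e] unfolding yF by (simp add: d_defs algebra_simps)
  qed
  \<comment> \<open>Restricted to a line, the conic is a monic quadratic in x. On the line of slope
    \<open>l1\<close> its roots are \<open>xA\<close> and \<open>xB\<close>, on that of slope
    \<open>l3\<close> they are \<open>xB\<close> and \<open>xR\<close>. Both conics thus satisfy the
    same two linear equations, which determine them because \<open>l1\<close> and \<open>l3\<close>
    differ.\<close>
  have c_l1: "c1 - c2 * l1 = - (xA + xB)"
    using 1(1) unfolding vieta_def c_defs by Groebner_Basis.algebra
  have d_l3: "d1 - d2 * l3 = - (xB + xR)"
    using 3(1) unfolding vieta_def d_defs by Groebner_Basis.algebra
  have c_l3: "c1 - c2 * l3 = - (xB + xR)"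
  proof -
    have "(xB - xR) * (c1 - c2 * l3 + (xB + xR)) = 0"
      using cB cR 3(2,3) by Groebner_Basis.algebra
    hence "c1 - c2 * l3 + (xB + xR) = 0" using generic by simp
    thus ?thesis by Groebner_Basis.algebra
  qed
  have d_l1: "d1 - d2 * l1 = - (xA + xB)"
  proof (cases "xA = xB")
    case True
    have "d1 - d2 * l1 = - (xA + xA)"
      unfolding d_defs
    proof (rule conic_tangent)
      show "vieta a b l3 m3 xA xR xE" using 3 True by simp
      show "l3 * xE + m3 = - (l4 * xE + m4)" using 3(4) 4(3) by Groebner_Basis.algebra
      show "l4 * xA + m4 = l3 * xA + m3" using 4 3 True tangent by simp
      show "2 * l1 * (l3 * xA + m3) = 3 * xA\<^sup>2 + a" using 3(2) True tangent by metis
    qed (use generic in auto)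
    thus ?thesis using True by simp
  next
    case False
    have "(xA - xB) * (d1 - d2 * l1 + (xA + xB)) = 0"
      using dA dB 1(2,3) by Groebner_Basis.algebra
    hence "d1 - d2 * l1 + (xA + xB) = 0" using False by simp
    thus ?thesis by Groebner_Basis.algebra
  qed
  have "l1 \<noteq> l3"
    using c_l1 c_l3 generic by auto
  moreover have "(c2 - d2) * (l1 - l3) = 0"
    using c_l1 c_l3 d_l1 d_l3 by Groebner_Basis.algebra
  ultimately have c2: "d2 = c2" by simp
  hence c1: "d1 = c1" using c_l1 d_l1 unfolding diff_eq_eq c2 by simp
  have c0: "d0 = c0" using cR dR c1 c2 by Groebner_Basis.algebra
  \<comment> \<open>Eliminating y between conic and cubic gives a quartic in x whose roots sum to
    \<open>c2^2 - 2 * c1\<close>, so three of them determine the fourth.\<close>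
  have "xF = c2^2 - 2 * c1 - xA - xB - xR"
    using 1(1) 2(1) unfolding c_defs vieta_def by Groebner_Basis.algebra
  moreover have "xF' = d2^2 - 2 * d1 - xA - xB - xR"
    using 3(1) 4(1) unfolding d_defs vieta_def by Groebner_Basis.algebra
  ultimately have x: "xF' = xF" using c1 c2 by simp
  have "c2 \<noteq> 0" using c_l1 c_l3 generic by auto
  moreover have "c2 * (yF - yF') = 0"
    using cF dF unfolding x c0 c1 c2 by Groebner_Basis.algebra
  ultimately show ?thesis using x by simp
qed


section \<open>The group of complex points on y^2 = x^3 - x\<close>

typedef pt = "{P :: complex ec_point. case P of Infinity \<Rightarrow> True | Affine x y \<Rightarrow> y^2 = x^3 - x}"
  morphisms of_pt to_pt
  by (rule exI[of _ Infinity]) simp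

definition Pt :: "complex \<Rightarrow> complex \<Rightarrow> pt" where "Pt x y = to_pt (Affine x y)"

text \<open>The default 0 at infinity lets 0 count as a point with rational coordinates and makes
  \<open>xc P = 0\<close> hold exactly on the kernel of \<open>phi\<close>.\<close>

definition xc :: "pt \<Rightarrow> complex" where "xc P = (case of_pt P of Infinity \<Rightarrow> 0 | Affine x y \<Rightarrow> x)"

definition yc :: "pt \<Rightarrow> complex" where "yc P = (case of_pt P of Infinity \<Rightarrow> 0 | Affine x y \<Rightarrow> y)"

abbreviation (input) curve :: "complex weierstrass" where "curve \<equiv> Weierstrass 0 0 0 (- 1) 0"

instantiation pt :: "{zero,plus,uminus,minus}"
begin
definition "zero_pt = to_pt Infinity"
definition "plus_pt P Q = to_pt (ec_add curve (of_pt P) (of_pt Q))"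
definition "uminus_pt P = (case of_pt P of Infinity \<Rightarrow> 0 | Affine x y \<Rightarrow> Pt x (- y))"
definition "minus_pt (P :: pt) Q = P + (- Q)"
instance ..
end

lemma of_pt_zero [simp]: "of_pt 0 = Infinity"
  by (simp add: zero_pt_def to_pt_inverse)

lemma of_pt_Pt [simp]: "y^2 = x^3 - x \<Longrightarrow> of_pt (Pt x y) = Affine x y"
  by (simp add: Pt_def to_pt_inverse)

lemma coords_Pt [simp]: "y^2 = x^3 - x \<Longrightarrow> xc (Pt x y) = x" "y^2 = x^3 - x \<Longrightarrow> yc (Pt x y) = y"
  by (simp_all add: xc_def yc_def)

lemma coords_zero [simp]: "xc 0 = 0" "yc 0 = 0"
  by (simp_all add: xc_def yc_def)

lemma pt_cases:
  fixes P :: pt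
  obtains "P = 0" | x y where "y^2 = x^3 - x" "P = Pt x y"
proof (cases "of_pt P")
  case Infinity
  hence "P = 0" using of_pt_inverse[of P] by (simp add: zero_pt_def)
  thus ?thesis by (rule that(1))
next
  case (Affine x y)
  hence "y^2 = x^3 - x" "P = Pt x y" using of_pt[of P] of_pt_inverse[of P] by (simp_all add: Pt_def)
  thus ?thesis by (rule that(2))
qed

lemma nonzero_ptE:
  assumes "P \<noteq> 0"
  obtains x y where "y^2 = x^3 - x" "P = Pt x y"
  using assms by (cases P rule: pt_cases) auto

lemma Pt_neq_0: "y^2 = x^3 - x \<Longrightarrow> Pt x y \<noteq> 0"
  by (metis ec_point.distinct(1) of_pt_Pt of_pt_zero)

lemma Pt_coords: "P \<noteq> 0 \<Longrightarrow> Pt (xc P) (yc P) = P"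
  by (cases P rule: pt_cases) auto

lemma coords_on_curve: "yc P ^ 2 = xc P ^ 3 - xc P"
  by (cases P rule: pt_cases) auto

lemma minus_zero_pt: "- (0 :: pt) = 0"
  by (simp add: uminus_pt_def)

lemma minus_Pt: "y^2 = x^3 - x \<Longrightarrow> - Pt x y = Pt x (- y)"
  by (simp add: uminus_pt_def)

lemma zero_add_pt: "0 + P = (P :: pt)"
  by (simp add: plus_pt_def of_pt_inverse)

lemma add_zero_pt: "P + 0 = (P :: pt)"
  by (cases P rule: pt_cases) (simp_all add: plus_pt_def zero_add_pt Pt_def zero_pt_def to_pt_inverse)

lemma Pt_add_opposite: "y^2 = x^3 - x \<Longrightarrow> Pt x y + Pt x (- y) = 0"
  by (simp add: plus_pt_def zero_pt_def)

lemma Pt_add: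
  assumes "y1^2 = x1^3 - x1" "y2^2 = x2^3 - x2" "\<not> (x1 = x2 \<and> y1 + y2 = 0)"
  obtains l m x3 where "y1 = l * x1 + m" "y2 = l * x2 + m" "vieta (- 1) 0 l m x1 x2 x3"
    "(- (l * x3 + m))^2 = x3^3 - x3"
    "Pt x1 y1 + Pt x2 y2 = Pt x3 (- (l * x3 + m))"
    "x1 = x2 \<Longrightarrow> 2 * l * y1 = 3 * x1^2 - 1"
proof -
  have c: "y1^2 = x1^3 + (- 1) * x1 + 0" "y2^2 = x2^3 + (- 1) * x2 + 0" using assms by simp_all
  obtain l m x3 where *: "y1 = l * x1 + m" "y2 = l * x2 + m" "vieta (- 1) 0 l m x1 x2 x3"
    "ec_add (Weierstrass 0 0 0 (- 1) 0) (Affine x1 y1) (Affine x2 y2) = Affine x3 (- (l * x3 + m))"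
    "x1 = x2 \<Longrightarrow> 2 * l * y1 = 3 * x1^2 + - 1"
    using ec_add_affine[OF c assms(3)] by metis
  have "(- (l * x3 + m))^2 = x3^3 - x3"
    using vieta_on_curve(3)[OF *(3)] unfolding power2_minus by simp
  with * show ?thesis using that assms by (auto simp: plus_pt_def Pt_def to_pt_inverse)
qed

lemma Pt_add_eqI:
  assumes "y1^2 = x1^3 - x1" "y2^2 = x2^3 - x2" "vieta (- 1) 0 l m x1 x2 x3"
    "y1 = l * x1 + m" "y2 = l * x2 + m" "x1 \<noteq> x2"
  shows "Pt x1 y1 + Pt x2 y2 = Pt x3 (- (l * x3 + m))"
proof -
  have c: "y1^2 = x1^3 + (- 1) * x1 + 0" "y2^2 = x2^3 + (- 1) * x2 + 0" using assms by simp_all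
  show ?thesis using ec_add_eqI[OF c assms(3-6)] assms(1,2) by (simp add: plus_pt_def Pt_def to_pt_inverse)
qed

lemma same_x:
  assumes "y1^2 = x^3 - x" "y2^2 = x^3 - (x :: complex)" "y1 + y2 \<noteq> 0"
  shows "y1 = y2"
proof -
  have "(y1 - y2) * (y1 + y2) = 0" using assms by Groebner_Basis.algebra
  thus ?thesis using assms by simp
qed

lemma add_commute_pt: "P + Q = Q + (P :: pt)"
proof (cases P rule: pt_cases; cases Q rule: pt_cases)
  fix x1 y1 x2 y2
  assume P: "y1^2 = x1^3 - x1" "P = Pt x1 y1" and Q: "y2^2 = x2^3 - x2" "Q = Pt x2 y2"
  show ?thesis
  proof (cases "x1 = x2")
    case True
    thus ?thesis using P Q same_x[of y1 x1 y2] Pt_add_opposite[of y1 x1] Pt_add_opposite[of y2 x1]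
      by (metis add.commute add_eq_0_iff)
  next
    case False
    then obtain l m x3 where "y1 = l * x1 + m" "y2 = l * x2 + m" "vieta (- 1) 0 l m x1 x2 x3"
      "Pt x1 y1 + Pt x2 y2 = Pt x3 (- (l * x3 + m))"
      using Pt_add[OF P(1) Q(1)] by metis
    thus ?thesis using P Q False by (metis Pt_add_eqI vieta_permute(1))
  qed
qed (simp_all add: zero_add_pt add_zero_pt)

text \<open>If \<open>A + R\<close> and \<open>R\<close> have the same abscissa, then the line through \<open>A\<close> and \<open>R\<close> is the tangent at \<open>R\<close>.\<close>

lemma generic_cancel:
  assumes "A \<noteq> 0" "R \<noteq> 0" "xc A \<noteq> xc R"
  shows "(A + R) + (- R) = A"
proof -
  obtain xA yA where A: "yA^2 = xA^3 - xA" "A = Pt xA yA" using assms(1) by (rule nonzero_ptE)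
  obtain xR yR where R: "yR^2 = xR^3 - xR" "R = Pt xR yR" using assms(2) by (rule nonzero_ptE)
  have ne: "xA \<noteq> xR" using assms(3) A R by simp
  then obtain l m x3 where *: "yA = l * xA + m" "yR = l * xR + m" "vieta (- 1) 0 l m xA xR x3"
      "Pt xA yA + Pt xR yR = Pt x3 (- (l * x3 + m))" "(- (l * x3 + m))^2 = x3^3 - x3"
    using Pt_add[OF A(1) R(1)] by metis
  have R': "(- yR)^2 = xR^3 - xR" using R by simp
  have "Pt x3 (- (l * x3 + m)) + Pt xR (- yR) = Pt xA yA"
  proof (cases "x3 = xR")
    case False
    moreover have "vieta (- 1) 0 (- l) (- m) x3 xR xA" using *(3) by (simp add: vieta_def algebra_simps)
    ultimately have "Pt x3 (- (l * x3 + m)) + Pt xR (- yR) = Pt xA (- (- l * xA + - m))"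
      using * R' by (intro Pt_add_eqI) auto
    thus ?thesis using *(1) by (simp add: add.commute)
  next
    case True
    have l: "2 * l * yR = 3 * xR^2 - 1" and xA: "xA = l^2 - 2 * xR"
      using *(2,3) unfolding vieta_def True by Groebner_Basis.algebra+
    \<comment> \<open>The curve is smooth: \<open>x^3 - x\<close> and its derivative
      \<open>3 x^2 - 1\<close> have no common root.\<close>
    have "yR \<noteq> 0"
    proof
      assume "yR = 0"
      hence "(2 :: complex) = 0" using l R(1) by Groebner_Basis.algebra
      thus False by simp
    qed
    hence ne: "\<not> (xR = xR \<and> - yR + - yR = 0)" by simp
    obtain l' m' x' where 2: "- yR = l' * xR + m'" "vieta (- 1) 0 l' m' xR xR x'"
      "Pt xR (- yR) + Pt xR (- yR) = Pt x' (- (l' * x' + m'))" "2 * l' * (- yR) = 3 * xR^2 - 1"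
      by (rule Pt_add[OF R' R' ne]) simp
    have "2 * yR * (l' + l) = 0" using 2(4) l by Groebner_Basis.algebra
    hence l': "l' = - l" using \<open>yR \<noteq> 0\<close> by (simp add: eq_neg_iff_add_eq_0)
    have "x' = xA" using 2(2) xA l' unfolding vieta_def by Groebner_Basis.algebra
    moreover have "- (l' * xA + m') = yA" using 2(1) *(1,2) l' by Groebner_Basis.algebra
    moreover have "- (l * x3 + m) = - yR" using *(2) True by simp
    ultimately show ?thesis using 2(3) True by simp
  qed
  thus ?thesis using *(4) A R by (simp add: minus_Pt)
qed

text \<open>Makes the filter \<open>cofinite\<close> nontrivial, so that a statement not involving R
  follows once it is known for almost all R.\<close>

lemma infinite_pt: "infinite (UNIV :: pt set)"
proof
  assume "finite (UNIV :: pt set)"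
  moreover have "range xc = UNIV"
  proof -
    have "xc (Pt x (csqrt (x^3 - x))) = x" for x by simp
    thus ?thesis by (metis surj_def)
  qed
  ultimately show False
    using infinite_UNIV_char_0[where ?'a = complex] by (metis finite_imageI)
qed

lemma finite_xc_fibre: "finite S \<Longrightarrow> finite {R. R = 0 \<or> xc R \<in> S}"
proof -
  assume S: "finite S"
  have "{R. R = 0 \<or> xc R \<in> S} \<subseteq> insert 0 (\<Union>x\<in>S. {Pt x (csqrt (x^3 - x)), Pt x (- csqrt (x^3 - x))})"
  proof
    fix R assume R: "R \<in> {R. R = 0 \<or> xc R \<in> S}"
    show "R \<in> insert 0 (\<Union>x\<in>S. {Pt x (csqrt (x^3 - x)), Pt x (- csqrt (x^3 - x))})"
    proof (cases "R = 0")
      case False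
      have "yc R ^ 2 = csqrt (xc R ^ 3 - xc R) ^ 2" by (simp add: coords_on_curve)
      hence "yc R = csqrt (xc R ^ 3 - xc R) \<or> yc R = - csqrt (xc R ^ 3 - xc R)" 
        by (simp only: power2_eq_iff)
      hence "R = Pt (xc R) (csqrt (xc R ^ 3 - xc R)) \<or> R = Pt (xc R) (- csqrt (xc R ^ 3 - xc R))"
        using Pt_coords[OF False] by metis
      thus ?thesis using R False by blast
    qed simp
  qed
  thus ?thesis using S finite_subset by fastforce
qed

lemma eventually_xc: "finite S \<Longrightarrow> eventually (\<lambda>R. R \<noteq> 0 \<and> xc R \<notin> S) cofinite"
  using finite_xc_fibre by (simp add: eventually_cofinite)

text \<open>Cancellation is not yet known in general. Where \<open>generic_cancel\<close> applies, R
  is recovered from T; the other R are 0 or share the abscissa of A, and those are finitely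
  many.\<close>

lemma finite_add_fibre: "finite {R. A + R = (T :: pt)}"
proof (cases "A = 0")
  case True
  thus ?thesis by (simp add: zero_add_pt)
next
  case False
  have "R \<in> insert (T + (- A)) {R. R = 0 \<or> xc R \<in> {xc A}}" if "A + R = T" for R
  proof (cases "R = 0 \<or> xc R = xc A")
    case False
    hence "(R + A) + (- A) = R" using \<open>A \<noteq> 0\<close> by (intro generic_cancel) auto
    thus ?thesis using that by (simp add: add_commute_pt)
  qed simp
  hence "{R. A + R = T} \<subseteq> insert (T + (- A)) {R. R = 0 \<or> xc R \<in> {xc A}}" by blast
  moreover have "finite (insert (T + (- A)) {R. R = 0 \<or> xc R \<in> {xc A}})"
    using finite_xc_fibre[of "{xc A}"] by blast
  ultimately show ?thesis by (rule finite_subset)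
qed

lemma filterlim_add_pt: "filterlim (\<lambda>R. A + R :: pt) cofinite cofinite"
  unfolding filterlim_def le_filter_def eventually_filtermap eventually_cofinite
proof (intro allI impI)
  fix P :: "pt \<Rightarrow> bool" assume "finite {x. \<not> P x}"
  moreover have "{x. \<not> P (A + x)} = (\<Union>T\<in>{x. \<not> P x}. {R. A + R = T})" by auto
  ultimately show "finite {x. \<not> P (A + x)}" using finite_add_fibre by auto
qed

text \<open>The hypotheses of \<open>vieta_assoc\<close> exclude finitely many abscissas of R and of
  \<open>B + R\<close>. Translations have finite fibres, so only finitely many R are lost.\<close>

lemma generic_assoc: "eventually (\<lambda>R. (A + B) + R = A + (B + R :: pt)) cofinite"
proof (cases "A = 0 \<or> B = 0")
  case True
  thus ?thesis by (auto simp: zero_add_pt add_zero_pt)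
next
  case False
  obtain xA yA where A: "yA^2 = xA^3 - xA" "A = Pt xA yA" using False nonzero_ptE[of A] by blast
  obtain xB yB where B: "yB^2 = xB^3 - xB" "B = Pt xB yB" using False nonzero_ptE[of B] by blast
  have gen: "eventually (\<lambda>R. (R \<noteq> 0 \<and> xc R \<notin> {xA, xB, xc (A + B)}) \<and> B + R \<noteq> 0 \<and> xc (B + R) \<notin> {xA}) cofinite"
    unfolding conj_assoc
    by (rule eventually_conj[OF eventually_xc eventually_compose_filterlim[OF eventually_xc filterlim_add_pt],
          unfolded conj_assoc]) auto
  show ?thesis
  proof (cases "xA = xB \<and> yA + yB = 0")
    case True
    hence "yB = - yA" by (metis add_eq_0_iff)
    hence AB: "A = - B" "A + B = 0"
      using A B True by (auto simp: minus_Pt Pt_add_opposite)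
    from gen show ?thesis
    proof eventually_elim
      case (elim R)
      have "(R + B) + (- B) = R"
        using elim A B True False by (intro generic_cancel) (auto simp: add_commute_pt)
      thus ?case using AB by (simp add: zero_add_pt add_commute_pt)
    qed
  next
    case ne: False
    obtain l1 m1 xD where 1: "yA = l1 * xA + m1" "yB = l1 * xB + m1" "vieta (- 1) 0 l1 m1 xA xB xD"
      "(- (l1 * xD + m1))^2 = xD^3 - xD" "A + B = Pt xD (- (l1 * xD + m1))"
      "xA = xB \<Longrightarrow> 2 * l1 * yA = 3 * xA^2 - 1"
      by (rule Pt_add[OF A(1) B(1) ne]) (use A(2) B(2) in blast)
    from gen show ?thesis
    proof eventually_elim
      case (elim R)
      obtain xR yR where R: "yR^2 = xR^3 - xR" "R = Pt xR yR" using elim nonzero_ptE[of R] by blast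
      have g: "xR \<noteq> xA" "xR \<noteq> xB" "xR \<noteq> xD" using elim 1 R by auto
      obtain l2 m2 xF where 2: "- (l1 * xD + m1) = l2 * xD + m2" "yR = l2 * xR + m2" "vieta (- 1) 0 l2 m2 xD xR xF"
        "(A + B) + R = Pt xF (- (l2 * xF + m2))"
        by (rule Pt_add[OF 1(4) R(1)]) (use g(3) 1(5) R(2) in auto)
      obtain l3 m3 xE where 3: "yB = l3 * xB + m3" "yR = l3 * xR + m3" "vieta (- 1) 0 l3 m3 xB xR xE"
        "(- (l3 * xE + m3))^2 = xE^3 - xE" "B + R = Pt xE (- (l3 * xE + m3))"
        by (rule Pt_add[OF B(1) R(1)]) (use g(2) B(2) R(2) in auto)
      have g': "xE \<noteq> xA" using elim 3 by auto
      obtain l4 m4 xF' where 4: "yA = l4 * xA + m4" "- (l3 * xE + m3) = l4 * xE + m4" "vieta (- 1) 0 l4 m4 xA xE xF'"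
        "A + (B + R) = Pt xF' (- (l4 * xF' + m4))"
        by (rule Pt_add[OF A(1) 3(4)]) (use g' A(2) 3(5) in auto)
      have "xF = xF' \<and> - (l2 * xF + m2) = - (l4 * xF' + m4)"
      proof (rule vieta_assoc[OF 1(3) 1(1,2) _ 2(3) 2(1) 2(2) _ 3(3) 3(1,2) _ 4(3) 4(1) 4(2)])
        show "yA = yB \<and> 2 * l1 * yA = 3 * xA\<^sup>2 + - 1" if "xA = xB"
          using 1(1,2,6) that by auto
      qed (use g g' in auto)
      thus ?case using 2(4) 4(4) by metis
    qed
  qed
qed

text \<open>Degenerate configurations are avoided by adding an auxiliary R to both bracketings: for
  almost all R the two results agree by generic associativity, and R can be cancelled again.\<close>

lemma add_assoc_pt: "(A + B) + C = A + (B + C :: pt)"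
proof -
  let ?U = "(A + B) + C" and ?V = "A + (B + C)"
  have cancel: "eventually (\<lambda>R. (U + R) + (- R) = U) cofinite" for U :: pt
  proof (cases "U = 0")
    case True
    thus ?thesis
      by (intro always_eventually) (metis Pt_add_opposite Pt_coords coords_on_curve minus_Pt minus_zero_pt zero_add_pt)
  next
    case False
    have "eventually (\<lambda>R. R \<noteq> 0 \<and> xc R \<notin> {xc U}) cofinite" by (rule eventually_xc) auto
    thus ?thesis by eventually_elim (use False in \<open>auto intro!: generic_cancel\<close>)
  qed
  have "eventually (\<lambda>R. ?U + R = (A + B) + (C + R)) cofinite" by (rule generic_assoc)
  moreover have "eventually (\<lambda>R. (A + B) + (C + R) = A + (B + (C + R))) cofinite"
    by (rule eventually_compose_filterlim[OF generic_assoc filterlim_add_pt])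
  moreover have "eventually (\<lambda>R. (B + C) + R = B + (C + R)) cofinite" by (rule generic_assoc)
  moreover have "eventually (\<lambda>R. ?V + R = A + ((B + C) + R)) cofinite" by (rule generic_assoc)
  moreover note cancel[of ?U] cancel[of ?V]
  ultimately have "eventually (\<lambda>R :: pt. ?U = ?V) cofinite"
    by eventually_elim metis
  thus ?thesis using infinite_pt by simp
qed

instance pt :: ab_group_add
proof
  fix A B C :: pt
  show "A + B + C = A + (B + C)" by (rule add_assoc_pt)
  show "A + B = B + A" by (rule add_commute_pt)
  show "0 + A = A" by (rule zero_add_pt)
  show "- A + A = 0"
    by (cases A rule: pt_cases) (simp_all add: minus_zero_pt zero_add_pt minus_Pt Pt_add_opposite add_commute_pt[of "Pt _ (- _)"])
  show "A - B = A + - B" by (simp add: minus_pt_def)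
qed


section \<open>Gaussian integers as a Euclidean ring\<close>

datatype gint = GInt (gre: int) (gim: int)

definition gcnj :: "gint \<Rightarrow> gint" where "gcnj z = GInt (gre z) (- gim z)"

definition gnorm :: "gint \<Rightarrow> int" where "gnorm z = (gre z)^2 + (gim z)^2"

definition gi :: gint where "gi = GInt 0 1"

lemma gint_eq_iff: "z = w \<longleftrightarrow> gre z = gre w \<and> gim z = gim w"
  by (cases z; cases w) simp

instantiation gint :: comm_ring_1
begin

definition "0 = GInt 0 0"
definition "1 = GInt 1 0"
definition "z + w = GInt (gre z + gre w) (gim z + gim w)"
definition "z - w = GInt (gre z - gre w) (gim z - gim w)"
definition "- z = GInt (- gre z) (- gim z)"
definition "z * w = GInt (gre z * gre w - gim z * gim w) (gre z * gim w + gim z * gre w)"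

instance
  by standard
    (simp_all add: gint_eq_iff zero_gint_def one_gint_def plus_gint_def minus_gint_def
      uminus_gint_def times_gint_def algebra_simps)

end

lemma gint_sel [simp]:
  "gre 0 = 0" "gim 0 = 0" "gre 1 = 1" "gim 1 = 0"
  "gre (z + w) = gre z + gre w" "gim (z + w) = gim z + gim w"
  "gre (z - w) = gre z - gre w" "gim (z - w) = gim z - gim w"
  "gre (- z) = - gre z" "gim (- z) = - gim z"
  "gre (z * w) = gre z * gre w - gim z * gim w" "gim (z * w) = gre z * gim w + gim z * gre w"
  "gre gi = 0" "gim gi = 1" "gre (gcnj z) = gre z" "gim (gcnj z) = - gim z"
  by (simp_all add: zero_gint_def one_gint_def plus_gint_def minus_gint_def
      uminus_gint_def times_gint_def gi_def gcnj_def)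

lemma gint_sel_of_nat [simp]: "gre (of_nat n) = int n" "gim (of_nat n) = 0"
  by (induction n) simp_all

lemma gint_sel_of_int [simp]: "gre (of_int n) = n" "gim (of_int n) = 0"
  by (cases n; simp)+

lemma gint_sel_numeral [simp]: "gre (numeral n) = numeral n" "gim (numeral n) = 0"
  using gint_sel_of_nat[of "numeral n"] by simp_all

lemma gi_mult_gi [simp]: "gi * gi = - 1"
  by (simp add: gint_eq_iff)

lemma gi_mult_gi' [simp]: "gi * (gi * z) = - z"
  by (simp flip: mult.assoc)

lemma gnorm_mult: "gnorm (z * w) = gnorm z * gnorm w"
  by (simp add: gnorm_def power2_eq_square algebra_simps)

lemma gnorm_power: "gnorm (z ^ n) = gnorm z ^ n"
  by (induction n) (simp_all add: gnorm_mult, simp add: gnorm_def)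

lemma gnorm_nonneg [simp]: "gnorm z \<ge> 0"
  by (simp add: gnorm_def)

lemma gnorm_eq_0_iff [simp]: "gnorm z = 0 \<longleftrightarrow> z = 0"
  by (simp add: gnorm_def gint_eq_iff)

lemma gnorm_pos_iff [simp]: "gnorm z > 0 \<longleftrightarrow> z \<noteq> 0"
  using gnorm_nonneg[of z] gnorm_eq_0_iff[of z] by linarith

lemma gnorm_simps [simp]: "gnorm 0 = 0" "gnorm 1 = 1" "gnorm (- z) = gnorm z" "gnorm gi = 1" "gnorm (gcnj z) = gnorm z"
  "gnorm (of_int n) = n^2" "gnorm (numeral k) = (numeral k)^2"
  by (simp_all add: gnorm_def)

lemma mult_gcnj: "z * gcnj z = of_int (gnorm z)"
  by (simp add: gint_eq_iff gnorm_def power2_eq_square)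

lemma gcnj_mult: "gcnj (z * w) = gcnj z * gcnj w"
  by (simp add: gint_eq_iff)

lemma gcnj_gcnj [simp]: "gcnj (gcnj z) = z"
  by (simp add: gint_eq_iff)

text \<open>The integer nearest to \<open>a / n\<close>, as the floor of
  \<open>a / n + 1/2\<close>.\<close>

definition rdiv :: "int \<Rightarrow> int \<Rightarrow> int" where "rdiv a n = (2 * a + n) div (2 * n)"

lemma rdiv_mult: "n > 0 \<Longrightarrow> rdiv (a * n) n = a"
proof -
  assume n: "n > 0"
  have "(2 * (a * n) + n) div (2 * n) = (n + a * (2 * n)) div (2 * n)" by (simp add: algebra_simps)
  also have "\<dots> = a + n div (2 * n)" using n by (subst div_mult_self1) auto
  finally show ?thesis using n by (simp add: rdiv_def)
qed

lemma rdiv_close: "n > 0 \<Longrightarrow> 2 * \<bar>a - rdiv a n * n\<bar> \<le> n"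
proof -
  assume n: "n > 0"
  define r where "r = (2 * a + n) mod (2 * n)"
  have "2 * a + n = rdiv a n * (2 * n) + r"
    unfolding rdiv_def r_def by (rule div_mult_mod_eq[symmetric])
  hence "2 * (a - rdiv a n * n) = r - n" by (simp add: algebra_simps)
  moreover have "0 \<le> r" "r < 2 * n" using n by (simp_all add: r_def)
  ultimately show ?thesis by linarith
qed

instantiation gint :: idom_modulo
begin

definition "z div w = (if w = 0 then 0 else
  GInt (rdiv (gre (z * gcnj w)) (gnorm w)) (rdiv (gim (z * gcnj w)) (gnorm w)))"
definition "z mod w = z - (z div w) * (w :: gint)"

instance
proof
  fix a b :: gint
  show "a * b \<noteq> 0" if "a \<noteq> 0" "b \<noteq> 0"
    using that by (metis gnorm_eq_0_iff gnorm_mult mult_eq_0_iff)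
  show "a * b div b = a" if "b \<noteq> 0"
  proof -
    have e: "a * b * gcnj b = a * of_int (gnorm b)" by (simp only: mult.assoc mult_gcnj)
    have "gre (a * b * gcnj b) = gre a * gnorm b" "gim (a * b * gcnj b) = gim a * gnorm b"
      unfolding e by simp_all
    thus ?thesis using that by (simp add: divide_gint_def rdiv_mult del: gint_sel(11,12))
  qed
  show "a div 0 = 0" by (simp add: divide_gint_def)
  show "a div b * b + a mod b = a" by (simp add: modulo_gint_def)
qed

end

text \<open>Rounding leaves an error of at most 1/2 in each coordinate of the quotient, so the
  remainder has at most half the norm of \<open>b\<close>.\<close>

lemma gnorm_mod_less: "b \<noteq> 0 \<Longrightarrow> gnorm (a mod b) < gnorm b"
proof -
  assume b: "b \<noteq> 0"
  define n where "n = gnorm b"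
  have n: "n > 0" using b by (simp add: n_def)
  define u v where "u = gre (a * gcnj b)" and "v = gim (a * gcnj b)"
  have "(a mod b) * gcnj b = a * gcnj b - (a div b) * of_int n"
    by (simp only: modulo_gint_def left_diff_distrib mult.assoc mult_gcnj n_def)
  moreover have "a div b = GInt (rdiv u n) (rdiv v n)"
    using b by (simp add: divide_gint_def n_def u_def v_def)
  ultimately have "gre ((a mod b) * gcnj b) = u - rdiv u n * n" "gim ((a mod b) * gcnj b) = v - rdiv v n * n"
    by (simp_all add: u_def v_def del: gint_sel(11,12)) simp_all
  hence "gnorm (a mod b * gcnj b) = (u - rdiv u n * n)^2 + (v - rdiv v n * n)^2"
    by (simp only: gnorm_def[of "a mod b * gcnj b"])
  hence "gnorm (a mod b) * n = (u - rdiv u n * n)^2 + (v - rdiv v n * n)^2"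
    by (simp add: gnorm_mult n_def)
  hence "4 * (gnorm (a mod b) * n) = (2 * \<bar>u - rdiv u n * n\<bar>)^2 + (2 * \<bar>v - rdiv v n * n\<bar>)^2"
    by (simp add: power_mult_distrib)
  also have "\<dots> \<le> n^2 + n^2" by (intro add_mono power_mono rdiv_close n) auto
  finally have "(2 * gnorm (a mod b)) * n \<le> n * n" by (simp add: power2_eq_square mult_ac)
  hence "2 * gnorm (a mod b) \<le> n" using n by (simp only: mult_le_cancel_right)
  thus ?thesis using n gnorm_nonneg[of "a mod b"] unfolding n_def by linarith
qed

lemma gint_unit_iff: "is_unit z \<longleftrightarrow> z \<in> {1, - 1, gi, - gi}"
proof
  assume "is_unit z"
  then obtain w where "1 = z * w" by (auto simp: dvd_def)
  hence "gnorm z * gnorm w = 1" by (metis gnorm_mult gnorm_simps(2))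
  hence 1: "gnorm z = 1" using gnorm_nonneg[of z] unfolding zmult_eq_1_iff by linarith
  hence "(gre z)^2 \<le> 1" "(gim z)^2 \<le> 1"
    using zero_le_power2[of "gre z"] zero_le_power2[of "gim z"] unfolding gnorm_def by linarith+
  hence "\<bar>gre z\<bar> \<le> 1" "\<bar>gim z\<bar> \<le> 1" by (simp_all add: abs_square_le_1)
  hence "gre z \<in> {- 1, 0, 1}" "gim z \<in> {- 1, 0, 1}" by auto
  thus "z \<in> {1, - 1, gi, - gi}" using 1 by (auto simp: gnorm_def gint_eq_iff)
next
  have "gi * (- gi) = 1" "(- gi) * gi = 1" by simp_all
  hence "is_unit gi" "is_unit (- gi)" by (metis dvd_triv_left)+
  moreover assume "z \<in> {1, - 1, gi, - gi}"
  ultimately show "is_unit z" by auto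
qed

text \<open>Dividing by this unit moves z into the half-open first quadrant (real part positive,
  imaginary part nonnegative), which contains exactly one associate of each nonzero z.\<close>

definition gunit :: "gint \<Rightarrow> gint" where
  "gunit z = (if z = 0 then 0 else if gre z > 0 \<and> gim z \<ge> 0 then 1
    else if gre z \<le> 0 \<and> gim z > 0 then gi else if gre z < 0 \<and> gim z \<le> 0 then - 1 else - gi)"

lemma gunit_props:
  shows "gunit 0 = 0" "is_unit z \<Longrightarrow> gunit z = z" "z \<noteq> 0 \<Longrightarrow> is_unit (gunit z)" "gunit z * (gcnj (gunit z) * z) = z"
proof -
  show "gunit 0 = 0" by (simp add: gunit_def)
  show "gunit z = z" if "is_unit z"
    using that unfolding gint_unit_iff by (auto simp: gunit_def gint_eq_iff)
  show "is_unit (gunit z)" if "z \<noteq> 0"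
    using that unfolding gint_unit_iff by (simp add: gunit_def)
  show "gunit z * (gcnj (gunit z) * z) = z"
    by (auto simp: gunit_def gint_eq_iff)
qed

lemma gunit_mult: "is_unit u \<Longrightarrow> gunit (u * z) = u * gunit z"
proof -
  have "gunit (- z) = - gunit z" for z
    by (cases "gre z" "0 :: int" rule: linorder_cases; cases "gim z" "0 :: int" rule: linorder_cases)
      (simp_all add: gunit_def gint_eq_iff)
  moreover have "gunit (gi * z) = gi * gunit z" for z
    by (cases "gre z" "0 :: int" rule: linorder_cases; cases "gim z" "0 :: int" rule: linorder_cases)
      (simp_all add: gunit_def gint_eq_iff)
  moreover assume "is_unit u"
  ultimately show ?thesis unfolding gint_unit_iff by auto
qed

instantiation gint :: normalization_euclidean_semiring
begin

definition "euclidean_size z = nat (gnorm z)"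
definition "unit_factor z = gunit z"
definition "normalize z = gcnj (gunit z) * z"

instance
proof
  fix a b :: gint
  show "euclidean_size (0 :: gint) = 0" by (simp add: euclidean_size_gint_def)
  show "euclidean_size (a mod b) < euclidean_size b" if "b \<noteq> 0"
    using gnorm_mod_less[OF that, of a] that by (simp add: euclidean_size_gint_def)
  show "euclidean_size a \<le> euclidean_size (a * b)" if "b \<noteq> 0"
  proof -
    have "1 \<le> gnorm b" using gnorm_pos_iff[of b] that by linarith
    hence "gnorm a * 1 \<le> gnorm a * gnorm b" by (intro mult_left_mono) simp_all
    thus ?thesis by (simp add: euclidean_size_gint_def gnorm_mult)
  qed
  show "unit_factor (0 :: gint) = 0" by (simp add: unit_factor_gint_def gunit_props)
  show "unit_factor a = a" if "is_unit a"
    using gunit_props(2)[OF that] by (simp add: unit_factor_gint_def)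
  show "is_unit (unit_factor a)" if "a \<noteq> 0"
    using gunit_props(3)[OF that] by (simp add: unit_factor_gint_def)
  show "unit_factor (a * b) = a * unit_factor b" if "is_unit a"
    using gunit_mult[OF that] by (simp add: unit_factor_gint_def)
  show "unit_factor a * normalize a = a"
    unfolding unit_factor_gint_def normalize_gint_def by (rule gunit_props(4))
  show "normalize (0 :: gint) = 0" by (simp add: normalize_gint_def)
qed

end

instantiation gint :: euclidean_ring_gcd
begin

definition [code del]: "(gcd :: gint \<Rightarrow> _) = Euclidean_Algorithm.gcd"
definition [code del]: "(lcm :: gint \<Rightarrow> _) = Euclidean_Algorithm.lcm"
definition [code del]: "(Gcd :: gint set \<Rightarrow> _) = Euclidean_Algorithm.Gcd"
definition [code del]: "(Lcm :: gint set \<Rightarrow> _) = Euclidean_Algorithm.Lcm"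


instance
  by standard (simp_all add: gcd_gint_def lcm_gint_def Gcd_gint_def Lcm_gint_def)

end

section \<open>Gaussian integers and rationals inside the complex numbers\<close>

definition of_gint :: "gint \<Rightarrow> complex" where
  "of_gint z = Complex (of_int (gre z)) (of_int (gim z))"

lemma of_gint_simps [simp]:
  "of_gint 0 = 0" "of_gint 1 = 1" "of_gint (z + w) = of_gint z + of_gint w"
  "of_gint (z - w) = of_gint z - of_gint w" "of_gint (- z) = - of_gint z"
  "of_gint (z * w) = of_gint z * of_gint w" "of_gint gi = \<i>"
  "of_gint (of_int n) = of_int n" "of_gint (numeral k) = numeral k" "of_gint (gcnj z) = cnj (of_gint z)"
  by (simp_all add: of_gint_def complex_eq_iff)

lemma of_gint_power [simp]: "of_gint (z ^ n) = of_gint z ^ n"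
  by (induction n) simp_all

lemma of_gint_eq_iff [simp]: "of_gint z = of_gint w \<longleftrightarrow> z = w"
  by (simp add: of_gint_def gint_eq_iff)

lemma of_gint_eq_0_iff [simp]: "of_gint z = 0 \<longleftrightarrow> z = 0"
  using of_gint_eq_iff[of z 0] by simp

lemma cmod_of_gint: "(cmod (of_gint z))^2 = of_int (gnorm z)"
  by (simp add: of_gint_def cmod_power2 gnorm_def)

lemma gaussian_ints_iff: "z \<in> gaussian_ints \<longleftrightarrow> (\<exists>w. z = of_gint w)"
proof
  assume "z \<in> gaussian_ints"
  then obtain a b where "Re z = of_int a" "Im z = of_int b" by (auto simp: gaussian_ints_def Ints_def)
  hence "z = of_gint (GInt a b)" by (simp add: of_gint_def complex_eq_iff)
  thus "\<exists>w. z = of_gint w" ..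
qed (auto simp: gaussian_ints_def of_gint_def)

lemma gaussian_rats_closed:
  assumes "x \<in> gaussian_rats" "y \<in> gaussian_rats"
  shows "x + y \<in> gaussian_rats" "x - y \<in> gaussian_rats" "- x \<in> gaussian_rats" "x * y \<in> gaussian_rats"
    "x / y \<in> gaussian_rats" "x ^ n \<in> gaussian_rats"
proof -
  have m: "u * v \<in> gaussian_rats" if "u \<in> gaussian_rats" "v \<in> gaussian_rats" for u v
    using that by (auto simp: gaussian_rats_def)
  thus "x * y \<in> gaussian_rats" using assms by blast
  show "x ^ n \<in> gaussian_rats"
  proof (induction n)
    case 0
    show ?case by (simp add: gaussian_rats_def)
  next
    case (Suc n)
    thus ?case using m assms(1) by simp
  qed
  have "inverse y \<in> gaussian_rats" using assms(2) by (auto simp: gaussian_rats_def)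
  thus "x / y \<in> gaussian_rats" unfolding divide_inverse using assms(1) m by simp
qed (use assms in \<open>auto simp: gaussian_rats_def\<close>)

lemma of_gint_rat [simp]: "of_gint z \<in> gaussian_rats"
  by (simp add: gaussian_rats_def of_gint_def)

lemma gaussian_rats_consts [simp]: "0 \<in> gaussian_rats" "1 \<in> gaussian_rats" "\<i> \<in> gaussian_rats"
  "numeral k \<in> gaussian_rats" "of_int j \<in> gaussian_rats"
  by (simp_all add: gaussian_rats_def)

lemma gaussian_ratsE:
  assumes "x \<in> gaussian_rats"
  obtains p q where "q \<noteq> 0" "coprime p q" "x = of_gint p / of_gint q"
proof -
  obtain a b c d where ab: "Re x = of_int a / of_int b" "b > 0" and cd: "Im x = of_int c / of_int d" "d > 0"
    using assms by (auto simp: gaussian_rats_def elim!: Rats_cases')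
  define p q where "p = GInt (a * d) (c * b)" and "q = (of_int (b * d) :: gint)"
  have q: "q \<noteq> 0" using ab cd by (auto simp: q_def gint_eq_iff)
  have "of_gint p = x * of_gint q"
    using ab cd by (simp add: p_def q_def of_gint_def complex_eq_iff field_simps)
  moreover obtain p' q' where pq': "p = p' * gcd p q" "q = q' * gcd p q" "coprime p' q'"
    using q gcd_coprime_exists[of p q] by auto
  moreover have "q' \<noteq> 0" using pq'(2) q by auto
  moreover have "gcd p q \<noteq> 0" using q by simp
  ultimately have "of_gint p' * of_gint (gcd p q) = x * of_gint q' * of_gint (gcd p q)"
    by (metis mult.assoc of_gint_simps(6))
  hence "x = of_gint p' / of_gint q'" using q \<open>q' \<noteq> 0\<close> by (simp add: field_simps)
  thus ?thesis using that \<open>q' \<noteq> 0\<close> pq'(3) by blast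
qed

text \<open>Z[i] is integrally closed: in lowest terms the denominator divides the square of the
  numerator, hence is a unit.\<close>

lemma gaussian_rat_square_integral:
  assumes "x \<in> gaussian_rats" "x^2 = of_gint z"
  obtains w where "x = of_gint w" "z = w^2"
proof -
  obtain p q where pq: "q \<noteq> 0" "coprime p q" "x = of_gint p / of_gint q" using assms(1) by (rule gaussian_ratsE)
  have "of_gint (p^2) = of_gint (z * q^2)" using assms(2) pq by (simp add: power_divide field_simps)
  hence e: "p^2 = z * q^2" by (simp only: of_gint_eq_iff)
  hence "q dvd p^2" by (simp add: power2_eq_square)
  moreover have "coprime q (p^2)" using pq(2) by (simp add: coprime_commute[of q])
  ultimately have "is_unit q" using coprime_common_divisor[of q "p^2" q] by simp
  then obtain q' where q': "q * q' = 1" by (auto simp: dvd_def)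
  have "x = of_gint p / of_gint q * of_gint (q * q')" using pq(3) q' by simp
  hence "x = of_gint (p * q')" using pq(1) by simp
  moreover from this have "z = (p * q')^2" using assms(2) by (metis of_gint_eq_iff of_gint_power)
  ultimately show ?thesis by (rule that)
qed


section \<open>Legendre symbols of rational integers\<close>

lemma Legendre_cong:
  assumes "[a = b] (mod p)"
  shows "Legendre a p = Legendre b p"
proof -
  have "[x = a] (mod p) \<longleftrightarrow> [x = b] (mod p)" "[a = x] (mod p) \<longleftrightarrow> [b = x] (mod p)" for x
    using assms by (simp_all add: cong_def)
  thus ?thesis by (simp add: Legendre_def QuadRes_def)
qed

lemma Legendre_values: "Legendre a p \<in> {- 1, 0, 1}"
  by (simp add: Legendre_def)

text \<open>Two numbers from {-1, 0, 1} differ by at most 2, so a congruence modulo p > 2, such as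
  Euler's criterion provides, is an equality.\<close>

lemma Legendre_eqI:
  assumes "[Legendre a p = s] (mod p)" "s \<in> {- 1, 0, 1}" "p > 2"
  shows "Legendre a p = s"
proof -
  have "p dvd Legendre a p - s" using assms(1) by (simp add: cong_iff_dvd_diff)
  moreover have "\<bar>Legendre a p - s\<bar> < p" using Legendre_values[of a p] assms(2,3) by auto
  ultimately have "\<not> \<bar>Legendre a p - s\<bar> > 0" using zdvd_imp_le[of p "\<bar>Legendre a p - s\<bar>"] by auto
  thus ?thesis by simp
qed

lemma Legendre_mult:
  assumes "Factorial_Ring.prime p" "p > 2"
  shows "Legendre (a * b) (int p) = Legendre a (int p) * Legendre b (int p)"
proof (rule Legendre_eqI)
  have "[Legendre (a * b) (int p) = (a * b) ^ ((p - 1) div 2)] (mod int p)"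
    by (rule euler_criterion[OF assms])
  moreover have "[Legendre a (int p) * Legendre b (int p) = a ^ ((p - 1) div 2) * b ^ ((p - 1) div 2)] (mod int p)"
    by (intro cong_mult euler_criterion assms)
  ultimately show "[Legendre (a * b) (int p) = Legendre a (int p) * Legendre b (int p)] (mod int p)"
    by (metis cong_sym cong_trans power_mult_distrib)
  show "Legendre a (int p) * Legendre b (int p) \<in> {- 1, 0, 1}"
    using Legendre_values[of a "int p"] Legendre_values[of b "int p"] by auto
qed (use assms in simp)

lemma Legendre_eq_0_iff: "Legendre a p = 0 \<longleftrightarrow> p dvd a"
  by (simp add: Legendre_def cong_0_iff)

lemma Legendre_square: "\<not> p dvd a \<Longrightarrow> Factorial_Ring.prime p \<Longrightarrow> Legendre (a^2) p = 1"
  unfolding Legendre_def QuadRes_def cong_0_iff by (auto dest: prime_dvd_power intro: cong_refl)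

lemma Legendre_1: "p > 1 \<Longrightarrow> Legendre 1 p = 1"
  unfolding Legendre_def QuadRes_def cong_0_iff by (auto simp: zdvd_not_zless intro!: exI[of _ 1])

lemma reciprocity_1_mod_4:
  assumes "Factorial_Ring.prime p" "p mod 4 = 1" "Factorial_Ring.prime q" "q > 2" "p \<noteq> (q :: nat)"
  shows "Legendre (int q) (int p) = Legendre (int p) (int q)"
proof -
  have "p > 2" using assms(1,2) prime_ge_2_nat[of p] by (cases "p = 2") auto
  have "even ((p - 1) div 2)" using assms(2) by presburger
  hence "Legendre (int p) (int q) * Legendre (int q) (int p) = 1"
    using Quadratic_Reciprocity[OF assms(1) \<open>p > 2\<close> assms(3,4,5)] by simp
  thus ?thesis using Legendre_values[of "int p" "int q"] Legendre_values[of "int q" "int p"] by auto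
qed

text \<open>For odd \<open>m\<close> this is the Jacobi symbol of 2 over \<open>m\<close>.\<close>

definition chi8 :: "nat \<Rightarrow> int" where "chi8 m = (if m mod 8 \<in> {1, 7} then 1 else - 1)"

lemma chi8_mult:
  assumes "odd a" "odd b"
  shows "chi8 (a * b) = chi8 a * chi8 b"
proof -
  define c where "c r s = ((if r * s mod 8 \<in> {1, 7} then 1 else - 1) =
      (if r \<in> {1, 7} then 1 else - 1 :: int) * (if s \<in> {1, 7} then 1 else - 1))" for r s :: nat
  have odd: "m mod 8 = 1 \<or> m mod 8 = 3 \<or> m mod 8 = 5 \<or> m mod 8 = 7" if "odd m" for m :: nat
    using that by presburger
  have "c (a mod 8) (b mod 8)"
    using odd[OF assms(1)] odd[OF assms(2)] by (elim disjE; simp only:; simp add: c_def)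
  thus ?thesis unfolding c_def chi8_def mod_mult_eq .
qed

text \<open>For q = 2h + 1 the number \<open>h - h div 2\<close> counts the x up to h with 2x > h,
  which is the exponent in Gauss's lemma for 2.\<close>

lemma even_ceiling_half_iff: "even (h - h div 2) \<longleftrightarrow> (2 * h + 1) mod 8 = 1 \<or> (2 * h + 1) mod 8 = (7::int)" 
proof -
  obtain j r where h: "h = 4 * j + r" "r \<in> {0,1,2,3::int}"
  proof
    show "h = 4 * (h div 4) + h mod 4" by simp
    show "h mod 4 \<in> {0,1,2,3}" by auto
  qed
  have "(4 * j + r) div 2 = 2 * j + r div 2" using h(2) by auto
  hence 1: "h - h div 2 = 2 * j + (r - r div 2)" using h(1) by simp
  have 2: "(2 * h + 1) mod 8 = 2 * r + 1"
  proof -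
    have "2 * h + 1 = (2 * r + 1) + 8 * j" using h by simp
    hence "(2 * h + 1) mod 8 = (2 * r + 1) mod 8" by (simp only: mod_mult_self2)
    thus ?thesis using h(2) by auto
  qed
  show ?thesis unfolding 1 2 using h(2) by auto
qed
lemma Legendre_2:
  assumes "Factorial_Ring.prime q" "q > 2"
  shows "Legendre 2 (int q) = chi8 q"
proof -
  have odd: "odd q" using assms by (simp add: prime_odd_nat)
  interpret GAUSS q 2
    by unfold_locales (use assms in \<open>auto simp: cong_0_iff zdvd_not_zless\<close>)
  define h where "h = (int q - 1) div 2"
  have h: "int q = 2 * h + 1" using odd unfolding h_def by presburger
  have "B = (\<lambda>x. x * 2) ` {0<..h}" by (simp add: B_def A_def h_def)
  \<comment> \<open>The doubles of 1, ..., h are at most q - 1 and are already reduced.\<close>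
  moreover have "C = B"
  proof -
    have "x mod int q = x" if "x \<in> B" for x using that h by (auto simp: calculation)
    thus ?thesis unfolding C_def by simp
  qed
  ultimately have "E = (\<lambda>x. x * 2) ` {h div 2<..h}"
    unfolding E_def h_def[symmetric] by force
  hence "card E = card {h div 2<..h}" by (simp add: card_image inj_on_def)
  hence "card E = nat (h - h div 2)" by simp
  moreover have "even (nat (h - h div 2)) \<longleftrightarrow> q mod 8 \<in> {1, 7}"
  proof -
    have "h \<ge> 0" using assms h by linarith
    hence "even (nat (h - h div 2)) \<longleftrightarrow> even (h - h div 2)" by (simp add: even_nat_iff)
    also have "\<dots> \<longleftrightarrow> int q mod 8 = 1 \<or> int q mod 8 = 7" unfolding h by (rule even_ceiling_half_iff)
    also have "int q mod 8 = int (q mod 8)" by (simp add: zmod_int)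
    finally show ?thesis by auto
  qed
  ultimately show ?thesis using gauss_lemma by (auto simp: chi8_def uminus_power_if)
qed

text \<open>Takes the place of the Jacobi symbol: reciprocity is applied at each prime factor of
  \<open>m\<close> and the result is multiplied up.\<close>

lemma multiplicative_eq:
  fixes f g :: "nat \<Rightarrow> int"
  assumes "m > 0" "f 1 = g 1"
    and "\<And>a b. a * b dvd m \<Longrightarrow> f (a * b) = f a * f b"
    and "\<And>a b. a * b dvd m \<Longrightarrow> g (a * b) = g a * g b"
    and "\<And>q. Factorial_Ring.prime q \<Longrightarrow> q dvd m \<Longrightarrow> f q = g q"
  shows "f m = g m"
  using assms
proof (induction m rule: less_induct)
  case (less m)
  show ?case
  proof (cases "m = 1")
    case True
    thus ?thesis using less.prems(2) by simp
  next
    case False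
    then obtain q where q: "Factorial_Ring.prime q" "q dvd m" using prime_factor_nat by blast
    then obtain l where m: "m = q * l" by (auto simp: dvd_def)
    have "l > 0" using m less.prems(1) by (cases l) auto
    moreover have "l < m" using m prime_gt_1_nat[OF q(1)] \<open>l > 0\<close> by simp
    moreover have "l dvd m" using m by simp
    moreover have "f l = g l"
    proof (rule less.IH)
      show "l < m" "0 < l" by fact+
      show "f 1 = g 1" by (rule less.prems(2))
      show "f (a * b) = f a * f b" "g (a * b) = g a * g b" if "a * b dvd l" for a b
        by (rule less.prems(3,4)[OF dvd_trans[OF that \<open>l dvd m\<close>]])+
      show "f p = g p" if "Factorial_Ring.prime p" "p dvd l" for p
        by (rule less.prems(5)[OF that(1) dvd_trans[OF that(2) \<open>l dvd m\<close>]])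
    qed
    moreover have "f q = g q" by (rule less.prems(5)[OF q])
    moreover have "f m = f q * f l" "g m = g q * g l"
      using less.prems(3)[of q l] less.prems(4)[of q l] m by simp_all
    ultimately show ?thesis by simp
  qed
qed

text \<open>The residue class of \<open>-1-6i\<close> modulo \<open>16\<close>.\<close>

definition good :: "gint \<Rightarrow> bool" where
  "good \<pi> \<longleftrightarrow> prime_elem \<pi> \<and> gre \<pi> mod 16 = 15 \<and> gim \<pi> mod 16 = 10"

section \<open>Primes congruent to -1-6i modulo 16 and their norms\<close>

lemma good_gnorm_mod: "good \<pi> \<Longrightarrow> gnorm \<pi> mod 32 = 5"
proof -
  assume "good \<pi>"
  define a b where "a = gre \<pi> div 16" and "b = gim \<pi> div 16"
  have "gre \<pi> = 16 * a + 15" "gim \<pi> = 16 * b + 10"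
    using \<open>good \<pi>\<close> mult_div_mod_eq[of 16 "gre \<pi>"] mult_div_mod_eq[of 16 "gim \<pi>"]
    unfolding good_def a_def b_def by linarith+
  hence "gnorm \<pi> = 5 + 32 * (8 * a^2 + 15 * a + 8 * b^2 + 10 * b + 10)"
    by (simp add: gnorm_def power2_eq_square algebra_simps)
  thus ?thesis by (simp only: mod_mult_self2) simp
qed

lemma prime_elem_dvd_prime:
  assumes "prime_elem (\<pi> :: gint)" "m > 0" "\<pi> dvd of_nat m"
  shows "\<exists>q. Factorial_Ring.prime q \<and> \<pi> dvd of_nat q"
  using assms(2,3)
proof (induction m rule: less_induct)
  case (less m)
  have "m \<noteq> 1"
  proof
    assume "m = 1"
    hence "is_unit \<pi>" using less.prems(2) by simp
    thus False using assms(1) by (simp add: prime_elem_def)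
  qed
  then obtain q where q: "Factorial_Ring.prime q" "q dvd m" using prime_factor_nat by blast
  then obtain l where m: "m = q * l" by (elim dvdE)
  have l: "l > 0" using m less.prems(1) by (cases l) auto
  have "l < m" using m prime_gt_1_nat[OF q(1)] l by simp
  have "\<pi> dvd of_nat q * of_nat l" using less.prems(2) m by simp
  thus ?case using less.IH[OF \<open>l < m\<close> l] q(1) prime_elem_dvd_multD[OF assms(1)] by blast
qed

text \<open>A Gaussian prime divides some rational prime q, so its norm is q or q^2. An odd square
  is 1 modulo 8, whereas the norm here is 5 modulo 32.\<close>

lemma good_gnorm_prime: "good \<pi> \<Longrightarrow> Factorial_Ring.prime (nat (gnorm \<pi>))"
proof -
  assume g: "good \<pi>"
  hence pe: "prime_elem \<pi>" by (simp add: good_def)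
  have n1: "nat (gnorm \<pi>) \<noteq> 1" using good_gnorm_mod[OF g] by auto
  have "of_nat (nat (gnorm \<pi>)) = \<pi> * gcnj \<pi>" by (simp add: mult_gcnj)
  hence d: "\<pi> dvd of_nat (nat (gnorm \<pi>))" by (metis dvd_triv_left)
  have "\<pi> \<noteq> 0" using pe by (simp add: prime_elem_def)
  hence "gnorm \<pi> > 0" by (rule gnorm_pos_iff[THEN iffD2])
  then obtain q where q: "Factorial_Ring.prime q" "\<pi> dvd of_nat q"
    using prime_elem_dvd_prime[OF pe _ d] by auto
  then obtain w where "of_nat q = \<pi> * w" by (elim dvdE)
  hence "gnorm (of_nat q) = gnorm \<pi> * gnorm w" by (simp add: gnorm_mult)
  hence "int q ^ 2 = gnorm \<pi> * gnorm w" by (simp add: gnorm_def)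
  hence "int (nat (gnorm \<pi>)) dvd int (q ^ 2)" by simp
  hence "nat (gnorm \<pi>) dvd q ^ 2" by (simp only: int_dvd_int_iff)
  then obtain i where i: "i \<le> 2" "nat (gnorm \<pi>) = q ^ i" using divides_primepow_nat[OF q(1)] by blast
  have "i \<noteq> 2"
  proof
    assume "i = 2"
    hence e: "gnorm \<pi> = int q ^ 2" using i by (metis gnorm_nonneg nat_eq_iff2 of_nat_power)
    have "odd (gnorm \<pi>)" using good_gnorm_mod[OF g] by presburger
    hence "odd (int q)" using e by simp
    then obtain j where "int q = 2 * j + 1" by (elim oddE)
    hence "gnorm \<pi> = 4 * (j * (j + 1)) + 1" by (simp add: e power2_eq_square algebra_simps)
    moreover have "even (j * (j + 1))" by simp
    then obtain l where "j * (j + 1) = 2 * l" by (rule evenE)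
    ultimately have "gnorm \<pi> = 8 * l + 1" by simp
    thus False using good_gnorm_mod[OF g] by presburger
  qed
  moreover have "i \<noteq> 0" using i n1 by auto
  ultimately have "i = 1" using i by auto
  thus ?thesis using i q by simp
qed


lemma good_normE:
  assumes "good \<pi>"
  obtains p where "Factorial_Ring.prime p" "gnorm \<pi> = int p" "p mod 32 = 5" "p > 2" "p mod 4 = 1"
proof -
  define p where "p = nat (gnorm \<pi>)"
  have p: "gnorm \<pi> = int p" by (simp add: p_def)
  have "int (p mod 32) = int 5" using good_gnorm_mod[OF assms] by (simp add: zmod_int p)
  hence m: "p mod 32 = 5" by (simp only: of_nat_eq_iff)
  hence "p > 2" using mod_less_eq_dividend[of p 32] by linarith
  moreover have "p mod 4 = 1" using m mod_mod_cancel[of 4 32 p] by simp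
  ultimately show ?thesis by (rule that[OF good_gnorm_prime[OF assms, folded p_def] p m])
qed

lemma good_prime_elem: "good \<pi> \<Longrightarrow> prime_elem \<pi>"
  by (simp add: good_def)

lemma gint_dvd_gnorm: "\<pi> dvd z \<Longrightarrow> gnorm \<pi> dvd gnorm z"
  by (elim dvdE) (simp add: gnorm_mult)

lemma good_dvd_of_int_iff:
  assumes "good \<pi>"
  shows "\<pi> dvd of_int m \<longleftrightarrow> gnorm \<pi> dvd m"
proof
  obtain p where p: "Factorial_Ring.prime p" "gnorm \<pi> = int p" using assms by (rule good_normE)
  assume "\<pi> dvd of_int m"
  hence "gnorm \<pi> dvd gnorm (of_int m)" by (rule gint_dvd_gnorm)
  hence "int p dvd m ^ 2" by (simp add: p(2))
  moreover have "Factorial_Ring.prime (int p)" using p(1) by simp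
  ultimately have "int p dvd m" by (metis prime_dvd_power)
  thus "gnorm \<pi> dvd m" by (simp add: p)
next
  assume "gnorm \<pi> dvd m"
  then obtain k where "m = gnorm \<pi> * k" by (elim dvdE)
  hence "of_int m = (\<pi> * gcnj \<pi>) * of_int k" unfolding mult_gcnj by simp
  hence "of_int m = \<pi> * (gcnj \<pi> * of_int k)" by (simp only: mult.assoc)
  thus "\<pi> dvd of_int m" by (rule dvdI)
qed

lemma good_parts_coprime:
  assumes "good \<pi>" "Factorial_Ring.prime q" "int q dvd gre \<pi>" "int q dvd gim \<pi>"
  shows False
proof -
  obtain p where p: "Factorial_Ring.prime p" "gnorm \<pi> = int p" using assms(1) by (rule good_normE)
  have "int q ^ 2 dvd gre \<pi> ^ 2 + gim \<pi> ^ 2"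
    using assms(3,4) by (intro dvd_add dvd_power_same)
  hence "int (q ^ 2) dvd int p" using p(2) by (simp add: gnorm_def)
  hence d: "q ^ 2 dvd p" by (simp only: int_dvd_int_iff)
  have "q dvd p" using d by (rule dvd_trans[rotated]) (simp add: power2_eq_square)
  hence "q = p" by (rule primes_dvd_imp_eq[OF assms(2) p(1)])
  hence "p * p dvd p * 1" using d by (simp add: power2_eq_square)
  hence "p dvd 1" using prime_gt_0_nat[OF p(1)] by (metis nat_mult_dvd_cancel1)
  thus False using p(1) by simp
qed

text \<open>The residue field has prime order p, so i is congruent to a rational integer.
  Explicitly, u + v i being congruent to 0 gives r = -u/v modulo p, and v is invertible because p
  cannot divide both parts.\<close>

lemma good_root_ex:
  assumes "good \<pi>"
  shows "\<exists>r. \<pi> dvd of_int r - gi"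
proof -
  obtain p where p: "Factorial_Ring.prime p" "gnorm \<pi> = int p" using assms by (rule good_normE)
  have pi: "Factorial_Ring.prime (int p)" using p(1) by simp
  define u v where "u = gre \<pi>" and "v = gim \<pi>"
  have "\<not> int p dvd v"
  proof
    assume v: "int p dvd v"
    have "int p dvd u\<^sup>2 + v\<^sup>2" using p(2) by (simp add: gnorm_def u_def v_def)
    moreover have "int p dvd v\<^sup>2" using v by (simp add: power2_eq_square)
    ultimately have "int p dvd u\<^sup>2" by (metis dvd_add_left_iff)
    hence "int p dvd u" using pi by (metis prime_dvd_power)
    thus False using good_parts_coprime[OF assms p(1)] v by (simp add: u_def v_def)
  qed
  hence "coprime (int p) v" by (rule prime_imp_coprime[OF pi])
  hence "coprime v (int p)" by (simp only: coprime_commute)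
  then obtain w where "[v * w = 1] (mod int p)" using cong_solve_coprime_int[of v "int p"] by auto
  then obtain k where k: "v * w - 1 = int p * k" unfolding cong_iff_dvd_diff by (elim dvdE)
  have "of_int (- u * w) - gi = - of_int w * \<pi> + gi * of_int (v * w - 1)"
    by (simp add: gint_eq_iff u_def v_def)
  also have "gi * of_int (v * w - 1) = (\<pi> * gcnj \<pi>) * (of_int k * gi)"
    unfolding k mult_gcnj p(2) by (simp add: mult_ac)
  also have "- of_int w * \<pi> + (\<pi> * gcnj \<pi>) * (of_int k * gi) = \<pi> * (- of_int w + gcnj \<pi> * (of_int k * gi))"
    by (simp add: algebra_simps)
  finally have "\<pi> dvd of_int (- u * w) - gi" by (rule dvdI)
  thus ?thesis ..
qed

section \<open>The quadratic residue symbol modulo such a prime\<close>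

definition groot :: "gint \<Rightarrow> int" where "groot \<pi> = (SOME r. \<pi> dvd of_int r - gi)"

text \<open>Substituting \<open>groot\<close> for i identifies Z[i] modulo the prime with the
  integers modulo its norm; the symbol is the Legendre symbol transported along this
  identification.\<close>

definition chi :: "gint \<Rightarrow> gint \<Rightarrow> int" where
  "chi \<pi> z = Legendre (gre z + gim z * groot \<pi>) (gnorm \<pi>)"

lemma groot: "good \<pi> \<Longrightarrow> \<pi> dvd of_int (groot \<pi>) - gi"
  unfolding groot_def using good_root_ex by (rule someI_ex)

lemma dvd_residue:
  assumes "good \<pi>"
  shows "\<pi> dvd of_int (gre z + gim z * groot \<pi>) - z"
proof -
  have "of_int (gre z + gim z * groot \<pi>) - z = of_int (gim z) * (of_int (groot \<pi>) - gi)"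
    by (simp add: gint_eq_iff)
  thus ?thesis using groot[OF assms] by (simp only: dvd_mult)
qed

lemma chi_residue:
  assumes "good \<pi>" "\<pi> dvd of_int m - z"
  shows "chi \<pi> z = Legendre m (gnorm \<pi>)"
proof -
  have "\<pi> dvd (of_int m - z) - (of_int (gre z + gim z * groot \<pi>) - z)"
    by (intro dvd_diff assms(2) dvd_residue[OF assms(1)])
  also have "(of_int m - z) - (of_int (gre z + gim z * groot \<pi>) - z) = of_int (m - (gre z + gim z * groot \<pi>))"
    by simp
  finally have "gnorm \<pi> dvd m - (gre z + gim z * groot \<pi>)"
    by (simp only: good_dvd_of_int_iff[OF assms(1)])
  hence "[m = gre z + gim z * groot \<pi>] (mod gnorm \<pi>)" by (simp only: cong_iff_dvd_diff)
  from Legendre_cong[OF this] show ?thesis by (simp only: chi_def)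
qed

lemma chi_of_int: "good \<pi> \<Longrightarrow> chi \<pi> (of_int m) = Legendre m (gnorm \<pi>)"
  by (rule chi_residue) simp_all

lemma chi_cong:
  assumes "good \<pi>" "\<pi> dvd z - w"
  shows "chi \<pi> z = chi \<pi> w"
proof -
  define m where "m = gre z + gim z * groot \<pi>"
  have "\<pi> dvd (of_int m - z) + (z - w)"
    unfolding m_def by (intro dvd_add assms(2) dvd_residue[OF assms(1)])
  hence "\<pi> dvd of_int m - w" by simp
  hence "chi \<pi> w = Legendre m (gnorm \<pi>)" by (rule chi_residue[OF assms(1)])
  thus ?thesis by (simp only: chi_def m_def)
qed

lemma chi_mult:
  assumes "good \<pi>"
  shows "chi \<pi> (z * w) = chi \<pi> z * chi \<pi> w"
proof -
  obtain p where p: "Factorial_Ring.prime p" "gnorm \<pi> = int p" "p > 2" using assms by (rule good_normE)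
  define m l where "m = gre z + gim z * groot \<pi>" and "l = gre w + gim w * groot \<pi>"
  have "\<pi> dvd (of_int m - z) * of_int l + z * (of_int l - w)"
    unfolding m_def l_def by (intro dvd_add dvd_mult dvd_mult2 dvd_residue assms)
  also have "(of_int m - z) * of_int l + z * (of_int l - w) = of_int (m * l) - z * w"
    by (simp add: algebra_simps)
  finally have "chi \<pi> (z * w) = Legendre (m * l) (gnorm \<pi>)" by (rule chi_residue[OF assms])
  thus ?thesis using Legendre_mult[OF p(1,3), of m l] by (simp add: p(2) chi_def m_def l_def)
qed

lemma chi_values: "chi \<pi> z \<in> {- 1, 0, 1}"
  unfolding chi_def by (rule Legendre_values)

lemma chi_eq_0_iff: "good \<pi> \<Longrightarrow> chi \<pi> z = 0 \<longleftrightarrow> \<pi> dvd z"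
proof -
  assume g: "good \<pi>"
  define m where "m = gre z + gim z * groot \<pi>"
  have d: "\<pi> dvd of_int m - z" unfolding m_def by (rule dvd_residue[OF g])
  have "chi \<pi> z = 0 \<longleftrightarrow> gnorm \<pi> dvd m" by (simp only: chi_def m_def Legendre_eq_0_iff)
  also have "\<dots> \<longleftrightarrow> \<pi> dvd of_int m" by (simp only: good_dvd_of_int_iff[OF g])
  also have "\<dots> \<longleftrightarrow> \<pi> dvd z" using d by (metis diff_add_cancel dvd_add_right_iff)
  finally show ?thesis .
qed

lemma chi_pm1: "good \<pi> \<Longrightarrow> \<not> \<pi> dvd z \<Longrightarrow> chi \<pi> z = 1 \<or> chi \<pi> z = - 1"
  using chi_values[of \<pi> z] chi_eq_0_iff[of \<pi> z] by auto

lemma chi_square: "good \<pi> \<Longrightarrow> \<not> \<pi> dvd z \<Longrightarrow> chi \<pi> (z^2) = 1"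
  using chi_pm1[of \<pi> z] by (auto simp: power2_eq_square chi_mult)

text \<open>By Euler's criterion the symbol is i^((p-1)/2) = (-1)^((p-1)/4), and (p-1)/4 is odd
  because p is 5 modulo 32.\<close>

lemma chi_gi: "good \<pi> \<Longrightarrow> chi \<pi> gi = - 1"
proof -
  assume g: "good \<pi>"
  obtain p where p: "Factorial_Ring.prime p" "gnorm \<pi> = int p" "p mod 32 = 5" "p > 2" using g by (rule good_normE)
  define r where "r = groot \<pi>"
  have "chi \<pi> gi = Legendre r (int p)" by (simp add: chi_def r_def p(2))
  moreover have "Legendre r (int p) = - 1"
  proof (rule Legendre_eqI)
    have "\<pi> dvd (of_int r - gi) * (of_int r + gi)" using groot[OF g] by (simp add: r_def)
    also have "(of_int r - gi) * (of_int r + gi) = of_int (r^2 - (- 1))" by (simp add: algebra_simps power2_eq_square)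
    finally have "int p dvd r^2 - (- 1)" by (simp only: good_dvd_of_int_iff[OF g] p(2))
    hence "[r^2 = - 1] (mod int p)" by (simp only: cong_iff_dvd_diff)
    hence "[(r^2) ^ ((p - 1) div 4) = (- 1) ^ ((p - 1) div 4)] (mod int p)" by (rule cong_pow)
    moreover have "odd ((p - 1) div 4) \<and> 2 * ((p - 1) div 4) = (p - 1) div 2"
    proof -
      define j where "j = p div 32"
      have "p = 32 * j + 5" using p(3) mult_div_mod_eq[of 32 p] unfolding j_def by linarith
      thus ?thesis by simp
    qed
    ultimately have "[r ^ ((p - 1) div 2) = - 1] (mod int p)" by (simp flip: power_mult)
    thus "[Legendre r (int p) = - 1] (mod int p)"
      using euler_criterion[OF p(1,4), of r] cong_trans by blast
  qed (use p in auto)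
  ultimately show ?thesis by simp
qed

lemma chi_minus_1: "good \<pi> \<Longrightarrow> chi \<pi> (- 1) = 1"
  using chi_mult[of \<pi> gi gi] by (simp add: chi_gi)

lemma chi_uminus: "good \<pi> \<Longrightarrow> chi \<pi> (- z) = chi \<pi> z"
  using chi_mult[of \<pi> "- 1" z] by (simp add: chi_minus_1)

lemma good_not_dvd_small:
  assumes "good \<pi>" "gnorm z = 1 \<or> gnorm z = 2"
  shows "\<not> \<pi> dvd z"
proof
  obtain p where p: "gnorm \<pi> = int p" "p > 2" using assms(1) by (rule good_normE)
  assume "\<pi> dvd z"
  hence "int p dvd gnorm z" using gint_dvd_gnorm[of \<pi> z] p by simp
  hence "int p \<le> gnorm z" using assms(2) by (intro zdvd_imp_le) auto
  thus False using p(2) assms(2) by linarith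
qed

lemma chi_2: "good \<pi> \<Longrightarrow> chi \<pi> 2 = - 1"
proof -
  assume g: "good \<pi>"
  have e: "2 = - (gi * (1 + gi)^2)" by (simp add: gint_eq_iff power2_eq_square)
  have nd: "\<not> \<pi> dvd 1 + gi" by (rule good_not_dvd_small[OF g]) (simp add: gnorm_def)
  thus ?thesis by (subst e, simp only: chi_uminus[OF g] chi_mult[OF g] chi_gi[OF g] chi_square[OF g nd])
qed


lemma int_dvd_abs_iff: "int q dvd a \<longleftrightarrow> q dvd nat \<bar>a\<bar>"
  by (simp add: int_dvd_int_iff[symmetric])

lemma Legendre_abs:
  assumes "good \<pi>"
  shows "Legendre (int (nat \<bar>a\<bar>)) (gnorm \<pi>) = Legendre a (gnorm \<pi>)"
proof -
  have "of_int \<bar>a\<bar> = (of_int a :: gint) \<or> of_int \<bar>a\<bar> = - (of_int a :: gint)"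
    by (cases "a \<ge> 0") simp_all
  hence "chi \<pi> (of_int \<bar>a\<bar>) = chi \<pi> (of_int a)" using chi_uminus[OF assms, of "of_int a"] by auto
  thus ?thesis by (simp only: chi_of_int[OF assms]) simp
qed

text \<open>For a prime q dividing w the norm p is congruent to the square of
  \<open>gre \<pi>\<close> modulo q. As p is 1 modulo 4, reciprocity makes every such q a residue
  modulo p, and w is their product up to sign.\<close>

lemma Legendre_half_gim:
  assumes "good \<pi>" "gim \<pi> = 2 * w"
  shows "Legendre w (gnorm \<pi>) = 1"
proof -
  obtain p where p: "Factorial_Ring.prime p" "gnorm \<pi> = int p" "p > 2" "p mod 4 = 1" using assms(1) by (rule good_normE)
  have n: "int p = gre \<pi> ^ 2 + (2 * w)^2" using p(2) assms(2) by (simp add: gnorm_def)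
  have "gim \<pi> mod 16 = 10" using assms(1) by (simp add: good_def)
  hence odd: "odd w" using assms(2) by presburger
  have "Legendre (int (nat \<bar>w\<bar>)) (int p) = 1"
  proof (rule multiplicative_eq[where m = "nat \<bar>w\<bar>" and f = "\<lambda>a. Legendre (int a) (int p)" and g = "\<lambda>_. 1"])
    show "nat \<bar>w\<bar> > 0" using odd by auto
    show "Legendre (int 1) (int p) = 1" using Legendre_1[of "int p"] p(3) by simp
    show "Legendre (int (a * b)) (int p) = Legendre (int a) (int p) * Legendre (int b) (int p)" for a b
      using Legendre_mult[OF p(1,3), of "int a" "int b"] by simp
    fix q assume q: "Factorial_Ring.prime q" "q dvd nat \<bar>w\<bar>"
    have qw: "int q dvd w" using q(2) by (simp only: int_dvd_abs_iff)
    have "q \<noteq> 2" using qw odd by auto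
    hence q2: "q > 2" using prime_ge_2_nat[OF q(1)] by simp
    have qi: "Factorial_Ring.prime (int q)" using q(1) by simp
    have nd: "\<not> int q dvd gre \<pi>"
    proof
      assume "int q dvd gre \<pi>"
      moreover have "int q dvd gim \<pi>" using qw assms(2) by simp
      ultimately show False by (rule good_parts_coprime[OF assms(1) q(1)])
    qed
    have d: "int q dvd (2 * w)^2" using qw by (simp add: power2_eq_square)
    hence "[int p = gre \<pi> ^ 2] (mod int q)" by (simp add: n cong_iff_dvd_diff)
    hence "Legendre (int p) (int q) = 1"
      using Legendre_cong Legendre_square[OF nd qi] by metis
    moreover have "p \<noteq> q"
    proof
      assume "p = q"
      hence "int q dvd gre \<pi> ^ 2" using d n by (metis dvd_add_left_iff dvd_refl)
      hence "int q dvd gre \<pi>" using qi by (metis prime_dvd_power)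
      thus False using nd by simp
    qed
    ultimately show "Legendre (int q) (int p) = 1"
      using reciprocity_1_mod_4[OF p(1,4) q(1) q2] by simp
  qed simp
  thus ?thesis using Legendre_abs[OF assms(1), of w] by (simp only: p(2))
qed

text \<open>With u the real part and m = \<open>gim \<pi> - gre \<pi>\<close>, the norm is 2 u^2 + m
  (m + 2u). A prime q dividing m therefore has the symbol of 2 modulo q, so the symbol of m is that
  of 2 over the absolute value of m. It is -1 since m is 11 modulo 16.\<close>

lemma Legendre_gim_minus_gre:
  assumes "good \<pi>"
  shows "Legendre (gim \<pi> - gre \<pi>) (gnorm \<pi>) = - 1"
proof -
  obtain p where p: "Factorial_Ring.prime p" "gnorm \<pi> = int p" "p > 2" "p mod 4 = 1" using assms(1) by (rule good_normE)
  define u m where "u = gre \<pi>" and "m = gim \<pi> - gre \<pi>"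
  have n: "int p = 2 * u^2 + m * (m + 2 * u)"
    using p(2) by (simp add: gnorm_def u_def m_def power2_eq_square algebra_simps)
  have h: "gre \<pi> mod 16 = 15" "gim \<pi> mod 16 = 10" using assms(1) by (simp_all add: good_def)
  have "m mod 16 = (gim \<pi> mod 16 - gre \<pi> mod 16) mod 16" unfolding m_def by (rule mod_diff_eq[symmetric])
  hence m16: "m mod 16 = 11" unfolding h by simp
  hence "m mod 2 = 1" using mod_mod_cancel[of 2 16 m] by simp
  hence odd: "odd m" by (simp only: odd_iff_mod_2_eq_one)
  have "Legendre (int (nat \<bar>m\<bar>)) (int p) = chi8 (nat \<bar>m\<bar>)"
  proof (rule multiplicative_eq[where m = "nat \<bar>m\<bar>" and f = "\<lambda>a. Legendre (int a) (int p)"])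
    show "nat \<bar>m\<bar> > 0" using odd by auto
    show "Legendre (int 1) (int p) = chi8 1" using Legendre_1[of "int p"] p(3) by (simp add: chi8_def)
    show "Legendre (int (a * b)) (int p) = Legendre (int a) (int p) * Legendre (int b) (int p)" for a b
      using Legendre_mult[OF p(1,3), of "int a" "int b"] by simp
    show "chi8 (a * b) = chi8 a * chi8 b" if ab: "a * b dvd nat \<bar>m\<bar>" for a b
    proof (rule chi8_mult)
      have "int (a * b) dvd m" using ab by (simp only: int_dvd_abs_iff)
      hence "odd (int (a * b))" using odd by (metis dvd_trans)
      thus "odd a" "odd b" by simp_all
    qed
    fix q assume q: "Factorial_Ring.prime q" "q dvd nat \<bar>m\<bar>"
    have qm: "int q dvd m" using q(2) by (simp only: int_dvd_abs_iff)
    have "q \<noteq> 2" using qm odd by auto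
    hence q2: "q > 2" using prime_ge_2_nat[OF q(1)] by simp
    have qi: "Factorial_Ring.prime (int q)" using q(1) by simp
    have nd: "\<not> int q dvd u"
    proof
      assume u: "int q dvd u"
      hence "int q dvd m + u" using qm by simp
      thus False using good_parts_coprime[OF assms(1) q(1)] u by (simp add: m_def u_def)
    qed
    have d: "int q dvd m * (m + 2 * u)" using qm by simp
    hence "[int p = 2 * u^2] (mod int q)" by (simp add: n cong_iff_dvd_diff)
    hence "Legendre (int p) (int q) = Legendre (2 * u^2) (int q)" by (rule Legendre_cong)
    also have "\<dots> = chi8 q"
      using Legendre_mult[OF q(1) q2, of 2 "u^2"] Legendre_square[OF nd qi] Legendre_2[OF q(1) q2] by simp
    finally have "Legendre (int p) (int q) = chi8 q" .
    moreover have "p \<noteq> q"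
    proof
      assume "p = q"
      hence "int q dvd 2 * u^2" using d n by (metis dvd_add_left_iff dvd_refl)
      hence "int q dvd 2 \<or> int q dvd u^2" by (rule prime_dvd_multD[OF qi])
      moreover have "\<not> int q dvd 2" using q2 by (simp add: zdvd_not_zless)
      ultimately have "int q dvd u^2" by simp
      hence "int q dvd u" using qi by (metis prime_dvd_power)
      thus False using nd by simp
    qed
    ultimately show "Legendre (int q) (int p) = chi8 q"
      using reciprocity_1_mod_4[OF p(1,4) q(1) q2] by simp
  qed
  also have "chi8 (nat \<bar>m\<bar>) = - 1"
  proof -
    have "m mod 8 = 3" using m16 mod_mod_cancel[of 8 16 m] by simp
    hence "\<bar>m\<bar> mod 8 = 3 \<or> \<bar>m\<bar> mod 8 = 5"
      using zmod_zminus1_eq_if[of m 8] by (cases "m \<ge> 0") simp_all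
    moreover have "int (nat \<bar>m\<bar> mod 8) = \<bar>m\<bar> mod 8" by (simp add: zmod_int)
    ultimately have "int (nat \<bar>m\<bar> mod 8) = int 3 \<or> int (nat \<bar>m\<bar> mod 8) = int 5" by simp
    hence "nat \<bar>m\<bar> mod 8 = 3 \<or> nat \<bar>m\<bar> mod 8 = 5" by (simp only: of_nat_eq_iff)
    thus ?thesis by (auto simp: chi8_def)
  qed
  finally show ?thesis using Legendre_abs[OF assms(1), of m] by (simp only: p(2) m_def)
qed

text \<open>Writing the prime as u + v i, the product v (1 + i) is congruent to v - u. The symbols
  of v (twice an odd residue) and of v - u are both -1.\<close>

lemma chi_1_plus_gi:
  assumes g: "good \<pi>"
  shows "chi \<pi> (1 + gi) = 1"
proof -
  obtain w where w: "gim \<pi> = 2 * w" 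
  proof
    have "gim \<pi> mod 2 = 0" using g mod_mod_cancel[of 2 16 "gim \<pi>"] by (simp add: good_def)
    thus "gim \<pi> = 2 * (gim \<pi> div 2)" using mult_div_mod_eq[of 2 "gim \<pi>"] by linarith
  qed
  have v: "chi \<pi> (of_int (gim \<pi>)) = - 1"
  proof -
    have "of_int (gim \<pi>) = 2 * (of_int w :: gint)" by (simp add: w)
    hence "chi \<pi> (of_int (gim \<pi>)) = chi \<pi> 2 * chi \<pi> (of_int w)" by (simp only: chi_mult[OF g])
    thus ?thesis by (simp only: chi_2[OF g] chi_of_int[OF g] Legendre_half_gim[OF g w] mult_1_right)
  qed
  have "of_int (gim \<pi>) * (1 + gi) - of_int (gim \<pi> - gre \<pi>) = \<pi>" by (simp add: gint_eq_iff)
  hence "chi \<pi> (of_int (gim \<pi>) * (1 + gi)) = chi \<pi> (of_int (gim \<pi> - gre \<pi>))"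
    by (intro chi_cong[OF g]) simp
  also have "\<dots> = - 1" by (simp only: chi_of_int[OF g] Legendre_gim_minus_gre[OF g])
  finally show ?thesis using v by (simp add: chi_mult[OF g])
qed

text \<open>By quadratic reciprocity the residue symbol of a rational integer \<open>k\<close> depends on \<open>\<pi>\<close> only through the
  norm of \<open>\<pi>\<close> modulo \<open>k\<close>.\<close>

lemma chi_of_int_eq:
  assumes g: "good \<pi>" "good \<pi>'" and k: "k dvd gnorm \<pi> - gnorm \<pi>'"
    and nd: "\<not> \<pi> dvd of_int k" "\<not> \<pi>' dvd of_int k"
  shows "chi \<pi> (of_int k) = chi \<pi>' (of_int k)"
proof -
  obtain p where p: "Factorial_Ring.prime p" "gnorm \<pi> = int p" "p > 2" "p mod 4 = 1" using g(1) by (rule good_normE)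
  obtain p' where p': "Factorial_Ring.prime p'" "gnorm \<pi>' = int p'" "p' > 2" "p' mod 4 = 1" using g(2) by (rule good_normE)
  have "Legendre (int (nat \<bar>k\<bar>)) (int p) = Legendre (int (nat \<bar>k\<bar>)) (int p')"
  proof (rule multiplicative_eq[where m = "nat \<bar>k\<bar>" and f = "\<lambda>a. Legendre (int a) (int p)"
        and g = "\<lambda>a. Legendre (int a) (int p')"])
    show "nat \<bar>k\<bar> > 0" using nd by auto
    show "Legendre (int 1) (int p) = Legendre (int 1) (int p')" using Legendre_1 p(3) p'(3) by simp
    show "Legendre (int (a * b)) (int p) = Legendre (int a) (int p) * Legendre (int b) (int p)" for a b
      using Legendre_mult[OF p(1,3), of "int a" "int b"] by simp
    show "Legendre (int (a * b)) (int p') = Legendre (int a) (int p') * Legendre (int b) (int p')" for a b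
      using Legendre_mult[OF p'(1,3), of "int a" "int b"] by simp
    fix q assume q: "Factorial_Ring.prime q" "q dvd nat \<bar>k\<bar>"
    have qk: "int q dvd k" using q(2) by (simp only: int_dvd_abs_iff)
    show "Legendre (int q) (int p) = Legendre (int q) (int p')"
    \<comment> \<open>Reciprocity between odd primes does not cover q = 2; there both symbols equal
      -1.\<close>
    proof (cases "q = 2")
      case True
      thus ?thesis using chi_of_int[OF g(1), of 2] chi_of_int[OF g(2), of 2] chi_2[OF g(1)] chi_2[OF g(2)] p(2) p'(2)
        by simp
    next
      case False
      hence q2: "q > 2" using prime_ge_2_nat[OF q(1)] by simp
      have "p \<noteq> q" using nd(1) qk p(2) good_dvd_of_int_iff[OF g(1)] by auto
      moreover have "p' \<noteq> q" using nd(2) qk p'(2) good_dvd_of_int_iff[OF g(2)] by auto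
      moreover have "[int p = int p'] (mod int q)"
        using dvd_trans[OF qk k] by (simp add: p(2) p'(2) cong_iff_dvd_diff)
      hence "Legendre (int p) (int q) = Legendre (int p') (int q)" by (rule Legendre_cong)
      ultimately show ?thesis
        using reciprocity_1_mod_4[OF p(1,4) q(1) q2] reciprocity_1_mod_4[OF p'(1,4) q(1) q2] by simp
    qed
  qed
  thus ?thesis
    using Legendre_abs[OF g(1), of k] Legendre_abs[OF g(2), of k]
    by (simp only: chi_of_int[OF g(1)] chi_of_int[OF g(2)] p(2) p'(2))
qed


section \<open>Local conditions of the descent\<close>

lemma prime_elem_not_unit: "prime_elem (\<pi> :: gint) \<Longrightarrow> \<not> is_unit \<pi>"
  by (simp add: prime_elem_def)

lemma good_mod16: "good \<pi> \<Longrightarrow> gre \<pi> mod 16 = 15" "good \<pi> \<Longrightarrow> gim \<pi> mod 16 = 10"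
  by (simp_all add: good_def)

text \<open>The class of -1-6i modulo 16 contains only one of the four associates, so divisibility
  between good primes becomes equality.\<close>

lemma good_unit_multiple:
  assumes "good \<pi>" "is_unit u" "gre (\<pi> * u) mod 16 = 15" "gim (\<pi> * u) mod 16 = 10"
  shows "u = 1"
proof -
  define a b where "a = gre \<pi> div 16" and "b = gim \<pi> div 16"
  have "gre \<pi> = 16 * a + 15" "gim \<pi> = 16 * b + 10"
    using good_mod16[OF assms(1)] mult_div_mod_eq[of 16 "gre \<pi>"] mult_div_mod_eq[of 16 "gim \<pi>"]
    unfolding a_def b_def by linarith+
  moreover have "u = 1 \<or> u = - 1 \<or> u = gi \<or> u = - gi" using assms(2) by (simp add: gint_unit_iff)
  ultimately show ?thesis using assms(3,4) by (elim disjE) (simp_all, presburger+)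
qed

lemma associated_primes:
  assumes "prime_elem (p :: gint)" "prime_elem q" "p dvd q"
  obtains u where "is_unit u" "q = p * u"
proof -
  obtain u where u: "q = p * u" using assms(3) by (elim dvdE)
  have "Factorial_Ring.irreducible q" using assms(2) by (rule prime_elem_imp_irreducible)
  hence "is_unit u" using Factorial_Ring.irreducibleD[OF _ u] prime_elem_not_unit[OF assms(1)] by blast
  thus ?thesis using u that by blast
qed

lemma good_dvd_good:
  assumes "good \<pi>" "good \<pi>'" "\<pi> dvd \<pi>'"
  shows "\<pi> = \<pi>'"
proof -
  obtain u where u: "is_unit u" "\<pi>' = \<pi> * u"
    using associated_primes[OF good_prime_elem[OF assms(1)] good_prime_elem[OF assms(2)] assms(3)] by blast
  have "u = 1" using good_unit_multiple[OF assms(1) u(1)] good_mod16[OF assms(2)] u(2) by simp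
  thus ?thesis using u(2) by simp
qed

text \<open>The equation \<open>w\<^sup>2 = D (D\<^sup>2 p\<^sup>4 - n\<^sup>2 q\<^sup>4)\<close> arises from a point with abscissa \<open>D (p/q)\<^sup>2\<close>.\<close>

lemma descent_prime_dvd:
  fixes D p q n w \<rho> :: gint
  assumes \<rho>: "prime_elem \<rho>" and sqf: "\<not> \<rho>^2 dvd D" and cop: "coprime p q"
    and eq: "w^2 = D * (D^2 * p^4 - n^2 * q^4)" and D: "\<rho> dvd D"
  shows "\<rho> dvd n"
proof (rule ccontr)
  assume n: "\<not> \<rho> dvd n"
  have \<rho>0: "\<rho> \<noteq> 0" using \<rho> by (simp add: prime_elem_def)
  obtain D' where D': "D = \<rho> * D'" using D by (elim dvdE)
  have nD': "\<not> \<rho> dvd D'" using sqf unfolding D' power2_eq_square by (metis mult_dvd_mono dvd_refl)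
  \<comment> \<open>The valuation of the right-hand side at \<open>\<rho>\<close> would be odd: it
    is 1 if \<open>\<rho>\<close> does not divide q, and 3 if it divides q and hence not p. A square
    allows neither.\<close>
  have "\<rho> dvd w^2" unfolding eq D' by (simp add: mult.assoc)
  hence "\<rho> dvd w" using \<rho> prime_elem_dvd_power by blast
  then obtain w1 where w1: "w = \<rho> * w1" by (elim dvdE)
  have "\<rho> * (\<rho> * w1^2) = \<rho> * (D' * (\<rho>^2 * D'^2 * p^4 - n^2 * q^4))"
    using eq unfolding D' w1 by Groebner_Basis.algebra
  hence e1: "\<rho> * w1^2 = D' * (\<rho>^2 * D'^2 * p^4 - n^2 * q^4)" using \<rho>0 by (simp only: mult_cancel_left) simp
  hence "D' * (n^2 * q^4) = \<rho> * (D' * (\<rho> * D'^2 * p^4) - w1^2)" by Groebner_Basis.algebra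
  hence "\<rho> dvd D' * (n^2 * q^4)" by (rule dvdI)
  hence "\<rho> dvd q" using \<rho> nD' n prime_elem_dvd_mult_iff prime_elem_dvd_power by metis
  then obtain q1 where q1: "q = \<rho> * q1" by (elim dvdE)
  have np: "\<not> \<rho> dvd p" using cop \<open>\<rho> dvd q\<close> coprime_common_divisor prime_elem_not_unit[OF \<rho>] by blast
  have "\<rho> * w1^2 = \<rho> * (\<rho> * (D' * (D'^2 * p^4 - n^2 * \<rho>^2 * q1^4)))"
    using e1 unfolding q1 by Groebner_Basis.algebra
  hence e2: "w1^2 = \<rho> * (D' * (D'^2 * p^4 - n^2 * \<rho>^2 * q1^4))" using \<rho>0 by (simp only: mult_cancel_left) simp
  hence "\<rho> dvd w1^2" by (rule dvdI)
  hence "\<rho> dvd w1" using \<rho> prime_elem_dvd_power by blast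
  then obtain w2 where w2: "w1 = \<rho> * w2" by (elim dvdE)
  have "\<rho> * (\<rho> * w2^2) = \<rho> * (D' * (D'^2 * p^4 - n^2 * \<rho>^2 * q1^4))"
    using e2 unfolding w2 by Groebner_Basis.algebra
  hence "\<rho> * w2^2 = D' * (D'^2 * p^4 - n^2 * \<rho>^2 * q1^4)" using \<rho>0 by (simp only: mult_cancel_left) simp
  hence "D' * (D'^2 * p^4) = \<rho> * (w2^2 + D' * n^2 * \<rho> * q1^4)" by Groebner_Basis.algebra
  hence "\<rho> dvd D' * (D'^2 * p^4)" by (rule dvdI)
  thus False using \<rho> nD' np prime_elem_dvd_mult_iff prime_elem_dvd_power by metis
qed

text \<open>Reduce the equation modulo the prime. If it does not divide p, then w^2 is congruent to
  D (D p^2)^2. If it does, divide by its square first and obtain a square congruent to -D (n1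
  q^2)^2, where -1 has symbol 1.\<close>

lemma descent_chi_not_dvd:
  assumes g: "good \<pi>" and cop: "coprime p q" and n: "n = \<pi> * n1" "\<not> \<pi> dvd n1"
    and eq: "w^2 = D * (D^2 * p^4 - n^2 * q^4)" and D: "\<not> \<pi> dvd D"
  shows "chi \<pi> D = 1"
proof -
  note \<pi> = good_prime_elem[OF g]
  have \<pi>0: "\<pi> \<noteq> 0" using \<pi> by (simp add: prime_elem_def)
  have nd_mult: "\<not> \<pi> dvd y * z" if "\<not> \<pi> dvd y" "\<not> \<pi> dvd z" for y z
    using that prime_elem_dvd_mult_iff[OF \<pi>] by blast
  have nd_pow: "\<not> \<pi> dvd y ^ m" if "\<not> \<pi> dvd y" for y and m :: nat
    using that prime_elem_dvd_power[OF \<pi>] by blast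
  show ?thesis
  proof (cases "\<pi> dvd p")
    case False
    have "w^2 - D * (D * p^2)^2 = \<pi> * (- D * (\<pi> * n1^2 * q^4))"
      unfolding eq n by Groebner_Basis.algebra
    hence d: "\<pi> dvd w^2 - D * (D * p^2)^2" by (rule dvdI)
    have nd: "\<not> \<pi> dvd D * p^2" using nd_mult nd_pow D False by blast
    have "\<not> \<pi> dvd w"
    proof
      assume "\<pi> dvd w"
      hence "\<pi> dvd w^2" by (simp add: power2_eq_square)
      hence "\<pi> dvd D * (D * p^2)^2" using d by (metis dvd_diff_commute dvd_diff_right_iff dvd_diffD1 diff_diff_eq2 add_diff_cancel_left' dvd_diff)
      thus False using nd_mult[OF D nd_pow[OF nd]] by blast
    qed
    hence "1 = chi \<pi> (w^2)" by (rule chi_square[OF g, symmetric])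
    also have "\<dots> = chi \<pi> (D * (D * p^2)^2)" by (rule chi_cong[OF g d])
    also have "\<dots> = chi \<pi> D" by (simp only: chi_mult[OF g] chi_square[OF g nd] mult_1_right)
    finally show ?thesis ..
  next
    case True
    then obtain p1 where p1: "p = \<pi> * p1" by (elim dvdE)
    have nq: "\<not> \<pi> dvd q" using cop True coprime_common_divisor prime_elem_not_unit[OF \<pi>] by blast
    have e: "w^2 = \<pi>^2 * (D * (D^2 * \<pi>^2 * p1^4 - n1^2 * q^4))"
      unfolding eq n p1 by Groebner_Basis.algebra
    hence "\<pi> dvd w^2" by (simp add: power2_eq_square)
    hence "\<pi> dvd w" using prime_elem_dvd_power[OF \<pi>] by blast
    then obtain w1 where w1: "w = \<pi> * w1" by (elim dvdE)
    have "\<pi>^2 * w1^2 = \<pi>^2 * (D * (D^2 * \<pi>^2 * p1^4 - n1^2 * q^4))"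
      using e unfolding w1 by Groebner_Basis.algebra
    hence e2: "w1^2 = D * (D^2 * \<pi>^2 * p1^4 - n1^2 * q^4)" using \<pi>0 by (simp only: mult_cancel_left) simp
    have "w1^2 - - (D * (n1 * q^2)^2) = \<pi> * (D^3 * \<pi> * p1^4)" unfolding e2 by Groebner_Basis.algebra
    hence d: "\<pi> dvd w1^2 - - (D * (n1 * q^2)^2)" by (rule dvdI)
    have nd: "\<not> \<pi> dvd n1 * q^2" using nd_mult nd_pow n(2) nq by blast
    have "\<not> \<pi> dvd w1"
    proof
      assume "\<pi> dvd w1"
      hence "\<pi> dvd w1^2" by (simp add: power2_eq_square)
      hence "\<pi> dvd D * (n1 * q^2)^2" using d by (simp only: diff_minus_eq_add dvd_add_right_iff)
      thus False using nd_mult[OF D nd_pow[OF nd]] by blast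
    qed
    hence "1 = chi \<pi> (w1^2)" by (rule chi_square[OF g, symmetric])
    also have "\<dots> = chi \<pi> (- (D * (n1 * q^2)^2))" by (rule chi_cong[OF g d])
    also have "\<dots> = chi \<pi> D" by (simp only: chi_uminus[OF g] chi_mult[OF g, of D] chi_square[OF g nd] mult_1_right)
    finally show ?thesis ..
  qed
qed

text \<open>The right-hand side is divisible by the cube of the prime, and being a square also by
  its fourth power. Hence D'^2 p^4 is congruent to n1^2 q^4, so D' p^2 is congruent to n1 q^2 up to
  a sign, which the symbol ignores.\<close>

lemma descent_chi_dvd:
  assumes g: "good \<pi>" and cop: "coprime p q" and n: "n = \<pi> * n1" "\<not> \<pi> dvd n1"
    and eq: "w^2 = D * (D^2 * p^4 - n^2 * q^4)" and D: "D = \<pi> * D'" "\<not> \<pi> dvd D'"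
  shows "chi \<pi> (D' * n1) = 1"
proof -
  note \<pi> = good_prime_elem[OF g]
  have \<pi>0: "\<pi> \<noteq> 0" using \<pi> by (simp add: prime_elem_def)
  have nd_mult: "\<not> \<pi> dvd y * z" if "\<not> \<pi> dvd y" "\<not> \<pi> dvd z" for y z
    using that prime_elem_dvd_mult_iff[OF \<pi>] by blast
  have nd_pow: "\<not> \<pi> dvd y ^ m" if "\<not> \<pi> dvd y" for y and m :: nat
    using that prime_elem_dvd_power[OF \<pi>] by blast
  have e: "w^2 = \<pi>^2 * (\<pi> * (D' * (D'^2 * p^4 - n1^2 * q^4)))"
    unfolding eq n D by Groebner_Basis.algebra
  hence "\<pi> dvd w^2" by (simp add: power2_eq_square)
  hence "\<pi> dvd w" using prime_elem_dvd_power[OF \<pi>] by blast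
  then obtain w1 where w1: "w = \<pi> * w1" by (elim dvdE)
  have "\<pi>^2 * w1^2 = \<pi>^2 * (\<pi> * (D' * (D'^2 * p^4 - n1^2 * q^4)))" using e unfolding w1 by Groebner_Basis.algebra
  hence e1: "w1^2 = \<pi> * (D' * (D'^2 * p^4 - n1^2 * q^4))" using \<pi>0 by (simp only: mult_cancel_left) simp
  hence "\<pi> dvd w1^2" by (rule dvdI)
  hence "\<pi> dvd w1" using prime_elem_dvd_power[OF \<pi>] by blast
  then obtain w2 where w2: "w1 = \<pi> * w2" by (elim dvdE)
  have "\<pi> * (\<pi> * w2^2) = \<pi> * (D' * (D'^2 * p^4 - n1^2 * q^4))" using e1 unfolding w2 by Groebner_Basis.algebra
  hence e2: "D' * (D'^2 * p^4 - n1^2 * q^4) = \<pi> * w2^2" using \<pi>0 by (simp only: mult_cancel_left) simp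
  hence "\<pi> dvd D' * (D'^2 * p^4 - n1^2 * q^4)" by (rule dvdI)
  hence "\<pi> dvd D'^2 * p^4 - n1^2 * q^4" using D(2) prime_elem_dvd_mult_iff[OF \<pi>] by blast
  also have "D'^2 * p^4 - n1^2 * q^4 = (D' * p^2 - n1 * q^2) * (D' * p^2 - - (n1 * q^2))" by Groebner_Basis.algebra
  finally have or: "\<pi> dvd D' * p^2 - n1 * q^2 \<or> \<pi> dvd D' * p^2 - - (n1 * q^2)"
    by (simp only: prime_elem_dvd_mult_iff[OF \<pi>])
  hence chi: "chi \<pi> (D' * p^2) = chi \<pi> (n1 * q^2)"
    using chi_cong[OF g, of "D' * p^2" "n1 * q^2"] chi_cong[OF g, of "D' * p^2" "- (n1 * q^2)"]
    by (auto simp: chi_uminus[OF g])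
  have "\<pi> dvd D' * p^2 \<longleftrightarrow> \<pi> dvd n1 * q^2" using chi chi_eq_0_iff[OF g] by metis
  hence "\<pi> dvd p \<longleftrightarrow> \<pi> dvd q" using nd_mult nd_pow D(2) n(2)
    by (metis dvd_mult dvd_power_same dvd_trans dvd_power zero_less_numeral prime_elem_dvd_mult_iff[OF \<pi>] prime_elem_dvd_power[OF \<pi>])
  hence "\<not> \<pi> dvd p" "\<not> \<pi> dvd q"
    using coprime_common_divisor[OF cop] prime_elem_not_unit[OF \<pi>] by blast+
  hence "chi \<pi> D' = chi \<pi> n1"
    using chi by (simp add: chi_mult[OF g] chi_square[OF g])
  thus ?thesis using chi_pm1[OF g n(2)] by (auto simp: chi_mult[OF g])
qed


section \<open>The four primes and the admissible square classes\<close>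

text \<open>The system of residue conditions at p0, p1 and p2. The flag \<open>sj\<close> tells
  whether pj divides D, \<open>\<sigma>\<close> is the symbol of the unit part, \<open>e0\<close>
  that of k at p0 and at p2, \<open>e1\<close> that of k at p1. The solutions are a unit +-1 times 1
  or n, and a unit +-i times p0 p2 or p1 p3.\<close>

lemma sign_cases:
  fixes \<sigma> e0 e1 :: int
  assumes "\<sigma> = 1 \<or> \<sigma> = - 1" "e0 = 1 \<or> e0 = - 1" "e1 = 1 \<or> e1 = - 1"
    and "\<sigma> * (if s1 \<noteq> s0 then - e0 else 1) * (if s2 \<noteq> s0 then - e0 else 1) * (if s3 \<noteq> s0 then e0 else 1) = 1"
    and "\<sigma> * (if s0 \<noteq> s1 then - e1 else 1) * (if s2 \<noteq> s1 then e1 else 1) * (if s3 \<noteq> s1 then e1 else 1) = 1"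
    and "\<sigma> * (if s0 \<noteq> s2 then - e0 else 1) * (if s1 \<noteq> s2 then e0 else 1) * (if s3 \<noteq> s2 then - e0 else 1) = 1"
  shows "(\<sigma> = 1 \<and> s1 = s0 \<and> s2 = s0 \<and> s3 = s0) \<or> (\<sigma> = - 1 \<and> s2 = s0 \<and> s1 = (\<not> s0) \<and> s3 = (\<not> s0))"
  using assms by (cases s0; cases s1; cases s2; cases s3) auto

text \<open>A nonzero k keeps the four primes distinct, so n is squarefree.\<close>

locale four_primes =
  fixes be :: gint and k :: int
  assumes k_nonzero: "k \<noteq> 0"
    and good_shift: "good (be + of_int k * (1 + gi))" "good (be + gi * (of_int k * (1 + gi)))"
      "good (be - of_int k * (1 + gi))" "good (be - gi * (of_int k * (1 + gi)))"
begin

definition "b = of_int k * (1 + gi)"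
definition "p0 = be + b"
definition "p1 = be + gi * b"
definition "p2 = be - b"
definition "p3 = be - gi * b"
definition "n = p0 * p1 * p2 * p3"

lemma good: "good p0" "good p1" "good p2" "good p3"
  using good_shift by (simp_all add: p0_def p1_def p2_def p3_def b_def)

lemma prime_elems: "prime_elem p0" "prime_elem p1" "prime_elem p2" "prime_elem p3"
  using good by (simp_all add: good_prime_elem)

lemma n_eq: "n = be^4 + 4 * of_int k^4"
proof -
  have "n = be^4 - b^4" unfolding n_def p0_def p1_def p2_def p3_def
    using gi_mult_gi by Groebner_Basis.algebra
  also have "b^4 = - 4 * of_int k^4"
    unfolding b_def using gi_mult_gi by Groebner_Basis.algebra
  finally show ?thesis by simp
qed

lemma differences:
  "p0 - p1 = 2 * of_int k" "p0 - p2 = 2 * of_int k * (1 + gi)" "p0 - p3 = 2 * gi * of_int k"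
  "p1 - p2 = 2 * gi * of_int k" "p1 - p3 = 2 * gi * of_int k * (1 + gi)" "p2 - p3 = - 2 * of_int k"
  by (simp_all add: p0_def p1_def p2_def p3_def b_def gint_eq_iff)

lemma distinct: "p0 \<noteq> p1" "p0 \<noteq> p2" "p0 \<noteq> p3" "p1 \<noteq> p2" "p1 \<noteq> p3" "p2 \<noteq> p3"
  using differences k_nonzero by (auto simp: gint_eq_iff)

lemma not_dvd:
  "\<not> p0 dvd p1" "\<not> p0 dvd p2" "\<not> p0 dvd p3" "\<not> p1 dvd p0" "\<not> p1 dvd p2" "\<not> p1 dvd p3"
  "\<not> p2 dvd p0" "\<not> p2 dvd p1" "\<not> p2 dvd p3" "\<not> p3 dvd p0" "\<not> p3 dvd p1" "\<not> p3 dvd p2"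
  using good_dvd_good good distinct by metis+

lemma not_dvd_k: "\<not> p0 dvd of_int k" "\<not> p1 dvd of_int k" "\<not> p2 dvd of_int k" "\<not> p3 dvd of_int k"
proof -
  have *: "p dvd q" if "p dvd of_int k" "p - q = of_int k * r \<or> q - p = of_int k * r" for p q r :: gint
  proof -
    have "p dvd of_int k * r" using that(1) by simp
    hence "p dvd p - q" using that(2) by (metis dvd_diff_commute)
    thus ?thesis by (metis dvd_refl dvd_diff_commute diff_add_cancel dvd_add_right_iff)
  qed
  show "\<not> p0 dvd of_int k" using *[of p0 p1 2] not_dvd differences by (auto simp: mult.commute)
  show "\<not> p1 dvd of_int k" using *[of p1 p0 2] not_dvd differences by (auto simp: mult.commute)
  show "\<not> p2 dvd of_int k" using *[of p2 p3 "- 2"] not_dvd differences by (auto simp: mult.commute)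
  show "\<not> p3 dvd of_int k" using *[of p3 p2 "- 2"] not_dvd differences by (auto simp: mult.commute)
qed

lemma chi_k:
  shows "chi p0 (of_int k) = 1 \<or> chi p0 (of_int k) = - 1" "chi p1 (of_int k) = 1 \<or> chi p1 (of_int k) = - 1"
    "chi p2 (of_int k) = chi p0 (of_int k)" "chi p3 (of_int k) = 1 \<or> chi p3 (of_int k) = - 1"
proof -
  have "gnorm p2 - gnorm p0 = k * (- 4 * (gre be + gim be))"
    by (simp add: p0_def p2_def b_def gnorm_def power2_eq_square algebra_simps)
  hence "k dvd gnorm p2 - gnorm p0" by (rule dvdI)
  thus "chi p2 (of_int k) = chi p0 (of_int k)" by (intro chi_of_int_eq good not_dvd_k)
qed (intro chi_pm1 good not_dvd_k)+

lemma chi_diff: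
  assumes "good p" "q - p = z \<or> p - q = z"
  shows "chi p q = chi p z"
proof (cases "q - p = z")
  case True
  thus ?thesis using assms(1) by (intro chi_cong) auto
next
  case False
  hence "p - q = z" using assms(2) by simp
  hence "q - - z = p" by auto
  hence "chi p q = chi p (- z)" using assms(1) by (intro chi_cong) simp_all
  thus ?thesis using assms(1) by (simp add: chi_uminus)
qed

text \<open>Modulo one prime another is congruent to their difference. In that difference 2 and i
  have symbol -1 and 1+i has symbol 1, which leaves k with a sign.\<close>

lemma chi_table:
  "chi p0 p1 = - chi p0 (of_int k)" "chi p0 p2 = - chi p0 (of_int k)" "chi p0 p3 = chi p0 (of_int k)"
  "chi p1 p0 = - chi p1 (of_int k)" "chi p1 p2 = chi p1 (of_int k)" "chi p1 p3 = chi p1 (of_int k)"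
  "chi p2 p0 = - chi p2 (of_int k)" "chi p2 p1 = chi p2 (of_int k)" "chi p2 p3 = - chi p2 (of_int k)"
  "chi p3 p0 = chi p3 (of_int k)" "chi p3 p1 = chi p3 (of_int k)" "chi p3 p2 = - chi p3 (of_int k)"
proof -
  have *: "chi p (2 * of_int k) = - chi p (of_int k)" "chi p (2 * of_int k * (1 + gi)) = - chi p (of_int k)"
    "chi p (2 * gi * of_int k) = chi p (of_int k)" "chi p (2 * gi * of_int k * (1 + gi)) = chi p (of_int k)"
    "chi p (- 2 * of_int k) = - chi p (of_int k)" if "good p" for p
    using that by (simp_all add: chi_mult chi_uminus chi_2 chi_gi chi_1_plus_gi)
  note chi_diff' = chi_diff[OF _ disjI1] chi_diff[OF _ disjI2]
  show "chi p0 p1 = - chi p0 (of_int k)" "chi p0 p2 = - chi p0 (of_int k)" "chi p0 p3 = chi p0 (of_int k)"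
    using chi_diff'(2)[OF good(1) differences(1)] chi_diff'(2)[OF good(1) differences(2)]
      chi_diff'(2)[OF good(1) differences(3)] by (simp_all only: *[OF good(1)])
  show "chi p1 p0 = - chi p1 (of_int k)" "chi p1 p2 = chi p1 (of_int k)" "chi p1 p3 = chi p1 (of_int k)"
    using chi_diff'(1)[OF good(2) differences(1)] chi_diff'(2)[OF good(2) differences(4)]
      chi_diff'(2)[OF good(2) differences(5)] by (simp_all only: *[OF good(2)])
  show "chi p2 p0 = - chi p2 (of_int k)" "chi p2 p1 = chi p2 (of_int k)" "chi p2 p3 = - chi p2 (of_int k)"
    using chi_diff'(1)[OF good(3) differences(2)] chi_diff'(1)[OF good(3) differences(4)]
      chi_diff'(2)[OF good(3) differences(6)] by (simp_all only: *[OF good(3)])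
  show "chi p3 p0 = chi p3 (of_int k)" "chi p3 p1 = chi p3 (of_int k)" "chi p3 p2 = - chi p3 (of_int k)"
    using chi_diff'(1)[OF good(4) differences(3)] chi_diff'(1)[OF good(4) differences(5)]
      chi_diff'(1)[OF good(4) differences(6)] by (simp_all only: *[OF good(4)])
qed

lemma n_factors: "n = p0 * (p1 * p2 * p3)" "n = p1 * (p0 * p2 * p3)" "n = p2 * (p0 * p1 * p3)" "n = p3 * (p0 * p1 * p2)"
  by (simp_all add: n_def mult_ac)

lemma n_nonzero: "n \<noteq> 0"
  using prime_elems by (simp add: n_def prime_elem_def)

lemma not_dvd_cofactor:
  "\<not> p0 dvd p1 * p2 * p3" "\<not> p1 dvd p0 * p2 * p3" "\<not> p2 dvd p0 * p1 * p3" "\<not> p3 dvd p0 * p1 * p2"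
  using not_dvd by (simp_all add: prime_elem_dvd_mult_iff prime_elems)

text \<open>Away from \<open>n\<close> the squarefree part \<open>D\<close> of an abscissa is a unit, so \<open>D\<close> is recorded by that unit and by four
  truth values telling which \<open>p\<^sub>j\<close> divide it.\<close>

definition part :: "bool \<Rightarrow> gint \<Rightarrow> gint" where "part s p = (if s then p else 1)"

lemma split_prime:
  assumes "prime_elem p" "\<not> p^2 dvd D"
  obtains s D' where "D = part s p * D'" "\<not> p dvd D'"
proof (cases "p dvd D")
  case True
  then obtain D' where D': "D = p * D'" by (elim dvdE)
  have "\<not> p dvd D'" using assms(2) unfolding D' power2_eq_square by (metis mult_dvd_mono dvd_refl)
  thus ?thesis using that[of True D'] D' by (simp add: part_def)
next
  case False
  thus ?thesis using that[of False D] by (simp add: part_def)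
qed

lemma squarefree_shape:
  assumes D: "D \<noteq> 0" and sqf: "\<And>\<rho>. prime_elem \<rho> \<Longrightarrow> \<not> \<rho>^2 dvd D"
    and dvd: "\<And>\<rho>. prime_elem \<rho> \<Longrightarrow> \<rho> dvd D \<Longrightarrow> \<rho> dvd n"
  obtains u s0 s1 s2 s3 where "is_unit u" "D = u * part s0 p0 * part s1 p1 * part s2 p2 * part s3 p3"
proof -
  have sq: "\<not> \<rho>^2 dvd E" if "prime_elem \<rho>" "E dvd D" for \<rho> E
    using sqf[OF that(1)] dvd_trans[OF _ that(2)] by blast
  obtain s0 D0 where 0: "D = part s0 p0 * D0" "\<not> p0 dvd D0"
    using split_prime[OF prime_elems(1) sqf[OF prime_elems(1)]] by blast
  have d0: "D0 dvd D" unfolding 0(1) by (rule dvd_triv_right)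
  obtain s1 D1 where 1: "D0 = part s1 p1 * D1" "\<not> p1 dvd D1"
    using split_prime[OF prime_elems(2) sq[OF prime_elems(2) d0]] by blast
  have d01: "D1 dvd D0" unfolding 1(1) by (rule dvd_triv_right)
  hence d1: "D1 dvd D" using d0 by (rule dvd_trans)
  obtain s2 D2 where 2: "D1 = part s2 p2 * D2" "\<not> p2 dvd D2"
    using split_prime[OF prime_elems(3) sq[OF prime_elems(3) d1]] by blast
  have d12: "D2 dvd D1" unfolding 2(1) by (rule dvd_triv_right)
  hence d2: "D2 dvd D" using d1 by (rule dvd_trans)
  obtain s3 D3 where 3: "D2 = part s3 p3 * D3" "\<not> p3 dvd D3"
    using split_prime[OF prime_elems(4) sq[OF prime_elems(4) d2]] by blast
  have d23: "D3 dvd D2" unfolding 3(1) by (rule dvd_triv_right)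
  hence d3: "D3 dvd D" using d2 by (rule dvd_trans)
  have nd: "\<not> p0 dvd D3" "\<not> p1 dvd D3" "\<not> p2 dvd D3"
    using 0(2) 1(2) 2(2) dvd_trans[OF d23 dvd_trans[OF d12 d01]] dvd_trans[OF d23 d12] d23
    by (blast dest: dvd_trans)+
  have "is_unit D3"
  proof (rule ccontr)
    assume "\<not> is_unit D3"
    moreover have "D3 \<noteq> 0" using D d3 by auto
    ultimately have "\<exists>\<rho>. \<rho> dvd D3 \<and> Factorial_Ring.prime \<rho>" by (intro prime_divisor_exists)
    then obtain \<rho> where \<rho>: "\<rho> dvd D3" "Factorial_Ring.prime \<rho>" by blast
    have pe: "prime_elem \<rho>" using \<rho>(2) by simp
    have "\<rho> dvd D" using \<rho>(1) d3 by (rule dvd_trans)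
    hence "\<rho> dvd n" by (rule dvd[OF pe])
    hence or: "\<rho> dvd p0 \<or> \<rho> dvd p1 \<or> \<rho> dvd p2 \<or> \<rho> dvd p3"
      unfolding n_def by (simp add: prime_elem_dvd_mult_iff[OF pe] disj_assoc)
    have *: "p dvd D3" if p: "\<rho> dvd p" "prime_elem p" for p
    proof -
      obtain u where "is_unit u" "p = \<rho> * u" by (rule associated_primes[OF pe p(2,1)])
      thus ?thesis using \<rho>(1) by (simp add: mult_unit_dvd_iff)
    qed
    show False using or *[OF _ prime_elems(1)] *[OF _ prime_elems(2)] *[OF _ prime_elems(3)] *[OF _ prime_elems(4)] nd 3(2)
      by (elim disjE) simp_all
  qed
  moreover have "D = D3 * part s0 p0 * part s1 p1 * part s2 p2 * part s3 p3"
    unfolding 0(1) 1(1) 2(1) 3(1) by (simp add: mult_ac)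
  ultimately show ?thesis by (rule that)
qed

lemma chi_unit:
  assumes "is_unit u" "good p"
  shows "chi p u = (if u = gi \<or> u = - gi then - 1 else 1)"
proof -
  have "chi p 1 = 1" using chi_mult[OF assms(2), of "- 1" "- 1"] chi_minus_1[OF assms(2)] by simp
  moreover have "u = 1 \<or> u = - 1 \<or> u = gi \<or> u = - gi" using assms(1) by (simp add: gint_unit_iff)
  moreover have "1 \<noteq> gi" "1 \<noteq> - gi" "- 1 \<noteq> gi" "- 1 \<noteq> - gi" by (simp_all add: gint_eq_iff)
  ultimately show ?thesis
    using chi_minus_1[OF assms(2)] chi_gi[OF assms(2)] chi_uminus[OF assms(2), of gi] by (elim disjE) simp_all
qed

lemma chi_part_square: "good p \<Longrightarrow> \<not> p dvd q \<Longrightarrow> chi p (part s q) * chi p q = chi p (part (\<not> s) q)"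
  using chi_square[of p q] chi_square[of p 1] by (auto simp: part_def chi_mult power2_eq_square)

text \<open>At a prime not dividing D the condition concerns D itself. At a prime dividing D it
  concerns the cofactor times the other three primes, which flips their flags up to squares. Both
  cases are expressed by comparing each flag with that of the prime at hand.\<close>

lemma squareclass_signs:
  assumes u: "is_unit u" and D: "D = u * part s0 p0 * part s1 p1 * part s2 p2 * part s3 p3"
    and cop: "coprime p q" and eq: "w^2 = D * (D^2 * p^4 - n^2 * q^4)"
  defines "\<sigma> \<equiv> (if u = gi \<or> u = - gi then - 1 else 1)"
  shows "\<sigma> * chi p0 (part (s1 \<noteq> s0) p1) * chi p0 (part (s2 \<noteq> s0) p2) * chi p0 (part (s3 \<noteq> s0) p3) = 1"
    "\<sigma> * chi p1 (part (s0 \<noteq> s1) p0) * chi p1 (part (s2 \<noteq> s1) p2) * chi p1 (part (s3 \<noteq> s1) p3) = 1"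
    "\<sigma> * chi p2 (part (s0 \<noteq> s2) p0) * chi p2 (part (s1 \<noteq> s2) p1) * chi p2 (part (s3 \<noteq> s2) p3) = 1"
    "\<sigma> * chi p3 (part (s0 \<noteq> s3) p0) * chi p3 (part (s1 \<noteq> s3) p1) * chi p3 (part (s2 \<noteq> s3) p2) = 1"
proof -
  have gen: "\<sigma> * chi \<pi> (part (sa \<noteq> s) a) * chi \<pi> (part (sb \<noteq> s) b) * chi \<pi> (part (sc \<noteq> s) c) = 1"
    if g: "good \<pi>" and nd: "\<not> \<pi> dvd a" "\<not> \<pi> dvd b" "\<not> \<pi> dvd c" and n: "n = \<pi> * (a * b * c)"
      and D: "D = u * part s \<pi> * part sa a * part sb b * part sc c" for \<pi> a b c s sa sb sc
  proof -
    note \<pi> = good_prime_elem[OF g]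
    have nu: "\<not> \<pi> dvd u" using u prime_elem_not_unit[OF \<pi>] dvd_unit_imp_unit by blast
    have npart: "\<not> \<pi> dvd part t x" if "\<not> \<pi> dvd x" for t x
      using that prime_elem_not_unit[OF \<pi>] by (simp add: part_def)
    define D' where "D' = u * part sa a * part sb b * part sc c"
    have nD': "\<not> \<pi> dvd D'"
      unfolding D'_def using nu npart[OF nd(1), of sa] npart[OF nd(2), of sb] npart[OF nd(3), of sc]
      by (simp add: prime_elem_dvd_mult_iff[OF \<pi>])
    have nabc: "\<not> \<pi> dvd a * b * c" using nd by (simp add: prime_elem_dvd_mult_iff[OF \<pi>])
    have \<sigma>: "chi \<pi> u = \<sigma>" unfolding \<sigma>_def by (rule chi_unit[OF u g])
    show ?thesis
    proof (cases s)
      case True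
      have D1: "D = \<pi> * D'" using True D by (simp add: D'_def part_def mult_ac)
      have "chi \<pi> (D' * (a * b * c)) = 1"
        by (rule descent_chi_dvd[OF g cop n nabc eq D1 nD'])
      hence "\<sigma> * (chi \<pi> (part sa a) * chi \<pi> a) * (chi \<pi> (part sb b) * chi \<pi> b) * (chi \<pi> (part sc c) * chi \<pi> c) = 1"
        unfolding D'_def by (simp only: chi_mult[OF g] \<sigma> mult_ac)
      thus ?thesis using True by (simp add: chi_part_square[OF g nd(1)] chi_part_square[OF g nd(2)] chi_part_square[OF g nd(3)])
    next
      case False
      have D1: "D = D'" using False D by (simp add: D'_def part_def)
      have "chi \<pi> D' = 1"
        using descent_chi_not_dvd[OF g cop n nabc eq] nD' unfolding D1 by simp
      thus ?thesis using False unfolding D'_def by (simp add: chi_mult[OF g] \<sigma>)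
    qed
  qed
  show "\<sigma> * chi p0 (part (s1 \<noteq> s0) p1) * chi p0 (part (s2 \<noteq> s0) p2) * chi p0 (part (s3 \<noteq> s0) p3) = 1"
    by (rule gen[OF good(1) not_dvd(1,2,3) n_factors(1)]) (simp only: D mult_ac)
  show "\<sigma> * chi p1 (part (s0 \<noteq> s1) p0) * chi p1 (part (s2 \<noteq> s1) p2) * chi p1 (part (s3 \<noteq> s1) p3) = 1"
    by (rule gen[OF good(2) not_dvd(4,5,6) n_factors(2)]) (simp only: D mult_ac)
  show "\<sigma> * chi p2 (part (s0 \<noteq> s2) p0) * chi p2 (part (s1 \<noteq> s2) p1) * chi p2 (part (s3 \<noteq> s2) p3) = 1"
    by (rule gen[OF good(3) not_dvd(7,8,9) n_factors(3)]) (simp only: D mult_ac)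
  show "\<sigma> * chi p3 (part (s0 \<noteq> s3) p0) * chi p3 (part (s1 \<noteq> s3) p1) * chi p3 (part (s2 \<noteq> s3) p2) = 1"
    by (rule gen[OF good(4) not_dvd(10,11,12) n_factors(4)]) (simp only: D mult_ac)
qed

lemma squareclass:
  assumes u: "is_unit u" and D: "D = u * part s0 p0 * part s1 p1 * part s2 p2 * part s3 p3"
    and cop: "coprime p q" and eq: "w^2 = D * (D^2 * p^4 - n^2 * q^4)"
  shows "\<exists>d\<in>{1, n, gi * (p1 * p3), gi * (p0 * p2)}. D = d \<or> D = - d"
proof -
  define e0 e1 where "e0 = chi p0 (of_int k)" and "e1 = chi p1 (of_int k)"
  have e: "e0 = 1 \<or> e0 = - 1" "e1 = 1 \<or> e1 = - 1"
    using chi_k by (simp_all add: e0_def e1_def)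
  have table: "chi p0 p1 = - e0" "chi p0 p2 = - e0" "chi p0 p3 = e0" "chi p1 p0 = - e1" "chi p1 p2 = e1" "chi p1 p3 = e1"
    "chi p2 p0 = - e0" "chi p2 p1 = e0" "chi p2 p3 = - e0"
    using chi_table chi_k(3) by (simp_all add: e0_def e1_def)
  have one: "chi p0 1 = 1" "chi p1 1 = 1" "chi p2 1 = 1" "chi p3 1 = 1"
    using chi_unit[of 1] good by (simp_all add: gint_eq_iff)
  define \<sigma> :: int where "\<sigma> = (if u = gi \<or> u = - gi then - 1 else 1)"
  have \<sigma>: "\<sigma> = 1 \<or> \<sigma> = - 1" by (simp add: \<sigma>_def)
  note signs = squareclass_signs[OF assms, folded \<sigma>_def, unfolded part_def]
  have "(\<sigma> = 1 \<and> s1 = s0 \<and> s2 = s0 \<and> s3 = s0) \<or> (\<sigma> = - 1 \<and> s2 = s0 \<and> s1 = (\<not> s0) \<and> s3 = (\<not> s0))"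
    by (rule sign_cases[OF \<sigma> e(1,2)])
      (use signs(1-3) in \<open>simp_all only: if_distrib[of "chi p0"] if_distrib[of "chi p1"] if_distrib[of "chi p2"] table one\<close>)
  moreover have "u = 1 \<or> u = - 1" if "\<sigma> = 1"
    using that u by (auto simp: \<sigma>_def gint_unit_iff split: if_splits)
  moreover have "u = gi \<or> u = - gi" if "\<sigma> = - 1"
    using that by (auto simp: \<sigma>_def split: if_splits)
  ultimately show ?thesis
    unfolding D n_def by (cases s0) (auto simp: part_def mult_ac)
qed

end


section \<open>Square classes of abscissas of rational points\<close>

lemma gaussian_rats_power: "x \<in> gaussian_rats \<Longrightarrow> x ^ m \<in> gaussian_rats"
  by (rule gaussian_rats_closed(6)[of x x])

lemma gaussian_rats_uminus: "x \<in> gaussian_rats \<Longrightarrow> - x \<in> gaussian_rats"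
  by (rule gaussian_rats_closed(3)[of x x])

context four_primes
begin

text \<open>A representative of minimal norm of the square class of \<open>x\<close> is squarefree.\<close>

lemma squarefree_representative:
  assumes x: "x \<in> gaussian_rats" "x \<noteq> 0"
  obtains D t where "D \<noteq> 0" "t \<in> gaussian_rats" "t \<noteq> 0" "x = of_gint D * t^2"
    "\<And>\<rho>. prime_elem \<rho> \<Longrightarrow> \<not> \<rho>^2 dvd D"
proof -
  define S where "S = {D. D \<noteq> 0 \<and> (\<exists>t\<in>gaussian_rats. t \<noteq> 0 \<and> x = of_gint D * t^2)}"
  obtain p q where pq: "q \<noteq> 0" "x = of_gint p / of_gint q" using x(1) by (rule gaussian_ratsE)
  have "p \<noteq> 0" using pq x(2) by auto
  have "p * q \<in> S" unfolding S_def
  proof (intro CollectI conjI bexI)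
    show "p * q \<noteq> 0" using pq(1) \<open>p \<noteq> 0\<close> by simp
    show "1 / of_gint q \<in> gaussian_rats" by (intro gaussian_rats_closed(5)) simp_all
    show "1 / of_gint q \<noteq> 0" using pq(1) by simp
    show "x = of_gint (p * q) * (1 / of_gint q)^2" using pq by (simp add: power2_eq_square)
  qed
  then obtain D where D: "D \<in> S" "\<And>D'. D' \<in> S \<Longrightarrow> nat (gnorm D) \<le> nat (gnorm D')"
    using ex_has_least_nat[of "\<lambda>D. D \<in> S" "p * q" "\<lambda>D. nat (gnorm D)"] by blast
  then obtain t where t: "D \<noteq> 0" "t \<in> gaussian_rats" "t \<noteq> 0" "x = of_gint D * t^2" by (auto simp: S_def)
  have "\<not> \<rho>^2 dvd D" if \<rho>: "prime_elem \<rho>" for \<rho>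
  proof
    assume "\<rho>^2 dvd D"
    then obtain D' where D': "D = \<rho>^2 * D'" by (elim dvdE)
    have "\<rho> \<noteq> 0" using \<rho> by (simp add: prime_elem_def)
    have "D' \<in> S" unfolding S_def
    proof (intro CollectI conjI bexI)
      show "D' \<noteq> 0" using t(1) D' by auto
      show "of_gint \<rho> * t \<in> gaussian_rats" using t(2) by (intro gaussian_rats_closed(4)) simp_all
      show "of_gint \<rho> * t \<noteq> 0" using t(3) \<open>\<rho> \<noteq> 0\<close> by simp
      show "x = of_gint D' * (of_gint \<rho> * t)^2" using t(4) by (simp add: D' power_mult_distrib)
    qed
    hence "gnorm D \<le> gnorm D'" using D(2)[of D'] gnorm_nonneg[of D'] by (simp add: nat_le_eq_zle)
    moreover have "gnorm D = gnorm \<rho> ^ 2 * gnorm D'" by (simp add: D' gnorm_mult gnorm_power)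
    moreover have "gnorm D' > 0" using t(1) D' by (intro gnorm_pos_iff[THEN iffD2]) auto
    ultimately have "gnorm \<rho> ^ 2 \<le> 1" by simp
    hence "gnorm \<rho> \<le> 1" using abs_square_le_1[of "gnorm \<rho>"] by simp
    moreover have "gnorm \<rho> > 0" using \<open>\<rho> \<noteq> 0\<close> by (rule gnorm_pos_iff[THEN iffD2])
    ultimately have "gnorm \<rho> = 1" by linarith
    hence "is_unit \<rho>" using mult_gcnj[of \<rho>] by (metis dvd_triv_left of_int_1)
    thus False using prime_elem_not_unit[OF \<rho>] by simp
  qed
  thus ?thesis using that t by blast
qed

text \<open>With x = D t^2 and t = p/q, the number z = y q^2 / t satisfies the descent equation. Its
  square is a Gaussian integer, hence so is z. The sign of D is absorbed into t because -1 =
  i^2.\<close>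

lemma abscissa_class:
  assumes x: "x \<in> gaussian_rats" "x \<noteq> 0" and y: "y \<in> gaussian_rats" and eq: "y^2 = x^3 - of_gint n^2 * x"
  shows "\<exists>d\<in>{1, n, gi * (p1 * p3), gi * (p0 * p2)}. \<exists>t\<in>gaussian_rats. x = of_gint d * t^2"
proof -
  obtain D t where D: "D \<noteq> 0" "t \<in> gaussian_rats" "t \<noteq> 0" "x = of_gint D * t^2"
    and sqf: "\<And>\<rho>. prime_elem \<rho> \<Longrightarrow> \<not> \<rho>^2 dvd D"
    using squarefree_representative[OF x] by blast
  obtain p q where pq: "q \<noteq> 0" "coprime p q" "t = of_gint p / of_gint q" using D(2) by (rule gaussian_ratsE)
  define z where "z = y * of_gint q ^ 2 / t"
  have zK: "z \<in> gaussian_rats" unfolding z_def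
    by (intro gaussian_rats_closed(4,5) gaussian_rats_power y D(2)) simp
  have tq: "t * of_gint q = of_gint p" using pq by simp
  have "t^2 * z^2 = (y * of_gint q ^ 2)^2" using D(3) by (simp add: z_def power_divide)
  also have "\<dots> = t^2 * (of_gint D * (of_gint D^2 * (t * of_gint q)^4 - of_gint n^2 * of_gint q^4))"
    using eq D(4) by Groebner_Basis.algebra
  finally have "z^2 = of_gint D * (of_gint D^2 * of_gint p^4 - of_gint n^2 * of_gint q^4)"
    using D(3) tq by simp
  hence "z^2 = of_gint (D * (D^2 * p^4 - n^2 * q^4))" by simp
  then obtain w where w: "D * (D^2 * p^4 - n^2 * q^4) = w^2"
    using gaussian_rat_square_integral[OF zK] by metis
  have dvd: "\<rho> dvd n" if "prime_elem \<rho>" "\<rho> dvd D" for \<rho>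
    by (rule descent_prime_dvd[OF that(1) sqf[OF that(1)] pq(2) w[symmetric] that(2)])
  obtain u s0 s1 s2 s3 where "is_unit u" "D = u * part s0 p0 * part s1 p1 * part s2 p2 * part s3 p3"
    by (rule squarefree_shape[OF D(1) sqf dvd])
  from squareclass[OF this pq(2) w[symmetric]]
  obtain d where d: "d \<in> {1, n, gi * (p1 * p3), gi * (p0 * p2)}" "D = d \<or> D = - d" by blast
  have "\<exists>t\<in>gaussian_rats. x = of_gint d * t^2"
  proof (cases "D = d")
    case True
    thus ?thesis using D by blast
  next
    case False
    hence "x = of_gint d * (\<i> * t)^2" using d(2) D(4) by (simp add: power_mult_distrib)
    moreover have "\<i> * t \<in> gaussian_rats" using D(2) by (intro gaussian_rats_closed(4)) simp_all
    ultimately show ?thesis by blast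
  qed
  thus ?thesis using d(1) by blast
qed

end

section \<open>Complex multiplication by i and by 1 + i\<close>

lemma vieta_tangent_slope:
  assumes "vieta a b l m x x x3"
  shows "2 * l * (l * x + m) = 3 * x^2 + a"
  using assms unfolding vieta_def by Groebner_Basis.algebra

lemma Pt_add_eqI':
  assumes P: "y1^2 = x1^3 - x1" and Q: "y2^2 = x2^3 - x2" and v: "vieta (- 1) 0 l m x1 x2 x3"
    and y: "y1 = l * x1 + m" "y2 = l * x2 + m" and ne: "\<not> (x1 = x2 \<and> y1 + y2 = 0)"
  shows "Pt x1 y1 + Pt x2 y2 = Pt x3 (- (l * x3 + m))"
proof (cases "x1 = x2")
  case False
  thus ?thesis using Pt_add_eqI[OF P Q v y] by simp
next
  case True
  hence "y1 = y2" using y by simp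
  hence y1: "y1 = y2" "y1 \<noteq> 0" using True ne by auto
  obtain l' m' x3' where *: "y1 = l' * x1 + m'" "vieta (- 1) 0 l' m' x1 x2 x3'"
    "Pt x1 y1 + Pt x2 y2 = Pt x3' (- (l' * x3' + m'))"
    by (rule Pt_add[OF P Q ne]) blast
  have "2 * l * y1 = 2 * l' * y1"
    using vieta_tangent_slope[of "- 1" 0 l m x1 x3] vieta_tangent_slope[of "- 1" 0 l' m' x1 x3'] v *(1,2) y(1) True by simp
  hence l: "l' = l" using y1(2) by simp
  hence m: "m' = m" using *(1) y(1) by simp
  have "x3' = x3" using v *(2) unfolding l m vieta_def by (metis add_left_cancel)
  thus ?thesis using *(3) l m by simp
qed

definition imul :: "pt \<Rightarrow> pt" where
  "imul P = (if P = 0 then 0 else Pt (- xc P) (\<i> * yc P))"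

text \<open>Multiplication by 1 + i, an isogeny of degree 2. By \<open>phi_phi\<close> its square is
  doubling up to the unit i, so two descents along \<open>phi\<close> make one along 2.\<close>

definition phi :: "pt \<Rightarrow> pt" where "phi P = P + imul P"

lemma imul_on_curve: "y^2 = x^3 - x \<Longrightarrow> (\<i> * y)^2 = (- x)^3 - (- x)"
  by (simp add: power_mult_distrib)

lemma imul_zero [simp]: "imul 0 = 0"
  by (simp add: imul_def)

lemma imul_Pt: "y^2 = x^3 - x \<Longrightarrow> imul (Pt x y) = Pt (- x) (\<i> * y)"
  by (simp add: imul_def Pt_neq_0)

lemma imul_imul: "imul (imul P) = - P"
  by (cases P rule: pt_cases) (simp_all add: imul_Pt imul_on_curve minus_Pt del: mult_minus_right)

lemma imul_add: "imul (P + Q) = imul P + imul Q"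
proof (cases P rule: pt_cases; cases Q rule: pt_cases)
  fix x1 y1 x2 y2
  assume P: "y1^2 = x1^3 - x1" "P = Pt x1 y1" and Q: "y2^2 = x2^3 - x2" "Q = Pt x2 y2"
  have P': "(\<i> * y1)^2 = (- x1)^3 - (- x1)" and Q': "(\<i> * y2)^2 = (- x2)^3 - (- x2)"
    by (rule imul_on_curve; fact)+
  show ?thesis
  proof (cases "x1 = x2 \<and> y1 + y2 = 0")
    case True
    hence y2: "y2 = - y1" by (simp add: add_eq_0_iff)
    have "P + Q = 0" using P True y2 Pt_add_opposite[OF P(1)] Q by simp
    moreover have "imul P + imul Q = 0"
      using P Q True y2 Pt_add_opposite[OF P'] by (simp add: imul_Pt)
    ultimately show ?thesis by simp
  next
    case False
    obtain l m x3 where *: "y1 = l * x1 + m" "y2 = l * x2 + m" "vieta (- 1) 0 l m x1 x2 x3"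
      "(- (l * x3 + m))^2 = x3^3 - x3" "Pt x1 y1 + Pt x2 y2 = Pt x3 (- (l * x3 + m))"
      by (rule Pt_add[OF P(1) Q(1) False]) blast
    have "vieta (- 1) 0 (- \<i> * l) (\<i> * m) (- x1) (- x2) (- x3)"
      using *(3) by (simp add: vieta_def power_mult_distrib algebra_simps)
    moreover have "\<i> * y1 = - \<i> * l * - x1 + \<i> * m" "\<i> * y2 = - \<i> * l * - x2 + \<i> * m"
      using *(1,2) by (simp_all add: algebra_simps)
    moreover have "\<not> (- x1 = - x2 \<and> \<i> * y1 + \<i> * y2 = 0)"
      using False by (simp flip: distrib_left)
    ultimately have "Pt (- x1) (\<i> * y1) + Pt (- x2) (\<i> * y2) = Pt (- x3) (- (- \<i> * l * - x3 + \<i> * m))"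
      by (rule Pt_add_eqI'[OF P' Q'])
    also have "- (- \<i> * l * - x3 + \<i> * m) = \<i> * (- (l * x3 + m))" by (simp add: algebra_simps)
    finally show ?thesis using P Q *(4,5) by (simp add: imul_Pt del: minus_add_distrib)
  qed
qed (simp_all add: zero_add_pt add_zero_pt)

lemma imul_minus: "imul (- P) = - imul P"
proof -
  have "imul (- P) + imul P = 0" by (simp flip: imul_add)
  thus ?thesis by (simp add: eq_neg_iff_add_eq_0)
qed

lemma phi_zero [simp]: "phi 0 = 0"
  by (simp add: phi_def)

lemma phi_add: "phi (P + Q) = phi P + phi Q"
  by (simp add: phi_def imul_add)

lemma phi_minus: "phi (- P) = - phi P"
  by (simp add: phi_def imul_minus)

lemma phi_imul: "phi (imul P) = imul (phi P)"
  by (simp add: phi_def imul_add)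

lemma phi_phi: "phi (phi P) = imul P + imul P"
  by (simp add: phi_def imul_add imul_imul)

text \<open>The line through (x, y) and (-x, i y) has slope l, and its three abscissas sum to l^2,
  so the third one is l^2. That it is a square lets square classes detect the image of
  \<open>phi\<close>.\<close>

lemma xc_phi:
  assumes "P \<noteq> 0" "xc P \<noteq> 0"
  shows "phi P \<noteq> 0" "xc (phi P) = (xc P^2 - 1) / (2 * \<i> * xc P)" "xc (phi P) = (yc P * (1 - \<i>) / (2 * xc P))^2"
proof -
  obtain x y where P: "y^2 = x^3 - x" "P = Pt x y" using assms(1) by (rule nonzero_ptE)
  have x0: "x \<noteq> 0" using assms(2) P by simp
  have P': "(\<i> * y)^2 = (- x)^3 - (- x)" by (rule imul_on_curve) fact
  have ne: "\<not> (x = - x \<and> y + \<i> * y = 0)" using x0 by simp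
  obtain l m x3 where *: "y = l * x + m" "\<i> * y = l * (- x) + m" "vieta (- 1) 0 l m x (- x) x3"
    "(- (l * x3 + m))^2 = x3^3 - x3" "Pt x y + Pt (- x) (\<i> * y) = Pt x3 (- (l * x3 + m))"
    by (rule Pt_add[OF P(1) P' ne]) blast
  have phi: "phi P = Pt x3 (- (l * x3 + m))" unfolding phi_def P(2) imul_Pt[OF P(1)] by (rule *(5))
  show "phi P \<noteq> 0" unfolding phi by (rule Pt_neq_0) fact
  have xc: "xc (phi P) = x3" unfolding phi by (rule coords_Pt) fact
  have "y * (1 - \<i>) = 2 * x * l" using *(1,2) by (simp add: algebra_simps)
  hence l: "l = y * (1 - \<i>) / (2 * x)" using x0 by (simp add: field_simps)
  have x3: "x3 = l^2" using *(3) by (simp add: vieta_def)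
  show "xc (phi P) = (yc P * (1 - \<i>) / (2 * xc P))^2" using xc x3 l P by simp
  have "2 * \<i> * x * x3 * x = (x^2 - 1) * x"
  proof -
    have ii: "\<i> * \<i> = (- 1 :: complex)" by simp
    have "2 * x * l = y * (1 - \<i>)" using x0 unfolding l by simp
    thus ?thesis using P(1) ii unfolding x3 by Groebner_Basis.algebra
  qed
  hence "2 * \<i> * x * x3 = x^2 - 1" using x0 by simp
  hence "x3 = (x^2 - 1) / (2 * \<i> * x)" using x0 by (simp add: field_simps)
  thus "xc (phi P) = (xc P^2 - 1) / (2 * \<i> * xc P)" using xc P by simp
qed

lemma phi_xc_0: "xc P = 0 \<Longrightarrow> phi P = 0"
proof -
  assume x: "xc P = 0"
  show ?thesis
  proof (cases "P = 0")
    case False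
    have "yc P = 0" using coords_on_curve[of P] x by simp
    hence "P = Pt 0 0" using Pt_coords[OF False] x by simp
    thus ?thesis using Pt_add_opposite[of 0 0] by (simp add: phi_def imul_Pt)
  qed simp
qed

lemma xc_eq_imp: "P \<noteq> 0 \<Longrightarrow> R \<noteq> 0 \<Longrightarrow> xc P = xc R \<Longrightarrow> R = P \<or> R = - P"
proof -
  assume P: "P \<noteq> 0" and R: "R \<noteq> 0" and x: "xc P = xc R"
  have "(yc R)^2 = (yc P)^2" using coords_on_curve[of P] coords_on_curve[of R] x by simp
  hence "yc R = yc P \<or> yc R = - yc P" by (simp add: power2_eq_iff)
  thus ?thesis using Pt_coords[OF P] Pt_coords[OF R] minus_Pt[OF coords_on_curve[of P]] x by metis
qed


lemma xc_minus [simp]: "xc (- P) = xc P"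
  by (cases P rule: pt_cases) (simp_all add: minus_Pt)

lemma yc_minus [simp]: "yc (- P) = - yc P"
  by (cases P rule: pt_cases) (simp_all add: minus_Pt)

lemma xc_imul [simp]: "xc (imul P) = - xc P"
  by (cases P rule: pt_cases) (simp_all add: imul_Pt imul_on_curve del: mult_minus_right)

lemma yc_imul [simp]: "yc (imul P) = \<i> * yc P"
  by (cases P rule: pt_cases) (simp_all add: imul_Pt imul_on_curve del: mult_minus_right)

lemmas rats_closed = gaussian_rats_closed(1,2,4,5) gaussian_rats_power gaussian_rats_uminus

section \<open>Rational points of the twist as a subgroup\<close>

context four_primes
begin

definition "s = csqrt (of_gint n)"

text \<open>The points of the curve \<open>Y\<^sup>2 = X\<^sup>3 - X\<close> that correspond to \<open>\<rat>(\<i>)\<close>-rational points of \<open>y\<^sup>2 = x\<^sup>3 - n\<^sup>2 x\<close>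
  under \<open>(x, y) = (n X, n s Y)\<close>.\<close>

definition G :: "pt set" where "G = {P. xc P \<in> gaussian_rats \<and> yc P / s \<in> gaussian_rats}"

definition T :: pt where "T = Pt 1 0"

text \<open>On the curve for n it is the point with abscissa i p0^2 p1 p3, in the class of i p1 p3.
  It lies on the curve because of the identity p0^2 + p2^2 = 2 p1 p3.\<close>

definition Q :: pt where "Q = Pt (\<i> * of_gint p0 / of_gint p2) (s * (1 - \<i>) / of_gint p2 ^ 2)"

lemma s2: "s^2 = of_gint n" "s * s = of_gint n"
  by (simp_all add: s_def power2_eq_square[symmetric])

lemma s_nonzero: "s \<noteq> 0"
  using n_nonzero by (simp add: s_def)

lemma ratioE:
  assumes "z / s \<in> gaussian_rats"
  obtains w where "w \<in> gaussian_rats" "z = s * w"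
proof
  show "z / s \<in> gaussian_rats" by fact
  show "z = s * (z / s)" using s_nonzero by simp
qed

lemma s_div_s: "s * w / s = w"
  using s_nonzero by simp

lemma G_zero: "0 \<in> G"
  by (simp add: G_def)

lemma G_Pt: "y^2 = x^3 - x \<Longrightarrow> Pt x y \<in> G \<longleftrightarrow> x \<in> gaussian_rats \<and> y / s \<in> gaussian_rats"
  by (simp add: G_def)

lemma G_minus: "P \<in> G \<Longrightarrow> - P \<in> G"
  by (simp add: G_def gaussian_rats_uminus)

lemma G_imul: "P \<in> G \<Longrightarrow> imul P \<in> G"
proof -
  assume "P \<in> G"
  hence "\<i> * (yc P / s) \<in> gaussian_rats" by (intro gaussian_rats_closed(4)) (simp_all add: G_def)
  thus ?thesis using \<open>P \<in> G\<close> by (simp add: G_def gaussian_rats_uminus)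
qed

text \<open>Ordinates are s times rational numbers, hence so are chord slopes. A tangent slope has s
  in the denominator instead, and 1/s = s/n.\<close>

lemma slope_rational:
  assumes x: "x1 \<in> gaussian_rats" "x2 \<in> gaussian_rats" and y: "y1 / s \<in> gaussian_rats" "y2 / s \<in> gaussian_rats"
    and l: "y1 = l * x1 + m" "y2 = l * x2 + m" and t: "x1 = x2 \<Longrightarrow> 2 * l * y1 = 3 * x1^2 - 1"
    and ne: "\<not> (x1 = x2 \<and> y1 + y2 = 0)"
  obtains l' m' where "l' \<in> gaussian_rats" "m' \<in> gaussian_rats" "l = s * l'" "m = s * m'"
proof -
  obtain y1' y2' where y': "y1' \<in> gaussian_rats" "y1 = s * y1'" "y2' \<in> gaussian_rats" "y2 = s * y2'"
    using y by (elim ratioE)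
  have "\<exists>l'\<in>gaussian_rats. l = s * l'"
  proof (cases "x1 = x2")
    case False
    have "l * (x1 - x2) = s * (y1' - y2')" using l y' by (simp add: algebra_simps)
    hence "l = s * ((y1' - y2') / (x1 - x2))" using False by (simp add: field_simps)
    moreover have "(y1' - y2') / (x1 - x2) \<in> gaussian_rats" by (intro rats_closed x y')
    ultimately show ?thesis by blast
  next
    case True
    hence "y1 = y2" using l by simp
    hence "y1' \<noteq> 0" using ne True y' by auto
    have "l * (2 * s * y1') = 3 * x1^2 - 1" using t[OF True] y' by (simp add: mult_ac)
    hence "l = (3 * x1^2 - 1) / (2 * s * y1')" using \<open>y1' \<noteq> 0\<close> s_nonzero by (simp add: field_simps)
    also have "\<dots> = s * ((3 * x1^2 - 1) / (2 * of_gint n * y1'))"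
      unfolding s2(2)[symmetric] using s_nonzero \<open>y1' \<noteq> 0\<close> by simp
    finally have "l = s * ((3 * x1^2 - 1) / (2 * of_gint n * y1'))" .
    moreover have "(3 * x1^2 - 1) / (2 * of_gint n * y1') \<in> gaussian_rats" by (intro rats_closed x y') simp_all
    ultimately show ?thesis by blast
  qed
  then obtain l' where l': "l' \<in> gaussian_rats" "l = s * l'" by blast
  have "m = s * (y1' - l' * x1)" using l(1) l'(2) y' by (simp add: algebra_simps)
  moreover have "y1' - l' * x1 \<in> gaussian_rats" by (intro rats_closed x y' l')
  ultimately show ?thesis using that l' by blast
qed

text \<open>The intercept of the line is s m', and the product of the three abscissas is its square.
  So the classes of n x1, n x2, n x3 multiply to a square: the square class of n x behaves as a
  homomorphism.\<close>

lemma G_add_chord: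
  assumes P: "y1^2 = x1^3 - x1" "Pt x1 y1 \<in> G" and Q: "y2^2 = x2^3 - x2" "Pt x2 y2 \<in> G"
    and ne: "\<not> (x1 = x2 \<and> y1 + y2 = 0)"
  obtains m' x3 y3 where "m' \<in> gaussian_rats" "x1 * x2 * x3 = of_gint n * m'^2" "y3^2 = x3^3 - x3"
    "Pt x1 y1 + Pt x2 y2 = Pt x3 y3" "Pt x3 y3 \<in> G"
proof -
  obtain l m x3 where *: "y1 = l * x1 + m" "y2 = l * x2 + m" "vieta (- 1) 0 l m x1 x2 x3"
    "(- (l * x3 + m))^2 = x3^3 - x3" "Pt x1 y1 + Pt x2 y2 = Pt x3 (- (l * x3 + m))"
    "x1 = x2 \<Longrightarrow> 2 * l * y1 = 3 * x1^2 - 1"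
    by (rule Pt_add[OF P(1) Q(1) ne]) blast
  have K: "x1 \<in> gaussian_rats" "x2 \<in> gaussian_rats" "y1 / s \<in> gaussian_rats" "y2 / s \<in> gaussian_rats"
    using P Q by (simp_all add: G_Pt)
  obtain l' m' where lm: "l' \<in> gaussian_rats" "m' \<in> gaussian_rats" "l = s * l'" "m = s * m'"
    by (rule slope_rational[OF K *(1,2,6) ne])
  have "x3 = l^2 - x1 - x2" using *(3) by (simp add: vieta_def algebra_simps)
  also have "l^2 = of_gint n * l'^2" by (simp add: lm(3) power_mult_distrib s2)
  finally have x3: "x3 \<in> gaussian_rats" using K lm by (simp only:) (intro rats_closed; simp)
  have "- (l * x3 + m) = s * (- (l' * x3 + m'))" using lm by (simp add: algebra_simps)
  hence "- (l * x3 + m) / s = - (l' * x3 + m')" by (simp only: s_div_s)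
  moreover have "- (l' * x3 + m') \<in> gaussian_rats" by (intro rats_closed lm x3)
  ultimately have "Pt x3 (- (l * x3 + m)) \<in> G" using x3 by (simp only: G_Pt[OF *(4)])
  moreover have "x1 * x2 * x3 = of_gint n * m'^2" using *(3) by (simp add: vieta_def lm(4) power_mult_distrib s2)
  ultimately show ?thesis using that[OF lm(2) _ *(4,5)] by blast
qed

lemma G_add: "P \<in> G \<Longrightarrow> R \<in> G \<Longrightarrow> P + R \<in> G"
proof (cases P rule: pt_cases; cases R rule: pt_cases)
  fix x1 y1 x2 y2
  assume P: "y1^2 = x1^3 - x1" "P = Pt x1 y1" and R: "y2^2 = x2^3 - x2" "R = Pt x2 y2" and G: "P \<in> G" "R \<in> G"
  show "P + R \<in> G"
  proof (cases "x1 = x2 \<and> y1 + y2 = 0")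
    case True
    hence "y2 = - y1" by (simp add: add_eq_0_iff)
    thus ?thesis using True P R Pt_add_opposite[OF P(1)] G_zero by simp
  next
    case False
    have "Pt x1 y1 \<in> G" "Pt x2 y2 \<in> G" using G P R by simp_all
    then obtain x3 y3 where "Pt x1 y1 + Pt x2 y2 = Pt x3 y3" "Pt x3 y3 \<in> G"
      using G_add_chord[OF P(1) _ R(1) _ False] by metis
    thus ?thesis using P R by simp
  qed
qed (simp_all add: zero_add_pt add_zero_pt)

lemma G_diff: "P \<in> G \<Longrightarrow> R \<in> G \<Longrightarrow> P - R \<in> G"
  using G_add[of P "- R"] G_minus[of R] by simp

lemma G_phi: "P \<in> G \<Longrightarrow> phi P \<in> G"
  by (simp add: phi_def G_add G_imul)

lemma T_on_curve: "(0 :: complex)^2 = 1^3 - 1"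
  by simp

lemma T_coords [simp]: "xc T = 1" "yc T = 0" "T \<noteq> 0"
  using T_on_curve by (simp_all add: T_def Pt_neq_0)

lemma T_G: "T \<in> G"
  by (simp add: G_def)

lemma phi_T: "phi T = Pt 0 0"
proof -
  have "phi T \<noteq> 0" "xc (phi T) = 0" using xc_phi[of T] by simp_all
  moreover from this have "yc (phi T) = 0" using coords_on_curve[of "phi T"] by simp
  ultimately show ?thesis using Pt_coords[of "phi T"] by simp
qed

lemma p2_nonzero: "of_gint p2 \<noteq> 0"
  using prime_elems(3) by (simp add: prime_elem_def)

lemma Q_on_curve:
  "(s * (1 - \<i>) / of_gint p2 ^ 2)^2 = (\<i> * of_gint p0 / of_gint p2)^3 - \<i> * of_gint p0 / of_gint p2"
proof -
  define c d where "c = of_gint p0" and "d = of_gint p2"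
  have d: "d \<noteq> 0" using p2_nonzero by (simp add: d_def)
  have "2 * p1 * p3 = p0^2 + p2^2"
    unfolding p0_def p1_def p2_def p3_def using gi_mult_gi by Groebner_Basis.algebra
  hence "of_gint (2 * p1 * p3) = of_gint (p0^2 + p2^2)" by (rule arg_cong)
  hence e: "2 * (of_gint p1 * of_gint p3) = c^2 + d^2" by (simp add: c_def d_def mult.assoc)
  have i2: "(1 - \<i>)^2 = - 2 * \<i>" by (simp add: power2_eq_square algebra_simps)
  have "(s * (1 - \<i>) / d^2)^2 = of_gint n * (- 2 * \<i>) / d^4"
    by (simp only: power_divide power_mult_distrib s2 i2 power_mult[symmetric]) simp
  also have "of_gint n = c * d * (of_gint p1 * of_gint p3)" by (simp add: n_def c_def d_def mult_ac)
  also have "c * d * (of_gint p1 * of_gint p3) * (- 2 * \<i>) = - \<i> * (c * d * (2 * (of_gint p1 * of_gint p3)))"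
    by simp
  also have "\<dots> / d^4 = - \<i> * c * (c^2 + d^2) / d^3"
    unfolding e using d by (simp add: power4_eq_xxxx power3_eq_cube mult.assoc)
  also have "\<dots> = (\<i> * c / d)^3 - \<i> * c / d"
    using d by (simp add: power3_eq_cube power2_eq_square field_simps)
  finally show ?thesis by (simp only: c_def d_def)
qed

lemma Q_coords: "xc Q = \<i> * of_gint p0 / of_gint p2" "yc Q = s * (1 - \<i>) / of_gint p2 ^ 2" "Q \<noteq> 0"
  unfolding Q_def using Q_on_curve by (simp_all only: coords_Pt Pt_neq_0 not_False_eq_True)

lemma Q_G: "Q \<in> G"
proof -
  have "yc Q / s = (1 - \<i>) / of_gint p2 ^ 2" using s_nonzero by (simp add: Q_coords)
  moreover have "(1 - \<i>) / of_gint p2 ^ 2 \<in> gaussian_rats" by (intro rats_closed) simp_all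
  moreover have "\<i> * of_gint p0 / of_gint p2 \<in> gaussian_rats" by (intro rats_closed) simp_all
  ultimately show ?thesis by (simp add: G_def Q_coords(1))
qed

text \<open>A preimage of abscissa u must satisfy u^2 - 2 i x u - 1 = 0, with roots i (x + c) and i
  (x - c) where c^2 = x^2 - 1. Since y^2 = x (x^2 - 1), c is y divided by a square root of x, and it
  is rational because n x is a square. The abscissa fixes the image only up to sign.\<close>

lemma square_in_phi:
  assumes P: "P \<in> G" "xc P \<noteq> 0" and t: "t \<in> gaussian_rats" "of_gint n * xc P = t^2"
  shows "P \<in> phi ` G"
proof -
  define x y where "x = xc P" and "y = yc P"
  have on: "y^2 = x^3 - x" unfolding x_def y_def by (rule coords_on_curve)
  obtain y' where y': "y' \<in> gaussian_rats" "y = s * y'" using P(1) unfolding G_def y_def by (blast elim: ratioE)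
  have x0: "x \<noteq> 0" "x \<in> gaussian_rats" using P by (simp_all add: x_def G_def)
  have n0: "of_gint n \<noteq> 0" using n_nonzero by simp
  have t0: "t \<noteq> 0" using t(2) x0 n0 by (auto simp: x_def)
  have xt: "x = t^2 / of_gint n" using t(2) n0 by (simp add: x_def field_simps)
  define c where "c = of_gint n * y' / t"
  have cK: "c \<in> gaussian_rats" unfolding c_def by (intro rats_closed y' t) simp
  have c2: "c^2 = x^2 - 1"
  proof -
    have "x * c^2 = x * (x^2 - 1)"
    proof -
      have "x * c^2 = of_gint n * y'^2" unfolding c_def xt using n0 t0
        by (simp add: power_divide power_mult_distrib) (simp add: power2_eq_square)
      also have "\<dots> = y^2" by (simp add: y' power_mult_distrib s2)
      finally show ?thesis unfolding on by (simp add: power2_eq_square power3_eq_cube algebra_simps)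
    qed
    thus ?thesis using x0 by simp
  qed
  define u v where "u = \<i> * (x + c)" and "v = s * ((1 + \<i>) * u * t / of_gint n)"
  have uK: "u \<in> gaussian_rats" unfolding u_def by (intro rats_closed x0 cK) simp
  have uu: "u^2 - 1 = 2 * \<i> * x * u"
  proof -
    have "\<i> * \<i> = (- 1 :: complex)" by simp
    thus ?thesis using c2 unfolding u_def by Groebner_Basis.algebra
  qed
  have "v^2 = of_gint n * (2 * \<i> * u^2 * t^2 / of_gint n^2)"
  proof -
    have "(1 + \<i>)^2 = 2 * \<i>" by (simp add: power2_eq_square algebra_simps)
    thus ?thesis unfolding v_def by (simp add: power_mult_distrib power_divide s2)
  qed
  also have "\<dots> = 2 * \<i> * u^2 * x" unfolding xt using n0 by (simp add: power2_eq_square)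
  also have "\<dots> = u * (u^2 - 1)" unfolding uu by (simp add: power2_eq_square)
  finally have uv: "v^2 = u^3 - u" by (simp add: power2_eq_square power3_eq_cube algebra_simps)
  have u0: "u \<noteq> 0" using uu by auto
  define R where "R = Pt u v"
  have R: "R \<noteq> 0" "xc R = u" using uv by (simp_all add: R_def Pt_neq_0)
  have "v / s \<in> gaussian_rats" unfolding v_def s_div_s by (intro rats_closed uK t) simp_all
  hence RG: "R \<in> G" using uK uv by (simp add: R_def G_Pt)
  have "xc (phi R) = (u^2 - 1) / (2 * \<i> * u)" "phi R \<noteq> 0" using xc_phi[of R] R u0 by simp_all
  hence "xc (phi R) = xc P" unfolding uu using u0 by (simp add: x_def)
  moreover have "P \<noteq> 0" using P(2) by auto
  ultimately have "P = phi R \<or> P = - phi R" using xc_eq_imp[of "phi R" P] \<open>phi R \<noteq> 0\<close> by simp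
  thus ?thesis using RG G_minus[OF RG] by (auto simp flip: phi_minus)
qed

lemma phi_xc_square:
  assumes "P \<in> G" "phi P \<noteq> 0"
  obtains t where "t \<in> gaussian_rats" "of_gint n * xc (phi P) = t^2"
proof -
  have P: "P \<noteq> 0" "xc P \<noteq> 0" using assms(2) phi_xc_0 by auto
  obtain y' where y': "y' \<in> gaussian_rats" "yc P = s * y'" using assms(1) unfolding G_def by (blast elim: ratioE)
  define t where "t = of_gint n * y' * (1 - \<i>) / (2 * xc P)"
  have "t \<in> gaussian_rats" unfolding t_def using assms(1) by (intro rats_closed y') (simp_all add: G_def)
  moreover have "t = s * (yc P * (1 - \<i>) / (2 * xc P))" by (simp add: t_def y' flip: s2(2))
  hence "t^2 = of_gint n * xc (phi P)" by (simp only: power_mult_distrib s2 xc_phi(3)[OF P])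
  ultimately show ?thesis using that by metis
qed

text \<open>The class attached to T is that of n, which is no square because p0 divides n exactly
  once.\<close>

lemma T_not_phi: "T \<notin> phi ` G"
proof
  assume "T \<in> phi ` G"
  then obtain P where P: "P \<in> G" "phi P = T" by auto
  then obtain t where t: "t \<in> gaussian_rats" "of_gint n = t^2" using phi_xc_square[of P] by auto
  then obtain w where w: "n = w^2" using gaussian_rat_square_integral[of t n] by metis
  have "p0 dvd w^2" using n_factors(1) w by (metis dvd_triv_left)
  hence "p0 dvd w" using prime_elem_dvd_power[OF prime_elems(1)] by blast
  then obtain v where "w = p0 * v" by (elim dvdE)
  hence "p0 * (p1 * p2 * p3) = p0 * (p0 * v^2)" using w n_factors(1) by (simp add: power2_eq_square mult_ac)
  hence "p1 * p2 * p3 = p0 * v^2" using prime_elems(1) by (simp add: prime_elem_def)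
  thus False using not_dvd_cofactor(1) by (metis dvd_triv_left)
qed

end


section \<open>Multiplication by integers and Gaussian integers\<close>

primrec nmul :: "nat \<Rightarrow> 'a :: ab_group_add \<Rightarrow> 'a" where
  "nmul 0 P = 0"
| "nmul (Suc n) P = P + nmul n P"

lemma nmul_add: "nmul (a + b) P = nmul a P + nmul b P"
  by (induction a) (simp_all add: add.assoc)

lemma nmul_distrib: "nmul a (P + R) = nmul a P + nmul a R"
  by (induction a) simp_all

lemma nmul_minus: "nmul a (- P) = - nmul a P"
  by (induction a) simp_all

lemma nmul_mult: "nmul (a * b) P = nmul a (nmul b P)"
  by (induction a) (simp_all add: nmul_add)

definition zmul :: "int \<Rightarrow> 'a :: ab_group_add \<Rightarrow> 'a" where
  "zmul k P = nmul (nat k) P - nmul (nat (- k)) P"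

lemma zmul_diff: "zmul (int a - int b) P = nmul a P - nmul b P"
proof (cases "b \<le> a")
  case True
  then obtain c where "a = b + c" by (rule le_Suc_ex[THEN exE])
  thus ?thesis by (simp add: zmul_def nmul_add)
next
  case False
  then obtain c where "b = a + c" using le_Suc_ex[of a b] by auto
  thus ?thesis by (simp add: zmul_def nmul_add)
qed

lemma int_diff_nat: obtains a b where "k = int a - int b"
  by (rule that[of "nat k" "nat (- k)"]) simp

lemma zmul_add: "zmul (k + l) P = zmul k P + zmul l P"
proof -
  obtain a b c d where k: "k = int a - int b" "l = int c - int d" by (metis int_diff_nat)
  have "k + l = int (a + c) - int (b + d)" using k by simp
  hence "zmul (k + l) P = nmul (a + c) P - nmul (b + d) P" by (simp only: zmul_diff)
  thus ?thesis by (simp add: k zmul_diff nmul_add)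
qed

lemma zmul_distrib: "zmul k (P + R) = zmul k P + zmul k R"
  by (simp add: zmul_def nmul_distrib)

lemma zmul_minus: "zmul k (- P) = - zmul k P"
  by (simp add: zmul_def nmul_minus)

lemma zmul_mult: "zmul (k * l) P = zmul k (zmul l P)"
proof -
  obtain a b c d where k: "k = int a - int b" "l = int c - int d" by (metis int_diff_nat)
  have "k * l = int (a * c + b * d) - int (a * d + b * c)" unfolding k by (simp add: algebra_simps)
  hence "zmul (k * l) P = nmul (a * c + b * d) P - nmul (a * d + b * c) P" by (simp only: zmul_diff)
  also have "\<dots> = nmul a (nmul c P + - nmul d P) - nmul b (nmul c P + - nmul d P)"
    unfolding nmul_add nmul_mult nmul_distrib nmul_minus by simp
  finally show ?thesis by (simp add: k zmul_diff)
qed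

lemma zmul_simps [simp]: "zmul 0 P = 0" "zmul 1 P = P" "zmul (- 1) P = - P"
  by (simp_all add: zmul_def)

definition gmul :: "gint \<Rightarrow> pt \<Rightarrow> pt" where
  "gmul z P = zmul (gre z) P + zmul (gim z) (imul P)"

lemma imul_nmul: "imul (nmul a P) = nmul a (imul P)"
  by (induction a) (simp_all add: imul_add)

lemma imul_diff: "imul (P - R) = imul P - imul R"
  using imul_add[of P "- R"] by (simp add: imul_minus)

lemma imul_zmul: "imul (zmul k P) = zmul k (imul P)"
  by (simp add: zmul_def imul_diff imul_nmul)

lemma gmul_add: "gmul (z + w) P = gmul z P + gmul w P"
  by (simp add: gmul_def zmul_add)

lemma gmul_distrib: "gmul z (P + R) = gmul z P + gmul z R"
  by (simp add: gmul_def zmul_distrib imul_add)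

lemma zmul_uminus_left: "zmul (- k) P = - zmul k P"
  by (simp add: zmul_def)

lemma gmul_mult: "gmul (z * w) P = gmul z (gmul w P)"
proof -
  have "gmul z (gmul w P) = zmul (gre z) (zmul (gre w) P) + zmul (gre z) (zmul (gim w) (imul P))
      + (zmul (gim z) (zmul (gre w) (imul P)) + - zmul (gim z) (zmul (gim w) P))"
    by (simp only: gmul_def zmul_distrib imul_add imul_zmul imul_imul zmul_minus)
  also have "\<dots> = gmul (z * w) P"
    unfolding gmul_def gint_sel diff_conv_add_uminus[of "gre z * gre w"] zmul_add zmul_uminus_left zmul_mult by simp
  finally show ?thesis ..
qed

lemma gmul_one [simp]: "gmul 1 P = P" and gmul_zero_left [simp]: "gmul 0 P = 0"
  and gmul_gi: "gmul gi P = imul P" and gmul_minus_one: "gmul (- 1) P = - P"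
  by (simp_all add: gmul_def)

lemma gmul_zero [simp]: "gmul z 0 = 0"
  using gmul_distrib[of z 0 0] by simp

lemma gmul_minus: "gmul z (- P) = - gmul z P"
  using gmul_distrib[of z P "- P"] by (simp add: eq_neg_iff_add_eq_0 add.commute)

lemma gmul_minus_left: "gmul (- z) P = - gmul z P"
  using gmul_add[of z "- z" P] by (simp add: eq_neg_iff_add_eq_0 add.commute)

lemma gmul_diff: "gmul z (P - R) = gmul z P - gmul z R"
  using gmul_distrib[of z P "- R"] by (simp add: gmul_minus)

lemma gmul_diff_left: "gmul (z - w) P = gmul z P - gmul w P"
  using gmul_add[of z "- w" P] by (simp add: gmul_minus_left)

lemma gmul_phi: "gmul (1 + gi) P = phi P"
  by (simp add: gmul_add gmul_gi phi_def)

lemma gmul_2: "gmul 2 P = P + P"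
  using gmul_add[of 1 1 P] by simp

lemma gmul_commute: "gmul z (gmul w P) = gmul w (gmul z P)"
  by (simp add: mult.commute flip: gmul_mult)

lemma gmul_int: "gmul (of_int k) P = zmul k P"
  by (simp add: gmul_def)

text \<open>The parity of \<open>gre z + gim z\<close> is the class of \<open>z\<close> modulo \<open>1 + \<i>\<close>.\<close>

definition godd :: "gint \<Rightarrow> bool" where "godd z \<longleftrightarrow> odd (gre z + gim z)"

lemma godd_simps [simp]: "godd (z * w) \<longleftrightarrow> godd z \<and> godd w" "godd (z + w) \<longleftrightarrow> godd z \<noteq> godd w"
  "godd (z - w) \<longleftrightarrow> godd z \<noteq> godd w" "godd (- z) \<longleftrightarrow> godd z" "godd gi" "\<not> godd 2" "\<not> godd 0"
  by (auto simp: godd_def)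

lemma godd_power2 [simp]: "godd (z^2) \<longleftrightarrow> godd z"
  by (simp add: power2_eq_square)

lemma not_godd_dvd: "\<not> godd z \<Longrightarrow> 1 + gi dvd z"
proof -
  assume "\<not> godd z"
  hence "even (gre z + gim z)" by (simp add: godd_def)
  then obtain c where "gre z + gim z = 2 * c" by (rule evenE)
  hence "z = (1 + gi) * GInt c (c - gre z)" by (simp add: gint_eq_iff)
  thus ?thesis by (rule dvdI)
qed

text \<open>Modulo 2 the classes prime to 1 + i are those of 1 and i, so the quotient of two odd
  elements is one of these.\<close>

lemma godd_cases:
  assumes "godd p" "godd q"
  obtains w where "p = q + 2 * w" | w where "p = gi * q + 2 * w"
proof (cases "even (gre p - gre q)")
  case True
  moreover have "even (gim p - gim q)" using True assms by (auto simp: godd_def)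
  ultimately obtain a b where "gre p - gre q = 2 * a" "gim p - gim q = 2 * b" by (elim evenE) blast
  hence "p = q + 2 * GInt a b" by (simp add: gint_eq_iff)
  thus ?thesis by (rule that(1))
next
  case False
  have "even (gre p + gim q)" using False assms by (auto simp: godd_def)
  moreover have "even (gim p - gre q)" using False assms by (auto simp: godd_def)
  ultimately obtain a b where "gre p + gim q = 2 * a" "gim p - gre q = 2 * b" by (elim evenE) blast
  hence "p = gi * q + 2 * GInt a b" by (simp add: gint_eq_iff)
  thus ?thesis by (rule that(2))
qed

section \<open>Denominators at the prime 1 + i\<close>

text \<open>The fraction may be unreduced, so the formula for \<open>phi\<close> on p and q can be
  iterated without cancelling.\<close>

definition frac_form :: "gint \<Rightarrow> gint \<Rightarrow> pt \<Rightarrow> bool" where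
  "frac_form p q P \<longleftrightarrow> P \<noteq> 0 \<and> q \<noteq> 0 \<and> xc P = of_gint p / of_gint q"

lemma frac_form_phi:
  assumes "frac_form p q P" "phi P \<noteq> 0"
  shows "frac_form (p^2 - q^2) (2 * gi * p * q) (phi P)"
proof -
  have x: "xc P \<noteq> 0" using assms(2) phi_xc_0 by auto
  have P: "P \<noteq> 0" "q \<noteq> 0" "xc P = of_gint p / of_gint q" using assms(1) by (simp_all add: frac_form_def)
  have p: "p \<noteq> 0" using x P by auto
  have "xc (phi P) = ((of_gint p / of_gint q)^2 - 1) / (2 * \<i> * (of_gint p / of_gint q))"
    using xc_phi(2)[OF P(1) x] P(3) by simp
  also have "\<dots> = of_gint (p^2 - q^2) / of_gint (2 * gi * p * q)"
    using P(2) p by (simp add: field_simps power2_eq_square)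
  finally show ?thesis using assms(2) P(2) p by (simp add: frac_form_def gint_eq_iff[of gi] gint_eq_iff[of 2])
qed

lemma frac_form_cong:
  assumes "frac_form p q P" "p = c * p'" "q = c * q'"
  shows "frac_form p' q' P"
  using assms by (auto simp: frac_form_def)

text \<open>A neighbourhood of 0 in the (1 + i)-adic topology, in the manner of the filtration of
  the formal group at infinity.\<close>

definition deep :: "nat \<Rightarrow> pt \<Rightarrow> bool" where
  "deep m P \<longleftrightarrow> P = 0 \<or> (\<exists>p q. frac_form p q P \<and> godd p \<and> 2 ^ m dvd q)"

lemma deep_zero [simp]: "deep m 0"
  by (simp add: deep_def)

text \<open>With p odd and q even, \<open>p^2 - q^2\<close> stays odd while the new denominator
  \<open>2 * gi * p * q\<close> gains a factor 2.\<close>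

lemma deep_phi:
  assumes "deep (Suc m) P"
  shows "deep (Suc (Suc m)) (phi P)"
proof (cases "P = 0 \<or> phi P = 0")
  case True
  thus ?thesis by auto
next
  case False
  then obtain p q where pq: "frac_form p q P" "godd p" "2 ^ Suc m dvd q" using assms by (auto simp: deep_def)
  have f: "frac_form (p^2 - q^2) (2 * gi * p * q) (phi P)" using frac_form_phi[OF pq(1)] False by simp
  obtain r where r: "q = 2 ^ Suc m * r" using pq(3) by (elim dvdE)
  have "\<not> godd q" unfolding r by simp
  hence "godd (p^2 - q^2)" using pq(2) by simp
  moreover have "2 * gi * p * q = 2 ^ Suc (Suc m) * (gi * p * r)" unfolding r by (simp add: mult_ac)
  hence "2 ^ Suc (Suc m) dvd 2 * gi * p * q" by (rule dvdI)
  ultimately show ?thesis using f unfolding deep_def by blast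
qed

lemma deep_phi_mixed:
  assumes "frac_form p q P" "godd p \<noteq> godd q"
  shows "deep 1 (phi P)"
proof (cases "phi P = 0")
  case False
  have "godd (p^2 - q^2)" using assms(2) by simp
  moreover have "2 ^ 1 dvd 2 * gi * p * q" by (simp add: mult.assoc)
  ultimately show ?thesis using frac_form_phi[OF assms(1) False] unfolding deep_def by blast
qed simp

lemma deep_phi_congruent:
  assumes "frac_form p q P" "godd p" "godd q" "p = q + 2 * w"
  shows "deep 1 (phi (phi P))"
proof (cases "phi P = 0")
  case False
  have "frac_form (p^2 - q^2) (2 * gi * p * q) (phi P)" by (rule frac_form_phi[OF assms(1) False])
  hence "frac_form (2 * (w * (w + q))) (gi * p * q) (phi P)"
    by (rule frac_form_cong[where c = 2]) (unfold assms(4), Groebner_Basis.algebra+)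
  thus ?thesis using assms(2,3) by (intro deep_phi_mixed) auto
qed simp

text \<open>In lowest terms p and q are not both even. One application suffices if their parities
  differ and two if p is q modulo 2. If p is i q modulo 2, the first application leads to the
  previous case.\<close>

lemma deep_phi3:
  assumes "xc P \<in> gaussian_rats"
  shows "deep 1 (phi (phi (phi P)))"
proof (cases "P = 0 \<or> phi P = 0")
  case True
  thus ?thesis by auto
next
  case False
  have up: "deep 1 (phi R)" if "deep 1 R" for R
  proof -
    have "deep (Suc 1) (phi R)" using deep_phi[of 0 R] that by simp
    moreover have "2 ^ 1 dvd q" if "2 ^ Suc (Suc 0) dvd q" for q :: gint
      using that by (rule dvd_trans[rotated]) (simp only: le_imp_power_dvd)
    ultimately show ?thesis unfolding deep_def by auto
  qed
  obtain p q where pq: "q \<noteq> 0" "coprime p q" "xc P = of_gint p / of_gint q" using assms by (rule gaussian_ratsE)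
  have f: "frac_form p q P" using False pq by (simp add: frac_form_def)
  have "godd p \<or> godd q"
  proof (rule ccontr)
    assume "\<not> (godd p \<or> godd q)"
    hence "1 + gi dvd p" "1 + gi dvd q" by (simp_all add: not_godd_dvd)
    hence "is_unit (1 + gi)" using coprime_common_divisor[OF pq(2)] by blast
    thus False by (simp add: gint_unit_iff gint_eq_iff)
  qed
  then consider "godd p \<noteq> godd q" | "godd p" "godd q" by blast
  thus ?thesis
  proof cases
    case 1
    thus ?thesis using up deep_phi_mixed[OF f] by blast
  next
    case 2
    show ?thesis
    proof (rule godd_cases[OF 2])
      fix w assume "p = q + 2 * w"
      thus ?thesis using up deep_phi_congruent[OF f 2] by blast
    next
      fix w assume w: "p = gi * q + 2 * w"
      have "frac_form (p^2 - q^2) (2 * gi * p * q) (phi P)" using frac_form_phi[OF f] False by blast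
      hence "frac_form (2 * (gi * q * w + w^2) - q^2) (gi * p * q) (phi P)"
        by (rule frac_form_cong[where c = 2]) (use gi_mult_gi in \<open>unfold w, Groebner_Basis.algebra, simp add: mult_ac\<close>)
      moreover have "2 * (gi * q * w + w^2) - q^2 = gi * p * q + 2 * w^2"
        using gi_mult_gi unfolding w by Groebner_Basis.algebra
      moreover have "godd (2 * (gi * q * w + w^2) - q^2)" "godd (gi * p * q)" using 2 by simp_all
      ultimately show ?thesis using deep_phi_congruent by blast
    qed
  qed
qed

text \<open>A nonzero point has an abscissa with a fixed reduced denominator q, and every power of 2
  would divide q; the norm of q bounds the exponent.\<close>

lemma deep_all_zero:
  assumes "xc P \<in> gaussian_rats" "\<And>m. deep (Suc m) P"
  shows "P = 0"
proof (rule ccontr)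
  assume P: "P \<noteq> 0"
  obtain p q where pq: "q \<noteq> 0" "coprime p q" "xc P = of_gint p / of_gint q" using assms(1) by (rule gaussian_ratsE)
  have le: "4 ^ Suc m \<le> gnorm q" for m
  proof -
    obtain p' q' where f: "frac_form p' q' P" "godd p'" "2 ^ Suc m dvd q'" using assms(2)[of m] P by (auto simp: deep_def)
    have "of_gint (p * q') = of_gint (p' * q)" using f(1) pq by (simp add: frac_form_def field_simps)
    hence e: "p * q' = p' * q" by (simp only: of_gint_eq_iff)
    have "2 ^ Suc m dvd p' * q" unfolding e[symmetric] using f(3) by simp
    moreover have "coprime 2 p'"
    proof -
      have "odd (gnorm p')" using f(2) by (simp add: godd_def gnorm_def)
      then obtain j where "gnorm p' = 2 * j + 1" by (rule oddE)
      hence 1: "1 = p' * gcnj p' - 2 * of_int j" unfolding mult_gcnj by simp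
      show ?thesis
      proof (rule coprimeI)
        fix c assume "c dvd 2" "c dvd p'"
        thus "is_unit c" by (subst 1) (intro dvd_diff dvd_mult2)
      qed
    qed
    hence "coprime (2 ^ Suc m) p'" by simp
    ultimately have "2 ^ Suc m dvd q" by (simp only: coprime_dvd_mult_right_iff)
    hence "gnorm (2 ^ Suc m) dvd gnorm q" by (rule gint_dvd_gnorm)
    moreover have "gnorm q > 0" using pq(1) by (rule gnorm_pos_iff[THEN iffD2])
    moreover have "gnorm (2 ^ Suc m) = 4 ^ Suc m" by (simp only: gnorm_power gnorm_simps) simp
    ultimately show ?thesis using zdvd_imp_le by metis
  qed
  have "int m < 4 ^ Suc m" for m
  proof (induction m)
    case (Suc m)
    have "(4::int) ^ Suc (Suc m) = 4 * 4 ^ Suc m" by simp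
    thus ?case using Suc by linarith
  qed simp
  from this[of "nat (gnorm q)"] le[of "nat (gnorm q)"] show False by simp
qed

section \<open>Cosets of the image of 1 + i\<close>

context four_primes
begin

text \<open>Negation keeps the abscissa, and modulo squares dividing is multiplying, so a difference
  has the product class. A difference equal to 0 or to (0, 0) has no class, but both are images
  under \<open>phi\<close>, the latter of T.\<close>

lemma class_diff:
  assumes P: "P \<in> G" "xc P \<noteq> 0" "t \<in> gaussian_rats" "of_gint n * xc P = of_gint d * t^2"
    and R: "R \<in> G" "xc R \<noteq> 0" "u \<in> gaussian_rats" "of_gint n * xc R = of_gint e * u^2"
  shows "P - R \<in> phi ` G \<or>
    (xc (P - R) \<noteq> 0 \<and> (\<exists>v\<in>gaussian_rats. of_gint n * xc (P - R) = of_gint (d * e) * v^2))"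
proof -
  have n0: "of_gint n \<noteq> 0" using n_nonzero by simp
  have nz: "d \<noteq> 0" "e \<noteq> 0" "t \<noteq> 0" "u \<noteq> 0" using P R n0 by auto
  have "P \<noteq> 0" "R \<noteq> 0" using P R by auto
  obtain x1 y1 where 1: "y1^2 = x1^3 - x1" "P = Pt x1 y1" using \<open>P \<noteq> 0\<close> by (rule nonzero_ptE)
  obtain x2 y2 where 2: "y2^2 = x2^3 - x2" "R = Pt x2 y2" using \<open>R \<noteq> 0\<close> by (rule nonzero_ptE)
  have R': "(- y2)^2 = x2^3 - x2" "- R = Pt x2 (- y2)" using 2 by (simp_all add: minus_Pt)
  show ?thesis
  proof (cases "x1 = x2 \<and> y1 + - y2 = 0")
    case True
    hence "P - R = phi 0" using 1 2 by simp
    thus ?thesis using G_zero by blast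
  next
    case False
    have "Pt x1 y1 \<in> G" "Pt x2 (- y2) \<in> G" using P(1) 1 G_minus[OF R(1)] R' by simp_all
    from G_add_chord[OF 1(1) this(1) R'(1) this(2) False]
    obtain m x3 y3 where 3: "m \<in> gaussian_rats" "x1 * x2 * x3 = of_gint n * m^2" "y3^2 = x3^3 - x3"
      "Pt x1 y1 + Pt x2 (- y2) = Pt x3 y3" by metis
    have "P - R = P + - R" by simp
    also have "\<dots> = Pt x1 y1 + Pt x2 (- y2)" by (simp only: 1(2) R'(2))
    finally have PR: "P - R = Pt x3 y3" by (simp only: 3(4))
    show ?thesis
    proof (cases "x3 = 0")
      case True
      hence "y3 = 0" using 3(3) by simp
      hence "P - R = phi T" using True PR phi_T by simp
      thus ?thesis using T_G by blast
    next
      case False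
      define v where "v = of_gint n ^ 2 * m / (of_gint (d * e) * t * u)"
      have "v \<in> gaussian_rats" unfolding v_def by (intro rats_closed 3(1) P R of_gint_rat)
      moreover have "of_gint n * x3 = of_gint (d * e) * v^2"
      proof -
        have "(of_gint n * x1) * (of_gint n * x2) * (of_gint n * x3) = of_gint n ^ 4 * m^2"
          using 3(2) by (simp add: power4_eq_xxxx mult_ac)
        hence "(of_gint d * t^2) * (of_gint e * u^2) * (of_gint n * x3) = of_gint n ^ 4 * m^2"
          using P(4) R(4) 1 2 by simp
        hence "of_gint n * x3 = of_gint n ^ 4 * m^2 / (of_gint d * t^2 * (of_gint e * u^2))"
          using nz by (simp add: field_simps)
        also have "\<dots> = of_gint (d * e) * v^2"
          unfolding v_def using nz by (simp add: power_divide power_mult_distrib power2_eq_square power4_eq_xxxx mult_ac)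
        finally show ?thesis .
      qed
      ultimately show ?thesis using PR False 3(3) by auto
    qed
  qed
qed

lemma same_class_phi:
  assumes P: "P \<in> G" "xc P \<noteq> 0" "t \<in> gaussian_rats" "of_gint n * xc P = of_gint d * t^2"
    and R: "R \<in> G" "xc R \<noteq> 0" "u \<in> gaussian_rats" "of_gint n * xc R = of_gint e * u^2"
    and de: "d * e = c^2"
  shows "P - R \<in> phi ` G"
  using class_diff[OF P R]
proof (elim disjE conjE bexE)
  fix v assume *: "xc (P - R) \<noteq> 0" "v \<in> gaussian_rats" "of_gint n * xc (P - R) = of_gint (d * e) * v^2"
  have "of_gint c * v \<in> gaussian_rats" using *(2) by (intro rats_closed) simp_all
  moreover have "of_gint n * xc (P - R) = (of_gint c * v)^2" using *(3) by (simp only: de of_gint_power power_mult_distrib)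
  ultimately show ?thesis using square_in_phi[OF G_diff[OF P(1) R(1)] *(1)] by blast
qed

text \<open>The classes 1, n, i p1 p3 and i p0 p2 are those of 0, T, Q and T + Q; for the last one,
  n times i p1 p3 is i p0 p2 up to a square. The points with abscissa 0 are treated apart.\<close>

lemma coset_representatives:
  assumes P: "P \<in> G"
  shows "\<exists>c\<in>{0, T, Q, T + Q}. P - c \<in> phi ` G"
proof (cases "xc P = 0")
  case True
  have "P = 0 \<or> P = phi T"
  proof (cases "P = 0")
    case False
    have "yc P = 0" using coords_on_curve[of P] True by simp
    thus ?thesis using Pt_coords[OF False] True phi_T by simp
  qed simp
  hence "P - 0 \<in> phi ` G" using G_zero T_G phi_zero by (metis diff_zero imageI)
  thus ?thesis by blast
next
  case False
  obtain y' where y': "y' \<in> gaussian_rats" "yc P = s * y'" using P unfolding G_def by (blast elim: ratioE)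
  have n0: "of_gint n \<noteq> 0" using n_nonzero by simp
  have x: "of_gint n * xc P \<in> gaussian_rats" using P by (intro rats_closed) (simp_all add: G_def)
  have y: "of_gint n ^ 2 * y' \<in> gaussian_rats" using y' by (intro rats_closed) simp_all
  have "(of_gint n ^ 2 * y')^2 = of_gint n ^ 3 * yc P ^ 2"
    unfolding y'(2) by (simp add: power_mult_distrib s2 power2_eq_square power3_eq_cube)
  also have "\<dots> = (of_gint n * xc P)^3 - of_gint n ^ 2 * (of_gint n * xc P)"
    unfolding coords_on_curve by (simp add: power2_eq_square power3_eq_cube algebra_simps)
  finally obtain d t where d: "d \<in> {1, n, gi * (p1 * p3), gi * (p0 * p2)}"
    and t: "t \<in> gaussian_rats" "of_gint n * xc P = of_gint d * t^2"
    using abscissa_class[OF x _ y] False n0 by (metis mult_eq_0_iff)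
  have T: "T \<in> G" "xc T \<noteq> 0" "1 \<in> gaussian_rats" "of_gint n * xc T = of_gint n * 1^2"
    using T_G by simp_all
  have p: "of_gint p0 \<noteq> 0" "of_gint p2 \<noteq> 0" using prime_elems by (simp_all add: prime_elem_def)
  have Q: "Q \<in> G" "xc Q \<noteq> 0" "of_gint p0 \<in> gaussian_rats" "of_gint n * xc Q = of_gint (gi * (p1 * p3)) * of_gint p0 ^ 2"
    using Q_G p by (simp_all add: Q_coords(1) n_def field_simps power2_eq_square)
  have gi2: "(gi * z) * (gi * z) = (gi * z)^2" for z by (simp only: power2_eq_square)
  from d consider "d = 1" | "d = n" | "d = gi * (p1 * p3)" | "d = gi * (p0 * p2)" by blast
  thus ?thesis
  proof cases
    case 1
    hence "P \<in> phi ` G" using square_in_phi[OF P False t(1)] t(2) by simp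
    thus ?thesis by simp
  next
    case 2
    have "P - T \<in> phi ` G"
      by (rule same_class_phi[OF P False t T, where c = n]) (simp add: 2 power2_eq_square)
    thus ?thesis by blast
  next
    case 3
    have "P - Q \<in> phi ` G"
      by (rule same_class_phi[OF P False t Q, where c = "gi * (p1 * p3)"]) (simp only: 3 power2_eq_square)
    thus ?thesis by blast
  next
    case 4
    from class_diff[OF P False t T] show ?thesis
    proof (elim disjE conjE bexE)
      assume "P - T \<in> phi ` G"
      thus ?thesis by blast
    next
      fix v assume v: "xc (P - T) \<noteq> 0" "v \<in> gaussian_rats" "of_gint n * xc (P - T) = of_gint (d * n) * v^2"
      have "P - T - Q \<in> phi ` G"
        by (rule same_class_phi[OF G_diff[OF P T(1)] v Q, where c = "gi * n"])
          (simp only: 4 n_def power2_eq_square mult_ac)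
      thus ?thesis by (simp add: diff_diff_eq)
    qed
  qed
qed

section \<open>Torsion\<close>

lemma G_gmul: "P \<in> G \<Longrightarrow> gmul z P \<in> G"
proof -
  assume P: "P \<in> G"
  have nm: "nmul a R \<in> G" if "R \<in> G" for a R by (induction a) (simp_all add: G_zero G_add that)
  have "zmul k R \<in> G" if "R \<in> G" for k R unfolding zmul_def by (intro G_diff nm that)
  thus ?thesis unfolding gmul_def using P by (simp add: G_add G_imul)
qed

text \<open>On the points killed by an odd m, \<open>phi\<close> is surjective. A point of this kind
  is thus an image under every power of \<open>phi\<close>, hence arbitrarily deep, hence 0.\<close>

lemma odd_torsion:
  assumes "P \<in> G" "gmul (of_int m) P = 0" "odd m"
  shows "P = 0"
proof -
  obtain l where l: "m = 2 * l + 1" using assms(3) by (rule oddE)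
  define M where "M = {P \<in> G. gmul (of_int m) P = 0}"
  have step: "\<exists>R\<in>M. A = phi R" if "A \<in> M" for A
  proof -
    \<comment> \<open>With m = 2l + 1, the identity (1 + i)^2 i l = -2l = 1 - m gives phi R = A - m
      A = A.\<close>
    define R where "R = gmul ((1 + gi) * (gi * of_int l)) A"
    have "gmul (of_int m) R = gmul ((1 + gi) * (gi * of_int l)) (gmul (of_int m) A)"
      unfolding R_def by (rule gmul_commute)
    hence "R \<in> M" using that by (simp add: M_def R_def G_gmul)
    moreover have "A = phi R"
    proof -
      have "phi R = gmul ((1 + gi) * ((1 + gi) * (gi * of_int l))) A" by (simp only: R_def gmul_phi[symmetric] gmul_mult)
      also have "(1 + gi) * ((1 + gi) * (gi * of_int l)) = 1 - of_int m" by (simp add: l gint_eq_iff)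
      also have "gmul (1 - of_int m) A = A" using that by (simp add: gmul_diff_left M_def)
      finally show ?thesis ..
    qed
    ultimately show ?thesis by blast
  qed
  have deep: "deep (Suc j) A" if "A \<in> M" for j A
    using that
  proof (induction j arbitrary: A)
    case 0
    then obtain A1 A2 A3 where A: "A1 \<in> M" "A = phi A1" "A2 \<in> M" "A1 = phi A2" "A3 \<in> M" "A2 = phi A3"
      using step by metis
    thus ?case using deep_phi3[of A3] by (simp add: M_def G_def)
  next
    case (Suc j)
    then obtain R where "R \<in> M" "A = phi R" using step by blast
    thus ?case using deep_phi[OF Suc.IH] by simp
  qed
  have "P \<in> M" using assms by (simp add: M_def)
  thus ?thesis using deep_all_zero[of P] deep assms(1) by (simp add: G_def)
qed

lemma two_torsion_cases:
  assumes "P + P = 0"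
  shows "P \<in> {0, T, imul T, T + imul T}"
proof (cases "P = 0")
  case False
  have "P = - P" using assms by (simp add: eq_neg_iff_add_eq_0)
  hence "yc P = - yc P" by (metis yc_minus)
  hence y: "yc P = 0" by simp
  hence "xc P * (xc P - 1) * (xc P + 1) = 0"
    using coords_on_curve[of P] by (simp add: power3_eq_cube algebra_simps)
  hence "xc P = 0 \<or> xc P = 1 \<or> xc P = - 1" by (auto simp: add_eq_0_iff2)
  moreover have "P = Pt (xc P) 0" using Pt_coords[OF False] y by simp
  moreover have "imul T = Pt (- 1) 0" "T = Pt 1 0" "T + imul T = Pt 0 0"
    using phi_T by (simp_all add: T_def imul_Pt phi_def)
  ultimately show ?thesis by auto
qed simp

lemma T_two_torsion: "T + T = 0"
  using Pt_add_opposite[of 0 1] by (simp add: T_def)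

text \<open>Among the four points killed by 2, neither T nor iT lies in the image of
  \<open>phi\<close>. So \<open>phi P\<close> is 0 or \<open>phi T\<close> = (0, 0), a second
  application yields 0, and the square of \<open>phi\<close> is doubling up to a unit.\<close>

lemma phi_two_torsion:
  assumes "P \<in> G" "phi P + phi P = 0"
  shows "P + P = 0"
proof -
  have "imul T \<notin> phi ` G"
  proof
    assume "imul T \<in> phi ` G"
    then obtain R where R: "R \<in> G" "imul T = phi R" by auto
    hence "- T = phi (imul R)" by (simp add: phi_imul flip: imul_imul)
    hence "T = phi (- imul R)" by (simp add: phi_minus) (metis minus_minus)
    moreover have "- imul R \<in> G" using R(1) by (simp add: G_minus G_imul)
    ultimately show False using T_not_phi by blast
  qed
  hence "phi P \<in> {0, phi T}"
    using two_torsion_cases[OF assms(2)] T_not_phi imageI[OF assms(1), of phi] phi_def[of T] by auto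
  hence "phi (phi P) = 0" using phi_xc_0[of "phi T"] phi_T by auto
  hence "imul (P + P) = 0" by (simp add: phi_phi imul_add)
  hence "imul (imul (P + P)) = 0" by simp
  hence "- (P + P) = 0" by (simp only: imul_imul)
  thus ?thesis by (simp only: neg_equal_0_iff_equal)
qed

lemma gmul_2_phi: "gmul 2 P = phi (phi (- imul P))"
  by (simp add: phi_phi imul_minus imul_imul gmul_2)

text \<open>Multiplying by the conjugate replaces z by its norm. Even factors are removed by
  induction: doubling is two applications of \<open>phi\<close>, and \<open>phi_two_torsion\<close>
  undoes each of them.\<close>

lemma torsion:
  assumes P: "P \<in> G" and z: "z \<noteq> 0" "gmul z P = 0"
  shows "P + P = 0"
proof -
  have main: "P + P = 0" if "P \<in> G" "N > 0" "gmul (of_int (int N)) P = 0" for N P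
    using that
  proof (induction N arbitrary: P rule: less_induct)
    case (less N)
    show ?case
    proof (cases "odd N")
      case True
      thus ?thesis using odd_torsion[of P "int N"] less.prems by simp
    next
      case False
      hence "even N" by simp
      then obtain N' where N': "N = 2 * N'" by (rule evenE)
      have e: "of_int (int N) = of_int (int N') * (2 :: gint)" by (simp add: N')
      have "gmul (of_int (int N')) (gmul 2 P) = 0" using less.prems(3) unfolding e gmul_mult .
      moreover have "N' < N" "N' > 0" using N' less.prems(2) by simp_all
      moreover have "gmul 2 P \<in> G" by (rule G_gmul[OF less.prems(1)])
      ultimately have "gmul 2 P + gmul 2 P = 0" using less.IH[of N' "gmul 2 P"] by simp
      hence *: "phi (phi (- imul P)) + phi (phi (- imul P)) = 0" by (simp only: gmul_2_phi)
      have R: "- imul P \<in> G" by (rule G_minus[OF G_imul[OF less.prems(1)]])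
      have "(- imul P) + (- imul P) = 0"
        by (rule phi_two_torsion[OF R phi_two_torsion[OF G_phi[OF R] *]])
      hence "imul (- imul P + - imul P) = imul 0" by (rule arg_cong)
      thus ?thesis by (simp only: imul_add imul_minus imul_imul minus_minus imul_zero)
    qed
  qed
  have "gmul (of_int (gnorm z)) P = gmul (gcnj z) (gmul z P)"
    by (simp only: mult_gcnj[symmetric] mult.commute[of z] gmul_mult)
  hence "gmul (of_int (int (nat (gnorm z)))) P = 0" using z(2) by simp
  moreover have "gnorm z > 0" using z(1) by (rule gnorm_pos_iff[THEN iffD2])
  ultimately show ?thesis using main[OF P, of "nat (gnorm z)"] by simp
qed

end


section \<open>Heights\<close>

lemma gnorm_add_le: "gnorm (z + w) \<le> 2 * (gnorm z + gnorm w)"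
proof -
  have "2 * (gnorm z + gnorm w) - gnorm (z + w) = gnorm (z - w)"
    by (simp add: gnorm_def power2_eq_square algebra_simps)
  thus ?thesis using gnorm_nonneg[of "z - w"] by linarith
qed

lemma gnorm_diff_le: "gnorm (z - w) \<le> 2 * (gnorm z + gnorm w)"
  using gnorm_add_le[of z "- w"] by simp

lemma gnorm_add_le':
  assumes "gnorm z \<le> B" "gnorm w \<le> B"
  shows "gnorm (z + w) \<le> 4 * B" "gnorm (z - w) \<le> 4 * B"
proof -
  have "2 * (gnorm z + gnorm w) \<le> 2 * (B + B)" using assms by (intro mult_left_mono add_mono) simp_all
  hence "2 * (gnorm z + gnorm w) \<le> 4 * B" by simp
  thus "gnorm (z + w) \<le> 4 * B" "gnorm (z - w) \<le> 4 * B"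
    using gnorm_add_le[of z w] gnorm_diff_le[of z w] by (blast intro: order_trans)+
qed

lemma gnorm_square_diff: "(gnorm p - gnorm q)^2 \<le> gnorm (p^2 - q^2)"
proof -
  have "gnorm (p^2 - q^2) = (gnorm p - gnorm q)^2 + (2 * (gre p * gim q - gim p * gre q))^2"
    by (simp add: gnorm_def power2_eq_square algebra_simps)
  thus ?thesis by simp
qed

text \<open>The naive multiplicative height of the abscissa. Taking the least value over all
  representations lets any fraction, reduced or not, serve as an upper bound.\<close>

definition height :: "pt \<Rightarrow> nat" where
  "height P = (LEAST h. \<exists>p q. q \<noteq> 0 \<and> xc P = of_gint p / of_gint q \<and> h = nat (max (gnorm p) (gnorm q)))"

lemma height_le: "q \<noteq> 0 \<Longrightarrow> xc P = of_gint p / of_gint q \<Longrightarrow> int (height P) \<le> max (gnorm p) (gnorm q)"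
proof -
  assume "q \<noteq> 0" "xc P = of_gint p / of_gint q"
  hence "height P \<le> nat (max (gnorm p) (gnorm q))" unfolding height_def by (intro Least_le) blast
  moreover have "max (gnorm p) (gnorm q) \<ge> 0" by (simp add: max_def)
  ultimately show ?thesis by linarith
qed

lemma heightE:
  assumes "xc P \<in> gaussian_rats"
  obtains p q where "q \<noteq> 0" "xc P = of_gint p / of_gint q" "int (height P) = max (gnorm p) (gnorm q)"
proof -
  obtain p q where "q \<noteq> 0" "xc P = of_gint p / of_gint q" using assms by (rule gaussian_ratsE)
  hence "\<exists>h p q. q \<noteq> 0 \<and> xc P = of_gint p / of_gint q \<and> h = nat (max (gnorm p) (gnorm q))" by blast
  hence "\<exists>p q. q \<noteq> 0 \<and> xc P = of_gint p / of_gint q \<and> height P = nat (max (gnorm p) (gnorm q))"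
    unfolding height_def by (rule LeastI_ex)
  then obtain p q where pq: "q \<noteq> 0" "xc P = of_gint p / of_gint q" "height P = nat (max (gnorm p) (gnorm q))" by blast
  moreover have "max (gnorm p) (gnorm q) \<ge> 0" by (simp add: max_def)
  ultimately have "int (height P) = max (gnorm p) (gnorm q)" by simp
  thus ?thesis using that pq by blast
qed

lemma height_pos: "xc P \<in> gaussian_rats \<Longrightarrow> height P \<ge> 1"
proof -
  assume "xc P \<in> gaussian_rats"
  then obtain p q where "q \<noteq> 0" "int (height P) = max (gnorm p) (gnorm q)" by (rule heightE)
  moreover from this have "gnorm q > 0" by (intro gnorm_pos_iff[THEN iffD2])
  ultimately show ?thesis by linarith
qed

lemma height_xc_le:
  assumes "xc R \<in> gaussian_rats" "xc P = xc R \<or> xc P = - xc R"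
  shows "height P \<le> height R"
proof -
  obtain p q where pq: "q \<noteq> 0" "xc R = of_gint p / of_gint q" "int (height R) = max (gnorm p) (gnorm q)"
    by (rule heightE[OF assms(1)])
  from assms(2) have "int (height P) \<le> max (gnorm p) (gnorm q)"
  proof
    assume "xc P = xc R"
    thus ?thesis using pq(2) by (intro height_le[OF pq(1)]) simp
  next
    assume "xc P = - xc R"
    hence "xc P = of_gint (- p) / of_gint q" using pq(2) by simp
    from height_le[OF pq(1) this] show ?thesis by simp
  qed
  thus ?thesis using pq(3) by linarith
qed

lemma height_xc_cong:
  assumes "xc R \<in> gaussian_rats" "xc P = xc R \<or> xc P = - xc R"
  shows "height P = height R"
proof (rule antisym)
  show "height P \<le> height R" by (rule height_xc_le[OF assms])
  have "xc P \<in> gaussian_rats" using assms gaussian_rats_uminus by auto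
  moreover have "xc R = xc P \<or> xc R = - xc P" using assms(2) by auto
  ultimately show "height R \<le> height P" by (rule height_xc_le)
qed

lemma height_imul: "xc P \<in> gaussian_rats \<Longrightarrow> height (imul P) = height P"
  by (rule height_xc_cong) simp_all

text \<open>For a the larger number: if 2b \<le> a then a \<le> 2(a - b), so a^2 \<le> 4(a - b)^2
  \<le> 16h; otherwise a^2 \<le> 2ab \<le> 2h.\<close>

lemma max_square_le:
  fixes a b M h :: int
  assumes "a \<ge> 0" "b \<ge> 0" "a * b \<le> h" "(a - b)^2 \<le> 4 * h"
  shows "(max a b)^2 \<le> 16 * h"
proof -
  have *: "x^2 \<le> 16 * h" if x: "0 \<le> y" "y \<le> x" "x * y \<le> h" "(x - y)^2 \<le> 4 * h" for x y :: int
  proof (cases "2 * y \<le> x")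
    case True
    hence "x \<le> 2 * (x - y)" by simp
    hence "x^2 \<le> (2 * (x - y))^2" using x by (intro power_mono) auto
    also have "(2 * (x - y))^2 = 4 * (x - y)^2" by (simp add: power2_eq_square algebra_simps)
    finally show ?thesis using x(4) by linarith
  next
    case False
    hence "x * x \<le> x * (2 * y)" using x by (intro mult_left_mono) auto
    moreover have "h \<ge> 0" using x(3) mult_nonneg_nonneg[of x y] x by linarith
    ultimately show ?thesis using x(3) by (simp add: power2_eq_square)
  qed
  show ?thesis
  proof (cases "b \<le> a")
    case True
    thus ?thesis using *[of b a] assms by (simp add: max_def)
  next
    case False
    moreover have "(b - a)^2 \<le> 4 * h" using assms(4) by (simp add: power2_commute)
    ultimately show ?thesis using *[of a b] assms by (simp add: max_def mult.commute)
  qed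
qed

text \<open>In (p^2 - q^2) / (2 i p q) the product p q is coprime to the numerator, so only divisors
  of 2 can cancel. The height of the image therefore controls both the norm of p q and a quarter of
  the norm of p^2 - q^2.\<close>

lemma height_phi:
  assumes "xc P \<in> gaussian_rats" "xc (phi P) \<in> gaussian_rats"
  shows "(height P)^2 \<le> 16 * height (phi P)"
proof (cases "xc P = 0")
  case True
  hence "height P = height (phi P)" using phi_xc_0 assms(2) by (intro height_xc_cong) simp_all
  moreover have "int (height P) \<le> max (gnorm 0) (gnorm 1)" by (rule height_le) (simp_all add: True)
  moreover from this have "height P = 1" using height_pos[OF assms(1)] by simp
  ultimately have "height P = 1" "height (phi P) = 1" by simp_all
  thus ?thesis by simp
next
  case False
  hence P0: "P \<noteq> 0" by auto
  obtain p q where pq: "q \<noteq> 0" "coprime p q" "xc P = of_gint p / of_gint q" using assms(1) by (rule gaussian_ratsE)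
  have p0: "p \<noteq> 0" using pq False by auto
  have f: "frac_form (p^2 - q^2) (2 * gi * p * q) (phi P)"
    by (rule frac_form_phi) (use pq P0 xc_phi(1)[OF P0 False] in \<open>simp_all add: frac_form_def\<close>)
  obtain u v where uv: "v \<noteq> 0" "xc (phi P) = of_gint u / of_gint v" "int (height (phi P)) = max (gnorm u) (gnorm v)"
    using assms(2) by (rule heightE)
  define h where "h = max (gnorm u) (gnorm v)"
  have "of_gint u / of_gint v = of_gint (p^2 - q^2) / of_gint (2 * gi * p * q)"
    using f uv(2) unfolding frac_form_def by metis
  moreover have "of_gint (2 * gi * p * q) \<noteq> 0" using f unfolding frac_form_def by (metis of_gint_eq_0_iff)
  ultimately have "of_gint (u * (2 * gi * p * q)) = of_gint (v * (p^2 - q^2))"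
    using uv(1) by (simp add: frac_eq_eq mult.commute)
  hence e: "u * (2 * gi * p * q) = v * (p^2 - q^2)" by (simp only: of_gint_eq_iff)
  have "coprime (p * q) (p^2 - q^2)"
  proof -
    have *: "coprime x (x^2 - y^2)" if "coprime x y" for x y :: gint
    proof (rule coprimeI)
      fix c assume c: "c dvd x" "c dvd x^2 - y^2"
      have "c dvd x^2 - (x^2 - y^2)" by (intro dvd_diff c(2)) (use c(1) in \<open>simp add: power2_eq_square\<close>)
      hence "c dvd y^2" by simp
      moreover have "coprime x (y^2)" using that by simp
      ultimately show "is_unit c" using coprime_common_divisor[of x "y^2" c] c(1) by simp
    qed
    have "coprime p (p^2 - q^2)" using pq(2) by (rule *)
    moreover have "coprime q (q^2 - p^2)" using pq(2) by (intro *) (simp add: coprime_commute)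
    hence "coprime q (- (q^2 - p^2))" by (simp only: coprime_minus_right_iff)
    hence "coprime q (p^2 - q^2)" by simp
    ultimately show ?thesis by simp
  qed
  moreover have "p * q dvd v * (p^2 - q^2)" unfolding e[symmetric] by (rule dvdI[of _ _ "u * (2 * gi)"]) (simp add: mult_ac)
  ultimately have "p * q dvd v" by (simp only: coprime_dvd_mult_left_iff)
  then obtain z where z: "v = p * q * z" by (elim dvdE)
  have "p * q * (2 * gi * u) = p * q * (z * (p^2 - q^2))" using e unfolding z by (simp add: mult_ac)
  hence e2: "2 * gi * u = z * (p^2 - q^2)" using p0 pq(1) by simp
  have "z \<noteq> 0" using uv(1) z by auto
  hence "gnorm z > 0" by (rule gnorm_pos_iff[THEN iffD2])
  hence z1: "gnorm z \<ge> 1" by linarith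
  have "gnorm p * gnorm q * 1 \<le> gnorm p * gnorm q * gnorm z" by (intro mult_left_mono z1) simp
  hence 1: "gnorm p * gnorm q \<le> h" using z by (simp add: gnorm_mult h_def)
  have "1 * gnorm (p^2 - q^2) \<le> gnorm z * gnorm (p^2 - q^2)" by (intro mult_right_mono z1) simp
  also have "\<dots> = gnorm (2 * gi * u)" by (simp only: e2 gnorm_mult)
  also have "\<dots> = 4 * gnorm u" by (simp add: gnorm_mult)
  finally have 2: "(gnorm p - gnorm q)^2 \<le> 4 * h" using gnorm_square_diff[of p q] unfolding h_def by linarith
  have "int (height P) \<le> max (gnorm p) (gnorm q)" using pq by (intro height_le) auto
  hence "int (height P)^2 \<le> (max (gnorm p) (gnorm q))^2" by (intro power_mono) auto
  also have "\<dots> \<le> 16 * h" by (rule max_square_le[OF gnorm_nonneg gnorm_nonneg 1 2])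
  finally have "int ((height P)^2) \<le> int (16 * height (phi P))" using uv(3) by (simp add: h_def)
  thus ?thesis by (simp only: of_nat_le_iff)
qed

lemma finite_gnorm_le: "finite {z. gnorm z \<le> B}"
proof -
  have "{z. gnorm z \<le> B} \<subseteq> (\<lambda>(a, b). GInt a b) ` ({- B..B} \<times> {- B..B})"
  proof
    fix z assume "z \<in> {z. gnorm z \<le> B}"
    hence le: "(gre z)^2 + (gim z)^2 \<le> B" by (simp add: gnorm_def)
    have sq: "\<bar>x\<bar> \<le> x^2" for x :: int
    proof (cases "x = 0")
      case False
      hence "\<bar>x\<bar> * 1 \<le> \<bar>x\<bar> * \<bar>x\<bar>" by (intro mult_left_mono) auto
      thus ?thesis by (simp only: power2_eq_square abs_mult_self_eq mult_1_right)
    qed simp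
    have "\<bar>gre z\<bar> \<le> B" "\<bar>gim z\<bar> \<le> B"
      using le sq[of "gre z"] sq[of "gim z"] zero_le_power2[of "gre z"] zero_le_power2[of "gim z"] by linarith+
    hence "z = (\<lambda>(a, b). GInt a b) (gre z, gim z)" "(gre z, gim z) \<in> {- B..B} \<times> {- B..B}" by auto
    thus "z \<in> (\<lambda>(a, b). GInt a b) ` ({- B..B} \<times> {- B..B})" by (rule image_eqI)
  qed
  thus ?thesis by (rule finite_subset) auto
qed

lemma finite_height_le: "finite {P. xc P \<in> gaussian_rats \<and> height P \<le> B}"
proof -
  define S where "S = (\<lambda>(p, q). of_gint p / of_gint q) ` ({z. gnorm z \<le> int B} \<times> {z. gnorm z \<le> int B})"
  have "finite S" unfolding S_def by (intro finite_imageI finite_cartesian_product finite_gnorm_le)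
  hence "finite {P. P = 0 \<or> xc P \<in> S}" by (rule finite_xc_fibre)
  moreover have "xc P \<in> S" if P: "xc P \<in> gaussian_rats" "height P \<le> B" for P
  proof -
    obtain p q where "q \<noteq> 0" "xc P = of_gint p / of_gint q" "int (height P) = max (gnorm p) (gnorm q)"
      by (rule heightE[OF P(1)])
    moreover from this have "gnorm p \<le> int B" "gnorm q \<le> int B" using P(2) by linarith+
    ultimately show ?thesis unfolding S_def by (intro image_eqI[of _ _ "(p, q)"]) simp_all
  qed
  hence "{P. xc P \<in> gaussian_rats \<and> height P \<le> B} \<subseteq> {P. P = 0 \<or> xc P \<in> S}" by blast
  ultimately show ?thesis by (rule rev_finite_subset)
qed

lemma xc_add:
  assumes "P \<noteq> 0" "R \<noteq> 0" "xc P \<noteq> xc R"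
  shows "(xc P - xc R)^2 * xc (P + R) = (xc P * xc R - 1) * (xc P + xc R) - 2 * yc P * yc R"
proof -
  obtain x1 y1 where 1: "y1^2 = x1^3 - x1" "P = Pt x1 y1" using assms(1) by (rule nonzero_ptE)
  obtain x2 y2 where 2: "y2^2 = x2^3 - x2" "R = Pt x2 y2" using assms(2) by (rule nonzero_ptE)
  have "\<not> (x1 = x2 \<and> y1 + y2 = 0)" using assms(3) 1 2 by simp
  hence ne: "\<not> (x1 = x2 \<and> y1 + y2 = 0)" .
  obtain l m x3 where *: "y1 = l * x1 + m" "y2 = l * x2 + m" "vieta (- 1) 0 l m x1 x2 x3"
    "(- (l * x3 + m))^2 = x3^3 - x3" "Pt x1 y1 + Pt x2 y2 = Pt x3 (- (l * x3 + m))"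
    by (rule Pt_add[OF 1(1) 2(1) ne]) blast
  have "(x1 - x2)^2 * x3 = (x1 * x2 - 1) * (x1 + x2) - 2 * y1 * y2"
    using *(1,2) 1(1) 2(1) *(3) unfolding vieta_def by Groebner_Basis.algebra
  thus ?thesis using 1 2 *(4,5) by simp
qed

context four_primes
begin

lemma G_xc: "P \<in> G \<Longrightarrow> xc P \<in> gaussian_rats"
  by (simp add: G_def)

text \<open>Over the common denominator, the numerator and denominator of the addition formula have
  degree 2 in (p, q) and in (r, t), whence a quadratic bound. The term with both ordinates is a
  Gaussian integer \<open>w'\<close> because its square is one.\<close>

lemma height_add_generic:
  assumes P: "P \<in> G" "P \<noteq> 0" and R: "R \<in> G" "R \<noteq> 0" and ne: "xc P \<noteq> xc R"
  shows "height (P + R) \<le> 64 * height R ^ 2 * height P ^ 2"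
proof -
  obtain p q where pq: "q \<noteq> 0" "xc P = of_gint p / of_gint q" "int (height P) = max (gnorm p) (gnorm q)"
    by (rule heightE[OF G_xc[OF P(1)]])
  obtain r t where rt: "t \<noteq> 0" "xc R = of_gint r / of_gint t" "int (height R) = max (gnorm r) (gnorm t)"
    by (rule heightE[OF G_xc[OF R(1)]])
  define M N where "M = int (height P)" and "N = int (height R)"
  have M: "gnorm p \<le> M" "gnorm q \<le> M" "M \<ge> 0" and N: "gnorm r \<le> N" "gnorm t \<le> N" "N \<ge> 0"
    using pq(3) rt(3) by (simp_all add: M_def N_def)
  obtain yP where yP: "yP \<in> gaussian_rats" "yc P = s * yP" using P(1) unfolding G_def by (blast elim: ratioE)
  obtain yR where yR: "yR \<in> gaussian_rats" "yc R = s * yR" using R(1) unfolding G_def by (blast elim: ratioE)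
  define w where "w = of_gint q ^ 2 * of_gint t ^ 2 * (of_gint n * yP * yR)"
  have wK: "w \<in> gaussian_rats" unfolding w_def by (intro rats_closed of_gint_rat yP yR)
  have yy: "yc P * yc R = of_gint n * yP * yR" unfolding yP yR using s2(2) by (simp add: mult_ac)
  have cube: "c ^ 4 * ((a / c)^3 - a / c) = c * a * (a^2 - c^2)" if "c \<noteq> 0" for a c :: complex
    using that by (simp add: field_simps power2_eq_square power3_eq_cube power4_eq_xxxx)
  have "w^2 = (of_gint q ^ 4 * yc P ^ 2) * (of_gint t ^ 4 * yc R ^ 2)"
    unfolding w_def yy[symmetric] by (simp add: power_mult_distrib flip: power_mult)
  also have "\<dots> = of_gint (q * p * (p^2 - q^2) * (t * r * (r^2 - t^2)))"
    using pq(1) rt(1) by (simp add: coords_on_curve pq(2) rt(2) cube)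
  finally obtain w' where w': "w = of_gint w'" "q * p * (p^2 - q^2) * (t * r * (r^2 - t^2)) = w'^2"
    by (rule gaussian_rat_square_integral[OF wK])
  define u v where "u = (p * r - q * t) * (p * t + r * q) - 2 * w'" and "v = (p * t - r * q)^2"
  have "xc P - xc R = of_gint (p * t - r * q) / of_gint (q * t)"
    using pq(1) rt(1) by (simp add: pq(2) rt(2) field_simps)
  hence d: "(xc P - xc R)^2 = of_gint v / of_gint ((q * t)^2)"
    by (simp only: v_def of_gint_power power_divide)
  have "of_gint v / of_gint ((q * t)^2) * xc (P + R) = of_gint u / of_gint ((q * t)^2)"
  proof -
    have "(xc P * xc R - 1) * (xc P + xc R) = of_gint ((p * r - q * t) * (p * t + r * q)) / of_gint ((q * t)^2)"
    proof -
      have "xc P * xc R - 1 = of_gint (p * r - q * t) / of_gint (q * t)"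
        using pq(1) rt(1) by (simp add: pq(2) rt(2) field_simps)
      moreover have "xc P + xc R = of_gint (p * t + r * q) / of_gint (q * t)"
        unfolding pq(2) rt(2) of_gint_simps by (rule add_frac_eq) (use pq(1) rt(1) in simp_all)
      ultimately show ?thesis by (simp only: times_divide_times_eq power2_eq_square of_gint_simps(6))
    qed
    moreover have "2 * yc P * yc R = of_gint (2 * w') / of_gint ((q * t)^2)"
      using pq(1) rt(1) yy by (simp add: w'(1)[symmetric] w_def field_simps)
    ultimately show ?thesis using xc_add[OF P(2) R(2) ne] d by (simp add: u_def diff_divide_distrib)
  qed
  hence "of_gint v * xc (P + R) = of_gint u" using pq(1) rt(1) by (simp add: field_simps)
  moreover have v0: "v \<noteq> 0"
  proof
    assume "v = 0"
    thus False using d ne by simp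
  qed
  ultimately have "xc (P + R) = of_gint u / of_gint v" by (simp add: field_simps)
  hence "int (height (P + R)) \<le> max (gnorm u) (gnorm v)" by (rule height_le[OF v0])
  moreover have b: "gnorm (a * c) \<le> M * N" if "gnorm a \<le> M" "gnorm c \<le> N" for a c
    unfolding gnorm_mult by (rule mult_mono) (use that M N in auto)
  have b': "gnorm (a * c) \<le> M * N" if "gnorm a \<le> N" "gnorm c \<le> M" for a c
    using b[OF that(2,1)] by (simp add: mult.commute)
  have MN: "M * N \<ge> 0" using M N by simp
  have 1: "gnorm (p * r - q * t) \<le> 4 * (M * N)" by (rule gnorm_add_le'(2)[OF b[OF M(1) N(1)] b[OF M(2) N(2)]])
  have 2: "gnorm (p * t + r * q) \<le> 4 * (M * N)" by (rule gnorm_add_le'(1)[OF b[OF M(1) N(2)] b'[OF N(1) M(2)]])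
  have 3: "gnorm (p * t - r * q) \<le> 4 * (M * N)" by (rule gnorm_add_le'(2)[OF b[OF M(1) N(2)] b'[OF N(1) M(2)]])
  have v: "gnorm v \<le> 16 * (M * N)^2"
  proof -
    have "gnorm v \<le> (4 * (M * N))^2" unfolding v_def gnorm_power by (rule power_mono[OF 3]) simp
    thus ?thesis by (simp add: power_mult_distrib)
  qed
  have w: "gnorm w' \<le> 4 * (M * N)^2"
  proof -
    have e: "gnorm (a * c * (c^2 - a^2)) \<le> 4 * L^4" if "gnorm a \<le> L" "gnorm c \<le> L" "L \<ge> 0" for a c L
    proof -
      have "gnorm (a^2) \<le> L^2" "gnorm (c^2) \<le> L^2" unfolding gnorm_power using that by (auto intro: power_mono)
      hence "gnorm (c^2 - a^2) \<le> 4 * L^2" by (intro gnorm_add_le'(2))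
      hence "gnorm a * gnorm c * gnorm (c^2 - a^2) \<le> L * L * (4 * L^2)" using that by (intro mult_mono) auto
      thus ?thesis by (simp add: gnorm_mult power2_eq_square power4_eq_xxxx mult_ac)
    qed
    have "gnorm w' ^ 2 = gnorm (q * p * (p^2 - q^2)) * gnorm (t * r * (r^2 - t^2))"
      unfolding gnorm_power[symmetric] w'(2)[symmetric] by (simp only: gnorm_mult)
    also have "\<dots> \<le> (4 * M^4) * (4 * N^4)"
      by (rule mult_mono[OF e[OF M(2,1,3)] e[OF N(2,1,3)]]) simp_all
    also have "\<dots> = (4 * (M * N)^2)^2" by (simp add: power_mult_distrib flip: power_mult)
    finally show ?thesis by (rule power2_le_imp_le) simp
  qed
  have u: "gnorm u \<le> 64 * (M * N)^2"
  proof -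
    have "gnorm ((p * r - q * t) * (p * t + r * q)) \<le> (4 * (M * N)) * (4 * (M * N))"
      unfolding gnorm_mult by (rule mult_mono[OF 1 2]) (use MN in simp_all)
    hence "gnorm ((p * r - q * t) * (p * t + r * q)) \<le> 16 * (M * N)^2" by (simp add: power2_eq_square)
    moreover have "gnorm (2 * w') \<le> 16 * (M * N)^2" using w by (simp add: gnorm_mult)
    ultimately have "gnorm u \<le> 4 * (16 * (M * N)^2)" unfolding u_def by (rule gnorm_add_le'(2))
    thus ?thesis by simp
  qed
  ultimately have "int (height (P + R)) \<le> 64 * (M * N)^2" using u v zero_le_power2[of "M * N"] by linarith
  hence "int (height (P + R)) \<le> int (64 * height R ^ 2 * height P ^ 2)"
    by (simp add: M_def N_def power_mult_distrib mult_ac)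
  thus ?thesis by (simp only: of_nat_le_iff)
qed

lemma height_add:
  assumes R: "R \<in> G"
  obtains C where "\<And>P. P \<in> G \<Longrightarrow> height (P + R) \<le> C * height P ^ 2"
proof
  fix P assume P: "P \<in> G"
  let ?C = "64 * height R ^ 2 + height R + height (R + R) + 1"
  have h: "height P ^ 2 \<ge> 1" using height_pos[OF G_xc[OF P]] by simp
  have pos: "height 0 \<le> 1"
  proof -
    have "int (height 0) \<le> max (gnorm 0) (gnorm 1)" by (rule height_le) simp_all
    thus ?thesis by simp
  qed
  have const: "height (P + R) \<le> ?C * height P ^ 2" if "height (P + R) \<le> height R + height (R + R) + 1"
  proof -
    have "height (P + R) \<le> ?C * 1" using that by simp
    also have "\<dots> \<le> ?C * height P ^ 2" by (rule mult_le_mono2) fact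
    finally show ?thesis .
  qed
  show "height (P + R) \<le> ?C * height P ^ 2"
  proof (cases "P = 0 \<or> R = 0 \<or> xc P = xc R")
    case False
    hence "height (P + R) \<le> 64 * height R ^ 2 * height P ^ 2" using height_add_generic[OF P _ R] by blast
    also have "\<dots> \<le> ?C * height P ^ 2" by (intro mult_le_mono1) simp
    finally show ?thesis .
  next
    case True
    show ?thesis
    proof (cases "R = 0")
      case True
      have "1 \<le> ?C" by simp
      moreover have "height P \<le> height P ^ 2" using height_pos[OF G_xc[OF P]] by (simp add: power2_eq_square)
      ultimately have "1 * height P \<le> ?C * height P ^ 2" by (rule mult_le_mono)
      thus ?thesis using True by simp
    next
      case False
      hence "P = 0 \<or> P = R \<or> P = - R" using True xc_eq_imp[of R P] by auto
      thus ?thesis using const pos by auto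
    qed
  qed
qed

end


section \<open>Finite generation and a generator modulo torsion\<close>

context four_primes
begin

text \<open>This is Z[i] Q together with all 2-torsion of \<open>G\<close>: doubling the equation
  absorbs the torsion part.\<close>

definition "Hs = {P \<in> G. \<exists>z. gmul 2 P = gmul (2 * z) Q}"

lemma Hs_G: "P \<in> Hs \<Longrightarrow> P \<in> G"
  by (simp add: Hs_def)

lemma Hs_add: "P \<in> Hs \<Longrightarrow> R \<in> Hs \<Longrightarrow> P + R \<in> Hs"
proof -
  assume "P \<in> Hs" "R \<in> Hs"
  then obtain z w where "P \<in> G" "R \<in> G" "gmul 2 P = gmul (2 * z) Q" "gmul 2 R = gmul (2 * w) Q"
    by (auto simp: Hs_def)
  moreover from this have "gmul 2 (P + R) = gmul (2 * (z + w)) Q"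
    by (simp only: gmul_distrib gmul_add distrib_left)
  ultimately show ?thesis unfolding Hs_def using G_add by blast
qed

lemma Hs_gmul: "P \<in> Hs \<Longrightarrow> gmul c P \<in> Hs"
proof -
  assume "P \<in> Hs"
  then obtain z where z: "P \<in> G" "gmul 2 P = gmul (2 * z) Q" by (auto simp: Hs_def)
  have "gmul 2 (gmul c P) = gmul c (gmul 2 P)" by (rule gmul_commute)
  also have "\<dots> = gmul (2 * (c * z)) Q" unfolding z(2) gmul_mult[symmetric] by (simp add: mult_ac)
  finally show ?thesis unfolding Hs_def using G_gmul[OF z(1)] by blast
qed

lemma Hs_basic: "0 \<in> Hs" "T \<in> Hs" "Q \<in> Hs"
proof -
  have "gmul 2 T = gmul (2 * 0) Q" by (simp add: gmul_2 T_two_torsion)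
  thus "T \<in> Hs" unfolding Hs_def using T_G by blast
  have "gmul 2 0 = gmul (2 * 0) Q" by simp
  thus "0 \<in> Hs" unfolding Hs_def using G_zero by blast
  have "gmul 2 Q = gmul (2 * 1) Q" by simp
  thus "Q \<in> Hs" unfolding Hs_def using Q_G by blast
qed

lemma height_diff_uniform:
  assumes "finite S" "S \<subseteq> G"
  shows "\<exists>C. \<forall>R\<in>S. \<forall>P\<in>G. height (P - R) \<le> C * height P ^ 2"
  using assms
proof (induction S rule: finite_induct)
  case (insert R S)
  then obtain C where C: "\<forall>R\<in>S. \<forall>P\<in>G. height (P - R) \<le> C * height P ^ 2" by auto
  have "- R \<in> G" using insert.prems by (simp add: G_minus)
  then obtain C' where C': "\<And>P. P \<in> G \<Longrightarrow> height (P + - R) \<le> C' * height P ^ 2" by (rule height_add) blast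
  have "height (P - R') \<le> (C + C') * height P ^ 2" if "R' \<in> insert R S" "P \<in> G" for R' P
  proof (cases "R' = R")
    case True
    thus ?thesis using C'[OF that(2)] by (simp add: distrib_right)
  next
    case False
    hence "height (P - R') \<le> C * height P ^ 2" using C that by auto
    thus ?thesis by (simp add: distrib_right)
  qed
  thus ?case by blast
qed simp

text \<open>Two coset steps along \<open>phi\<close> form one step along 2. The square of
  \<open>phi\<close> raises the height to about its fourth power, while subtracting one of the
  finitely many R costs only a square, so the quotient point is smaller than P outside a bounded
  set.\<close>

lemma descent_step:
  "\<exists>B. \<forall>P\<in>G. \<exists>R P'. R \<in> Hs \<and> P' \<in> G \<and> P = R + gmul 2 P' \<and> (height P' \<le> B \<or> height P' < height P)"
proof -
  define cosets where "cosets = {0, T, Q, T + Q}"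
  define S where "S = (\<lambda>(c, c'). c + phi c') ` (cosets \<times> cosets)"
  have inH: "c \<in> Hs" if "c \<in> cosets" for c using that Hs_basic Hs_add by (auto simp: cosets_def)
  have phiH: "phi c \<in> Hs" if "c \<in> Hs" for c using Hs_gmul[OF that, of "1 + gi"] by (simp only: gmul_phi)
  have "a + phi c \<in> Hs" if ac: "a \<in> cosets" "c \<in> cosets" for a c
    by (rule Hs_add[OF inH[OF ac(1)] phiH[OF inH[OF ac(2)]]])
  hence SH: "S \<subseteq> Hs" unfolding S_def by auto
  have "finite S" by (simp add: S_def cosets_def)
  moreover have "S \<subseteq> G" using SH Hs_G by blast
  ultimately obtain C where C: "\<forall>R\<in>S. \<forall>P\<in>G. height (P - R) \<le> C * height P ^ 2"
    using height_diff_uniform by blast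
  \<comment> \<open>4096 = 16^2 * 16 comes from two uses of \<open>height_phi\<close>, the first one
    squared.\<close>
  define K where "K = 4096 * C + 1"
  have "\<exists>R P'. R \<in> Hs \<and> P' \<in> G \<and> P = R + gmul 2 P' \<and> (height P' \<le> K \<or> height P' < height P)" if P: "P \<in> G" for P
  proof -
    obtain c where c: "c \<in> cosets" "P - c \<in> phi ` G" using coset_representatives[OF P] unfolding cosets_def by blast
    then obtain P1 where P1: "P1 \<in> G" "P - c = phi P1" by blast
    obtain c' where c': "c' \<in> cosets" "P1 - c' \<in> phi ` G" using coset_representatives[OF P1(1)] unfolding cosets_def by blast
    then obtain P2 where P2: "P2 \<in> G" "P1 - c' = phi P2" by blast
    define R where "R = c + phi c'"
    have RS: "R \<in> S" unfolding S_def R_def by (rule image_eqI[of _ _ "(c, c')"]) (use c(1) c'(1) in auto)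
    have "P = c + phi (c' + phi P2)" using P1(2) P2(2) by (simp add: algebra_simps)
    hence PR: "P = R + phi (phi P2)" by (simp add: R_def phi_add add.assoc)
    have "gmul 2 (imul P2) = phi (phi P2)" by (simp add: gmul_2 phi_phi)
    hence "P = R + gmul 2 (imul P2)" using PR by simp
    moreover have "height P2 \<le> K \<or> height P2 < height P"
    proof (rule ccontr)
      assume "\<not> ?thesis"
      hence h: "K < height P2" "height P \<le> height P2" by auto
      have G1: "phi P2 \<in> G" by (rule G_phi[OF P2(1)])
      have G2: "phi (phi P2) \<in> G" by (rule G_phi[OF G1])
      have 1: "height P2 ^ 2 \<le> 16 * height (phi P2)" by (rule height_phi[OF G_xc[OF P2(1)] G_xc[OF G1]])
      have 2: "height (phi P2) ^ 2 \<le> 16 * height (phi (phi P2))" by (rule height_phi[OF G_xc[OF G1] G_xc[OF G2]])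
      have "phi (phi P2) = P - R" using PR by simp
      hence 3: "height (phi (phi P2)) \<le> C * height P ^ 2" using C RS P by simp
      have "(height P2 ^ 2)^2 \<le> (16 * height (phi P2))^2" using 1 by (rule power_mono) simp
      also have "\<dots> = 256 * height (phi P2) ^ 2" by (simp add: power_mult_distrib)
      also have "\<dots> \<le> 256 * (16 * (C * height P ^ 2))" using 2 3 by linarith
      also have "\<dots> \<le> K * height P ^ 2" by (simp add: K_def algebra_simps)
      also have "\<dots> \<le> K * height P2 ^ 2" using h(2) by (intro mult_le_mono2 power_mono) auto
      finally have "height P2 ^ 2 * height P2 ^ 2 \<le> K * height P2 ^ 2" by (simp only: power2_eq_square)
      moreover have pos: "height P2 ^ 2 > 0" using h(1) by simp
      ultimately have "height P2 ^ 2 \<le> K" by (metis mult_le_cancel2)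
      moreover have "height P2 \<le> height P2 ^ 2" using h(1) by (simp add: power2_eq_square)
      ultimately show False using h(1) by linarith
    qed
    moreover have "R \<in> Hs" using RS SH by blast
    moreover have "imul P2 \<in> G" by (rule G_imul[OF P2(1)])
    ultimately show ?thesis using height_imul[OF G_xc[OF P2(1)]] by metis
  qed
  thus ?thesis by blast
qed

text \<open>The step maps the finite set of points of small height to itself, so its iterates
  repeat. A repetition gives A = R + 2^d A with R in \<open>Hs\<close>, so 1 - 2^d carries A into
  \<open>Hs\<close>, and P differs from a multiple of A by an element of \<open>Hs\<close>.\<close>

lemma small_height_multiple:
  assumes step: "\<forall>P\<in>G. \<exists>R P'. R \<in> Hs \<and> P' \<in> G \<and> P = R + gmul 2 P' \<and> (height P' \<le> B \<or> height P' < height P)"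
    and P: "P \<in> G" "height P \<le> B"
  shows "\<exists>D. D \<noteq> 0 \<and> gmul D P \<in> Hs"
proof -
  define S where "S = {P \<in> G. height P \<le> B}"
  have fin: "finite S" by (rule finite_subset[OF _ finite_height_le[of B]]) (auto simp: S_def G_xc)
  have "\<exists>A'. A' \<in> S \<and> (\<exists>R\<in>Hs. A = R + gmul 2 A')" if "A \<in> S" for A
  proof -
    from that obtain R A' where "R \<in> Hs" "A' \<in> G" "A = R + gmul 2 A'" "height A' \<le> B \<or> height A' < height A"
      using step unfolding S_def by blast
    thus ?thesis using that unfolding S_def by auto
  qed
  hence "\<forall>A\<in>S. \<exists>A'. A' \<in> S \<and> (\<exists>R\<in>Hs. A = R + gmul 2 A')" by (intro ballI)
  from bchoice[OF this] obtain f where "\<forall>A\<in>S. f A \<in> S \<and> (\<exists>R\<in>Hs. A = R + gmul 2 (f A))" ..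
  hence f: "\<And>A. A \<in> S \<Longrightarrow> f A \<in> S" "\<And>A. A \<in> S \<Longrightarrow> \<exists>R\<in>Hs. A = R + gmul 2 (f A)" by simp_all
  have iter: "(f ^^ i) A \<in> S \<and> (\<exists>R\<in>Hs. A = R + gmul (2 ^ i) ((f ^^ i) A))" if A: "A \<in> S" for A i
  proof (induction i)
    case 0
    show ?case using A Hs_basic(1) by (intro conjI bexI[of _ 0]) simp_all
  next
    case (Suc i)
    then obtain R where R: "(f ^^ i) A \<in> S" "R \<in> Hs" "A = R + gmul (2 ^ i) ((f ^^ i) A)" by blast
    obtain R' where R': "R' \<in> Hs" "(f ^^ i) A = R' + gmul 2 ((f ^^ Suc i) A)" using f(2)[OF R(1)] by auto
    have "gmul (2 ^ i) ((f ^^ i) A) = gmul (2 ^ i) R' + gmul (2 ^ i) (gmul 2 ((f ^^ Suc i) A))"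
      unfolding arg_cong[OF R'(2), of "gmul (2 ^ i)"] gmul_distrib ..
    hence "A = R + gmul (2 ^ i) R' + gmul (2 ^ i) (gmul 2 ((f ^^ Suc i) A))"
      using R(3) by (simp only: add.assoc)
    hence "A = (R + gmul (2 ^ i) R') + gmul (2 ^ Suc i) ((f ^^ Suc i) A)"
      by (simp only: gmul_mult[symmetric] power_Suc2)
    moreover have "R + gmul (2 ^ i) R' \<in> Hs" by (intro Hs_add Hs_gmul R R')
    moreover have "(f ^^ Suc i) A \<in> S" using f(1)[OF R(1)] by simp
    ultimately show ?case by blast
  qed
  have PS: "P \<in> S" using P by (simp add: S_def)
  have "\<not> inj (\<lambda>i. (f ^^ i) P)"
  proof
    assume "inj (\<lambda>i. (f ^^ i) P)"
    moreover have "range (\<lambda>i. (f ^^ i) P) \<subseteq> S" using iter[OF PS] by blast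
    hence "finite (range (\<lambda>i. (f ^^ i) P))" using fin finite_subset by blast
    ultimately show False using finite_imageD infinite_UNIV_nat by blast
  qed
  then obtain i' j' where "(f ^^ i') P = (f ^^ j') P" "i' \<noteq> j'" by (auto simp: inj_def)
  then obtain i j where ij: "(f ^^ i) P = (f ^^ j) P" "i < j" by (metis linorder_neqE_nat)
  define A d where "A = (f ^^ i) P" and "d = j - i"
  have AS: "A \<in> S" using iter[OF PS] by (simp add: A_def)
  have "(f ^^ (d + i)) P = (f ^^ d) ((f ^^ i) P)" by (simp only: funpow_add o_apply)
  moreover have "d + i = j" using ij(2) by (simp add: d_def)
  ultimately have "(f ^^ d) A = (f ^^ j) P" by (simp only: A_def)
  hence "(f ^^ d) A = A" using ij(1) by (simp add: A_def)
  then obtain R where R: "R \<in> Hs" "A = R + gmul (2 ^ d) A" using iter[OF AS, of d] by auto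
  define D :: gint where "D = 1 - 2 ^ d"
  have "gmul D A = R" using R(2) by (simp add: D_def gmul_diff_left algebra_simps)
  obtain R' where R': "R' \<in> Hs" "P = R' + gmul (2 ^ i) A" using iter[OF PS, of i] unfolding A_def by blast
  have "gmul D P = gmul D R' + gmul (2 ^ i) (gmul D A)"
    unfolding arg_cong[OF R'(2), of "gmul D"] gmul_distrib gmul_commute[of D "2 ^ i"] ..
  hence "gmul D P = gmul D R' + gmul (2 ^ i) R" by (simp only: \<open>gmul D A = R\<close>)
  hence "gmul D P \<in> Hs" using Hs_add[OF Hs_gmul[OF R'(1)] Hs_gmul[OF R(1)]] by simp
  moreover have "D \<noteq> 0"
  proof
    assume "D = 0"
    hence "(2 :: gint) ^ d = 1" by (simp add: D_def)
    hence "gnorm (2 ^ d) = 1" by simp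
    hence "(4 :: int) ^ d = 1" by (simp add: gnorm_power)
    moreover have "d > 0" using ij(2) by (simp add: d_def)
    ultimately show False using one_less_power[of "4 :: int" d] by simp
  qed
  ultimately show ?thesis by blast
qed

text \<open>The product of the multipliers of the finitely many small points works for all of these,
  and induction on the height extends it to \<open>G\<close>. A last factor 2 removes the torsion
  allowed in \<open>Hs\<close>.\<close>

lemma uniform_multiple: "\<exists>D. D \<noteq> 0 \<and> (\<forall>P\<in>G. \<exists>z. gmul D P = gmul z Q)"
proof -
  obtain B where step: "\<forall>P\<in>G. \<exists>R P'. R \<in> Hs \<and> P' \<in> G \<and> P = R + gmul 2 P' \<and> (height P' \<le> B \<or> height P' < height P)"
    using descent_step by blast
  define S where "S = {P \<in> G. height P \<le> B}"
  have fin: "finite S" by (rule finite_subset[OF _ finite_height_le[of B]]) (auto simp: S_def G_xc)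
  have "\<exists>D. D \<noteq> 0 \<and> (\<forall>P\<in>S'. gmul D P \<in> Hs)" if "finite S'" "S' \<subseteq> S" for S'
    using that
  proof (induction S' rule: finite_induct)
    case empty
    show ?case by (intro exI[of _ 1]) simp
  next
    case (insert A S')
    then obtain D where D: "D \<noteq> 0" "\<forall>P\<in>S'. gmul D P \<in> Hs" by auto
    have "A \<in> G" "height A \<le> B" using insert.prems by (auto simp: S_def)
    hence "\<exists>D. D \<noteq> 0 \<and> gmul D A \<in> Hs" by (rule small_height_multiple[OF step])
    then obtain D' where D': "D' \<noteq> 0" "gmul D' A \<in> Hs" by (elim exE conjE)
    have "gmul (D * D') P \<in> Hs" if P: "P \<in> insert A S'" for P
    proof (cases "P = A")
      case True
      thus ?thesis using Hs_gmul[OF D'(2), of D] by (simp only: gmul_mult)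
    next
      case False
      hence "gmul D P \<in> Hs" using D(2) P by simp
      from Hs_gmul[OF this, of D'] have "gmul (D' * D) P \<in> Hs" by (simp only: gmul_mult)
      thus ?thesis by (simp only: mult.commute[of D])
    qed
    moreover have "D * D' \<noteq> 0" using D(1) D'(1) by simp
    ultimately show ?case by blast
  qed
  from this[OF fin order_refl] obtain D where D: "D \<noteq> 0" "\<And>P. P \<in> S \<Longrightarrow> gmul D P \<in> Hs" by blast
  have all: "gmul D P \<in> Hs" if "P \<in> G" for P
    using that
  proof (induction "height P" arbitrary: P rule: less_induct)
    case less
    show ?case
    proof (cases "P \<in> S")
      case False
      obtain R P' where R: "R \<in> Hs" "P' \<in> G" "P = R + gmul 2 P'" "height P' \<le> B \<or> height P' < height P"
        using step less.prems by blast
      have "gmul D P' \<in> Hs"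
      proof (cases "height P' < height P")
        case True
        thus ?thesis using less.hyps R(2) by simp
      next
        case False
        thus ?thesis using D(2)[of P'] R(2,4) by (simp add: S_def)
      qed
      have "gmul D P = gmul D R + gmul 2 (gmul D P')"
        unfolding arg_cong[OF R(3), of "gmul D"] gmul_distrib gmul_commute[of D 2] ..
      thus ?thesis using Hs_add[OF Hs_gmul[OF R(1)] Hs_gmul[OF \<open>gmul D P' \<in> Hs\<close>]] by simp
    qed (rule D(2))
  qed
  have "\<exists>z. gmul (2 * D) P = gmul z Q" if P: "P \<in> G" for P
  proof -
    obtain z where "gmul 2 (gmul D P) = gmul (2 * z) Q" using all[OF P] unfolding Hs_def by blast
    thus ?thesis unfolding gmul_mult[symmetric] by blast
  qed
  moreover have "2 * D \<noteq> 0" using D(1) by (simp add: gint_eq_iff[of 2])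
  ultimately show ?thesis by blast
qed

lemma gmul_Q_torsion_free: "gmul z Q + gmul z Q = 0 \<Longrightarrow> z = 0"
proof (rule ccontr)
  assume z: "gmul z Q + gmul z Q = 0" "z \<noteq> 0"
  hence "gmul (2 * z) Q = 0" by (simp only: gmul_mult gmul_2)
  moreover have "2 * z \<noteq> 0" using z(2) by (simp add: gint_eq_iff[of 2])
  ultimately have "Q + Q = 0" using torsion[OF Q_G] by blast
  hence "Q = - Q" by (simp add: eq_neg_iff_add_eq_0)
  hence "yc Q = - yc Q" by (metis yc_minus)
  hence "yc Q = 0" by simp
  moreover have "1 - \<i> \<noteq> (0 :: complex)" by (simp add: complex_eq_iff)
  ultimately show False using s_nonzero p2_nonzero by (simp add: Q_coords(2))
qed

text \<open>Among the nonzero z with z Q in D G, one of least norm divides all others by Euclidean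
  division, as in a principal ideal. A point P0 belonging to it generates up to points killed by D,
  which are killed by 2.\<close>

lemma generator:
  obtains P0 where "P0 \<in> G" "\<And>P. P \<in> G \<Longrightarrow> \<exists>w. (P - gmul w P0) + (P - gmul w P0) = 0"
    "\<And>w. gmul w P0 + gmul w P0 = 0 \<Longrightarrow> w = 0"
proof -
  obtain D where D: "D \<noteq> 0" "\<forall>P\<in>G. \<exists>z. gmul D P = gmul z Q" using uniform_multiple by blast
  define J where "J = {z. z \<noteq> 0 \<and> (\<exists>P\<in>G. gmul D P = gmul z Q)}"
  have "D \<in> J" unfolding J_def using D(1) Q_G by blast
  then obtain z0 where z0: "z0 \<in> J" "\<And>z. z \<in> J \<Longrightarrow> nat (gnorm z0) \<le> nat (gnorm z)"
    using ex_has_least_nat[of "\<lambda>z. z \<in> J" D "\<lambda>z. nat (gnorm z)"] by blast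
  then obtain P0 where P0: "P0 \<in> G" "gmul D P0 = gmul z0 Q" "z0 \<noteq> 0" by (auto simp: J_def)
  have DwP: "gmul D (gmul w P0) = gmul (w * z0) Q" for w
    unfolding gmul_commute[of D w] P0(2) gmul_mult ..
  show ?thesis
  proof (rule that[OF P0(1)])
    fix P assume P: "P \<in> G"
    obtain z where z: "gmul D P = gmul z Q" using D(2) P by blast
    define w where "w = z div z0"
    define R where "R = P - gmul w P0"
    have R: "R \<in> G" unfolding R_def by (intro G_diff P G_gmul P0)
    have DR: "gmul D R = gmul (z - w * z0) Q"
      unfolding R_def gmul_diff DwP z gmul_diff_left ..
    have e: "z - w * z0 = z mod z0" by (simp add: w_def minus_div_mult_eq_mod)
    have DR': "gmul D R = gmul (z mod z0) Q" using DR unfolding e .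
    have "z mod z0 = 0"
    proof (rule ccontr)
      assume "z mod z0 \<noteq> 0"
      hence "z mod z0 \<in> J" unfolding J_def using DR' R by blast
      hence "nat (gnorm z0) \<le> nat (gnorm (z mod z0))" by (rule z0(2))
      moreover have "gnorm (z mod z0) < gnorm z0" by (rule gnorm_mod_less[OF P0(3)])
      ultimately show False using gnorm_nonneg[of "z mod z0"] by linarith
    qed
    hence "gmul D R = 0" using DR' by simp
    hence "R + R = 0" using torsion[OF R D(1)] by blast
    thus "\<exists>w. (P - gmul w P0) + (P - gmul w P0) = 0" unfolding R_def by blast
  next
    fix w assume "gmul w P0 + gmul w P0 = 0"
    hence "gmul D (gmul w P0 + gmul w P0) = gmul D 0" by simp
    hence "gmul D (gmul w P0) + gmul D (gmul w P0) = 0" by (simp only: gmul_distrib gmul_zero)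
    hence "gmul (w * z0) Q + gmul (w * z0) Q = 0" unfolding DwP .
    hence "w * z0 = 0" by (rule gmul_Q_torsion_free)
    thus "w = 0" using P0(3) by simp
  qed
qed

end


section \<open>Gaussian primes, proper subfields and the field of definition\<close>

lemma ec_add_eqI':
  assumes P: "y1^2 = x1^3 + a * x1 + b" and Q: "y2^2 = x2^3 + a * x2 + b" and v: "vieta a b l m x1 x2 x3"
    and y: "y1 = l * x1 + m" "y2 = l * x2 + m" and ne: "\<not> (x1 = x2 \<and> y1 + y2 = 0)"
  shows "ec_add (Weierstrass 0 0 0 a b) (Affine x1 y1) (Affine x2 y2) = Affine x3 (- (l * x3 + m))"
proof (cases "x1 = x2")
  case False
  thus ?thesis using ec_add_eqI[OF P Q v y] by simp
next
  case True
  hence "y1 = y2" using y by simp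
  hence y1: "y1 = y2" "y1 \<noteq> 0" using True ne by auto
  obtain l' m' x3' where *: "y1 = l' * x1 + m'" "vieta a b l' m' x1 x2 x3'"
    "ec_add (Weierstrass 0 0 0 a b) (Affine x1 y1) (Affine x2 y2) = Affine x3' (- (l' * x3' + m'))"
    by (rule ec_add_affine[OF P Q ne]) blast
  have "2 * l * y1 = 2 * l' * y1"
    using vieta_tangent_slope[of a b l m x1 x3] vieta_tangent_slope[of a b l' m' x1 x3'] v *(1,2) y(1) True by simp
  hence l: "l' = l" using y1(2) by simp
  hence m: "m' = m" using *(1) y(1) by simp
  have "x3' = x3" using v *(2) unfolding l m vieta_def by (metis add_left_cancel)
  thus ?thesis using *(3) l m by simp
qed

lemma divides_gaussian_ring: "of_gint a divides\<^bsub>gaussian_ring\<^esub> of_gint b \<longleftrightarrow> a dvd b"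
proof
  assume "of_gint a divides\<^bsub>gaussian_ring\<^esub> of_gint b"
  then obtain c where "c \<in> gaussian_ints" "of_gint b = of_gint a * c"
    by (auto simp: factor_def gaussian_ring_def ring_of_type_algebra_def)
  then obtain c' where "of_gint b = of_gint (a * c')" by (auto simp: gaussian_ints_iff)
  hence "b = a * c'" by (simp only: of_gint_eq_iff)
  thus "a dvd b" by (rule dvdI)
next
  assume "a dvd b"
  then obtain c where "b = a * c" by (elim dvdE)
  hence "of_gint b = of_gint a * of_gint c" by simp
  moreover have "of_gint c \<in> gaussian_ints" unfolding gaussian_ints_iff by blast
  ultimately show "of_gint a divides\<^bsub>gaussian_ring\<^esub> of_gint b"
    by (auto simp: factor_def gaussian_ring_def ring_of_type_algebra_def)
qed

lemma gaussian_prime_imp_prime_elem: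
  assumes "gaussian_prime (of_gint \<pi>)"
  shows "prime_elem \<pi>"
proof -
  have p: "of_gint \<pi> \<noteq> 0" "Divisibility.prime gaussian_ring (of_gint \<pi>)"
    using assms unfolding gaussian_prime_def ring_prime_def by (simp_all add: gaussian_ring_def ring_of_type_algebra_def)
  show ?thesis
  proof (rule prime_elemI)
    show "\<pi> \<noteq> 0" using p(1) by auto
    show "\<not> is_unit \<pi>"
    proof
      assume "is_unit \<pi>"
      then obtain w where "1 = \<pi> * w" by (elim dvdE)
      hence "of_gint 1 = of_gint (\<pi> * w)" by (rule arg_cong)
      hence w: "of_gint \<pi> * of_gint w = 1" by simp
      have int: "of_gint c \<in> gaussian_ints" for c unfolding gaussian_ints_iff by blast
      have "\<exists>x\<in>gaussian_ints. x * of_gint \<pi> = 1 \<and> of_gint \<pi> * x = 1"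
        using w by (intro bexI[OF _ int[of w]]) (simp add: mult.commute)
      hence "of_gint \<pi> \<in> Units gaussian_ring"
        unfolding Units_def gaussian_ring_def ring_of_type_algebra_def using int by simp
      thus False using p(2) unfolding Divisibility.prime_def by blast
    qed
    fix a b assume "\<pi> dvd a * b"
    hence "of_gint \<pi> divides\<^bsub>gaussian_ring\<^esub> of_gint (a * b)" by (simp only: divides_gaussian_ring)
    moreover have "of_gint (a * b) = of_gint a \<otimes>\<^bsub>gaussian_ring\<^esub> of_gint b"
      by (simp add: gaussian_ring_def ring_of_type_algebra_def)
    moreover have "of_gint c \<in> carrier gaussian_ring" for c
      by (auto simp: gaussian_ring_def gaussian_ints_iff)
    ultimately have "of_gint \<pi> divides\<^bsub>gaussian_ring\<^esub> of_gint a \<or> of_gint \<pi> divides\<^bsub>gaussian_ring\<^esub> of_gint b"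
      using p(2) unfolding Divisibility.prime_def by metis
    thus "\<pi> dvd a \<or> \<pi> dvd b" by (simp only: divides_gaussian_ring)
  qed
qed

lemma good_of_gint:
  assumes "gaussian_prime (of_gint \<pi>)" "gaussian_cong (of_gint \<pi>) (- 1 - 6 * \<i>) 16"
  shows "good \<pi>"
proof -
  have e: "of_gint \<pi> - (- 1 - 6 * \<i>) = of_gint (\<pi> - GInt (- 1) (- 6))" "16 = of_gint 16"
    by (simp_all add: of_gint_def complex_eq_iff)
  have "16 dvd \<pi> - GInt (- 1) (- 6)"
    using assms(2) unfolding gaussian_cong_def e divides_gaussian_ring .
  then obtain w where "\<pi> - GInt (- 1) (- 6) = 16 * w" by (elim dvdE)
  hence "gre \<pi> + 1 = 16 * gre w" "gim \<pi> + 6 = 16 * gim w" by (simp_all add: gint_eq_iff)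
  hence "gre \<pi> = 15 + 16 * (gre w - 1)" "gim \<pi> = 10 + 16 * (gim w - 1)" by simp_all
  hence "gre \<pi> mod 16 = 15" "gim \<pi> mod 16 = 10" by (simp_all only: mod_mult_self2) simp_all
  thus ?thesis using gaussian_prime_imp_prime_elem[OF assms(1)] by (simp add: good_def)
qed

text \<open>The norms are primes, so divisibility would make the two numbers associates. But a
  conjugate is -1+6i modulo 16, which is not a unit times -1-6i.\<close>

lemma good_not_dvd_conj:
  assumes g: "good \<pi>" "good \<pi>'"
  shows "\<not> \<pi> dvd gcnj \<pi>'"
proof
  assume d: "\<pi> dvd gcnj \<pi>'"
  obtain p where p: "Factorial_Ring.prime p" "gnorm \<pi> = int p" using g(1) by (rule good_normE)
  obtain p' where p': "Factorial_Ring.prime p'" "gnorm \<pi>' = int p'" using g(2) by (rule good_normE)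
  obtain u where u: "gcnj \<pi>' = \<pi> * u" using d by (elim dvdE)
  have "gnorm \<pi> dvd gnorm (gcnj \<pi>')" by (rule gint_dvd_gnorm[OF d])
  hence "int p dvd int p'" using p p' by simp
  hence "p dvd p'" by (simp only: int_dvd_int_iff)
  hence "p = p'" by (rule primes_dvd_imp_eq[OF p(1) p'(1)])
  moreover have "gnorm \<pi>' = gnorm \<pi> * gnorm u" using arg_cong[OF u, of gnorm] by (simp add: gnorm_mult)
  ultimately have "gnorm u = 1" using p p' prime_gt_0_nat[OF p(1)] by simp
  hence "u * gcnj u = 1" by (simp add: mult_gcnj)
  hence "is_unit u" by (metis dvd_triv_left)
  hence uc: "u = 1 \<or> u = - 1 \<or> u = gi \<or> u = - gi" by (simp add: gint_unit_iff)
  define a b c d where "a = gre \<pi> div 16" and "b = gim \<pi> div 16" and "c = gre \<pi>' div 16" and "d = gim \<pi>' div 16"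
  have "gre \<pi> = 16 * a + 15" "gim \<pi> = 16 * b + 10" "gre \<pi>' = 16 * c + 15" "gim \<pi>' = 16 * d + 10"
    using good_mod16[OF g(1)] good_mod16[OF g(2)] mult_div_mod_eq[of 16 "gre \<pi>"] mult_div_mod_eq[of 16 "gim \<pi>"]
      mult_div_mod_eq[of 16 "gre \<pi>'"] mult_div_mod_eq[of 16 "gim \<pi>'"]
    unfolding a_def b_def c_def d_def by linarith+
  moreover have "gre (gcnj \<pi>') = gre (\<pi> * u)" "gim (gcnj \<pi>') = gim (\<pi> * u)" by (simp_all only: u)
  ultimately show False using uc by (elim disjE) (simp_all, presburger+)
qed

text \<open>Every subfield contains the rationals. With a non-real element z it also contains i = (z
  - Re z) / Im z, and then it is the whole field.\<close>

lemma subfield_real: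
  assumes F: "subfield F (ring_of_type_algebra :: complex ring)" and sub: "F \<subset> gaussian_rats" and z: "z \<in> F"
  shows "Im z = 0"
proof (rule ccontr)
  assume Im: "Im z \<noteq> 0"
  interpret C: field "ring_of_type_algebra :: complex ring" by rule
  note ring = subringE[OF subfieldE(1)[OF F]]
  have add: "x + y \<in> F" if "x \<in> F" "y \<in> F" for x y
    using ring(7)[OF that] by (simp add: ring_of_type_algebra_def)
  have mult: "x * y \<in> F" if "x \<in> F" "y \<in> F" for x y
    using ring(6)[OF that] by (simp add: ring_of_type_algebra_def)
  have a_inv: "\<ominus>\<^bsub>ring_of_type_algebra\<^esub> x = - x" for x :: complex
    by (rule C.sum_zero_eq_neg[symmetric]) (simp_all add: ring_of_type_algebra_def)
  have minus: "- x \<in> F" if "x \<in> F" for x using ring(5)[OF that] by (simp add: a_inv)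
  have 1: "0 \<in> F" "1 \<in> F" using ring(2,3) by (simp_all add: ring_of_type_algebra_def)
  have inv: "inverse x \<in> F" if "x \<in> F" "x \<noteq> 0" for x
  proof -
    have "x \<in> F - {\<zero>\<^bsub>ring_of_type_algebra\<^esub>}" using that by (simp add: ring_of_type_algebra_def)
    from C.subfield_m_inv(1,2)[OF F this]
    have "inv\<^bsub>ring_of_type_algebra\<^esub> x \<in> F" "x * inv\<^bsub>ring_of_type_algebra\<^esub> x = 1"
      by (simp_all add: ring_of_type_algebra_def)
    thus ?thesis using inverse_unique[of x] by metis
  qed
  have nat: "of_nat k \<in> F" for k by (induction k) (simp_all add: 1 add)
  have int: "of_int k \<in> F" for k by (cases k) (simp_all only: of_int_of_nat_eq of_int_minus nat minus)
  have rat: "of_real r \<in> F" if r: "r \<in> \<rat>" for r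
  proof -
    obtain a b where "b > 0" "r = of_int a / of_int b" using r by (auto elim: Rats_cases')
    hence "of_real r = (of_int a / of_int b :: complex)" and b: "of_int b \<noteq> (0 :: complex)" by simp_all
    thus ?thesis using mult[OF int[of a] inv[OF int[of b] b]] by (simp only: divide_inverse)
  qed
  have zK: "Re z \<in> \<rat>" "Im z \<in> \<rat>" using sub z by (auto simp: gaussian_rats_def)
  have "z + - of_real (Re z) = \<i> * of_real (Im z)" by (simp add: complex_eq_iff)
  hence "\<i> = (z + - of_real (Re z)) * inverse (of_real (Im z))" using Im by simp
  moreover have "(z + - of_real (Re z)) * inverse (of_real (Im z)) \<in> F"
    using Im by (intro mult add minus inv rat zK z) simp
  ultimately have i: "\<i> \<in> F" by metis
  have "gaussian_rats \<subseteq> F"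
  proof
    fix x assume "x \<in> gaussian_rats"
    hence "of_real (Re x) + \<i> * of_real (Im x) \<in> F" by (intro mult add i rat) (simp_all add: gaussian_rats_def)
    thus "x \<in> F" by (simp flip: complex_eq)
  qed
  thus False using sub by blast
qed

context four_primes
begin

definition "E = Weierstrass 0 0 0 (- (of_gint n ^ 2)) 0"

lemma elliptic_curve: "elliptic_curve_over gaussian_rats E"
proof -
  have "- (of_gint n ^ 2) \<in> gaussian_rats" by (intro rats_closed of_gint_rat)
  thus ?thesis
    unfolding elliptic_curve_over_def using subfield_gaussian_rats n_nonzero by (simp add: E_def)
qed

text \<open>The norm is n times its conjugate, and p0 divides n exactly once and the conjugate not
  at all.\<close>

lemma gnorm_n_not_square: "of_int (gnorm n) \<noteq> (w :: gint)^2"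
proof
  assume "of_int (gnorm n) = w^2"
  hence w: "n * gcnj n = w^2" by (simp only: mult_gcnj)
  have "p0 dvd w^2" unfolding w[symmetric] n_factors(1) by simp
  hence "p0 dvd w" using prime_elem_dvd_power[OF prime_elems(1)] by blast
  then obtain v where v: "w = p0 * v" by (elim dvdE)
  have "p0 * (p1 * p2 * p3 * gcnj n) = p0 * (p0 * v^2)"
    using w unfolding v n_factors(1) by (simp add: power2_eq_square mult_ac)
  hence "p1 * p2 * p3 * gcnj n = p0 * v^2" using prime_elems(1) by (simp add: prime_elem_def)
  hence "p0 dvd (p1 * p2 * p3) * gcnj n" by (metis dvd_triv_left)
  hence "p0 dvd gcnj n" using not_dvd_cofactor(1) prime_elem_dvd_mult_iff[OF prime_elems(1)] by blast
  hence "p0 dvd gcnj p0 * gcnj p1 * gcnj p2 * gcnj p3" by (simp only: n_def gcnj_mult)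
  thus False
    using good_not_dvd_conj[OF good(1) good(1)] good_not_dvd_conj[OF good(1) good(2)]
      good_not_dvd_conj[OF good(1) good(3)] good_not_dvd_conj[OF good(1) good(4)]
    by (simp add: prime_elem_dvd_mult_iff[OF prime_elems(1)])
qed

text \<open>The invariant \<open>c\<^sub>4\<close> of a model over a real field is real, so \<open>n u\<^sup>2\<close> is real or purely imaginary and its
  absolute value is rational; then the norm of \<open>n\<close> would be a square.\<close>

lemma genuinely_defined: "genuinely_defined_over gaussian_rats E"
  unfolding genuinely_defined_over_def
proof (intro conjI notI elliptic_curve)
  assume "\<exists>F. subfield F ring_of_type_algebra \<and> F \<subset> gaussian_rats \<and> is_base_change F gaussian_rats E"
  then obtain F E' u r t v where F: "subfield F (ring_of_type_algebra :: complex ring)" "F \<subset> gaussian_rats"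
    and E': "elliptic_curve_over F E'" and u: "u \<in> gaussian_rats" "u \<noteq> 0" and ch: "weierstrass_change u r t v E' E"
    unfolding is_base_change_def weierstrass_isomorphic_over_def by blast
  obtain a1 a2 a3 a4 a6 where a: "E' = Weierstrass a1 a2 a3 a4 a6" by (cases E')
  define A where "A = - (of_gint n ^ 2)"
  have "a1 \<in> F" "a2 \<in> F" "a3 \<in> F" "a4 \<in> F" using E' by (simp_all add: elliptic_curve_over_def a)
  hence real: "Im a1 = 0" "Im a2 = 0" "Im a3 = 0" "Im a4 = 0" using subfield_real[OF F] by blast+
  have c: "0 = a1 + 2 * t" "0 = a2 - t * a1 + 3 * r - t^2" "0 = a3 + r * a1 + 2 * v"
    "u^4 * A = a4 - t * a3 + 2 * r * a2 - (v + r * t) * a1 + 3 * r^2 - 2 * t * v"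
    using ch by (simp_all add: a E_def A_def)
  \<comment> \<open>The change of variables multiplies c4 = b2^2 - 24 b4 by u^4; on E it equals -48
    A = 48 n^2.\<close>
  have c4: "u^4 * (- 48 * A) = (a1^2 + 4 * a2)^2 - 24 * (2 * a4 + a1 * a3)"
    using c by Groebner_Basis.algebra
  have im: "Im ((a1^2 + 4 * a2)^2 - 24 * (2 * a4 + a1 * a3)) = 0"
    using real by (simp add: power2_eq_square)
  define z where "z = of_gint n * u^2"
  have c4': "u^4 * (- 48 * A) = 48 * z^2" by (simp add: A_def z_def power_mult_distrib flip: power_mult)
  have "Im (48 * z^2) = 0" using im unfolding c4[symmetric] c4' .
  hence "Re z = 0 \<or> Im z = 0" by (auto simp: power2_eq_square)
  moreover have zK: "z \<in> gaussian_rats" unfolding z_def by (intro rats_closed u of_gint_rat)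
  ultimately have "cmod z \<in> \<rat>" by (auto simp: cmod_def gaussian_rats_def)
  moreover have "(cmod u)^2 \<in> \<rat>" using u(1) by (simp add: cmod_power2 gaussian_rats_def)
  ultimately have q: "cmod z / (cmod u)^2 \<in> \<rat>" by simp
  have "cmod z = cmod (of_gint n) * (cmod u)^2" by (simp add: z_def norm_mult norm_power)
  hence "cmod z / (cmod u)^2 = cmod (of_gint n)" using u(2) by simp
  hence "cmod (of_gint n) \<in> \<rat>" using q by simp
  hence K: "of_real (cmod (of_gint n)) \<in> gaussian_rats" by (simp add: gaussian_rats_def)
  have sq: "(of_real (cmod (of_gint n)))^2 = of_gint (of_int (gnorm n))"
    by (simp only: of_real_power[symmetric] cmod_of_gint of_real_of_int_eq of_gint_simps)
  obtain w where "of_real (cmod (of_gint n)) = of_gint w" "of_int (gnorm n) = w^2"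
    by (rule gaussian_rat_square_integral[OF K sq])
  thus False using gnorm_n_not_square[of w] by simp
qed

section \<open>The group of rational points of the given curve\<close>

definition to_E :: "pt \<Rightarrow> complex ec_point" where
  "to_E P = (if P = 0 then Infinity else Affine (of_gint n * xc P) (of_gint n * s * yc P))"

lemma n0: "of_gint n \<noteq> 0"
  using n_nonzero by simp

lemma to_E_Pt: "y^2 = x^3 - x \<Longrightarrow> to_E (Pt x y) = Affine (of_gint n * x) (of_gint n * s * y)"
  by (simp add: to_E_def Pt_neq_0)

lemma to_E_inj: "inj to_E"
proof (rule injI)
  fix P R assume e: "to_E P = to_E R"
  show "P = R"
  proof (cases "P = 0 \<or> R = 0")
    case True
    thus ?thesis using e by (auto simp: to_E_def split: if_splits)
  next
    case False
    hence "xc P = xc R" "yc P = yc R" using e n0 s_nonzero by (simp_all add: to_E_def)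
    thus ?thesis using Pt_coords[of P] Pt_coords[of R] False by metis
  qed
qed

lemma to_E_image: "to_E ` G = ec_points E gaussian_rats"
proof (intro equalityI subsetI)
  fix A assume "A \<in> to_E ` G"
  then obtain P where P: "P \<in> G" "A = to_E P" by blast
  show "A \<in> ec_points E gaussian_rats"
  proof (cases "P = 0")
    case False
    obtain y' where y': "y' \<in> gaussian_rats" "yc P = s * y'" using P(1) unfolding G_def by (blast elim: ratioE)
    have y: "of_gint n * s * yc P = of_gint n ^ 2 * y'" unfolding y' by (simp add: power2_eq_square flip: s2(2))
    have "(of_gint n * s * yc P)^2 = (of_gint n * xc P)^3 + - (of_gint n ^ 2) * (of_gint n * xc P)"
      unfolding power_mult_distrib s2 coords_on_curve by (simp add: power2_eq_square power3_eq_cube algebra_simps)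
    moreover have "of_gint n * xc P \<in> gaussian_rats" "of_gint n ^ 2 * y' \<in> gaussian_rats"
      by (intro rats_closed of_gint_rat y' G_xc P)+
    ultimately show ?thesis using False P(2) y by (simp add: to_E_def ec_points_def E_def)
  qed (use P in \<open>simp add: to_E_def ec_points_def\<close>)
next
  fix A assume A: "A \<in> ec_points E gaussian_rats"
  show "A \<in> to_E ` G"
  proof (cases A)
    case Infinity
    thus ?thesis using G_zero by (intro image_eqI[of _ _ 0]) (simp_all add: to_E_def)
  next
    case (Affine x y)
    hence xy: "x \<in> gaussian_rats" "y \<in> gaussian_rats" "y^2 = x^3 - of_gint n ^ 2 * x"
      using A by (auto simp: ec_points_def E_def)
    have on: "(y / (of_gint n * s))^2 = (x / of_gint n)^3 - x / of_gint n"
      using n0 unfolding power_divide power_mult_distrib s2 xy(3) by (simp add: field_simps power2_eq_square power3_eq_cube)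
    have e: "y / (of_gint n * s) / s = y / of_gint n ^ 2"
      by (simp only: divide_divide_eq_left mult.assoc s2(2) power2_eq_square)
    have "x / of_gint n \<in> gaussian_rats" "y / of_gint n ^ 2 \<in> gaussian_rats" by (intro rats_closed of_gint_rat xy)+
    hence "Pt (x / of_gint n) (y / (of_gint n * s)) \<in> G" unfolding G_Pt[OF on] e by (rule conjI)
    moreover have "A = to_E (Pt (x / of_gint n) (y / (of_gint n * s)))"
      using Affine n0 s_nonzero by (simp add: to_E_Pt[OF on])
    ultimately show ?thesis by blast
  qed
qed

text \<open>The scaling carries a line of slope l and intercept m to one of slope s l and intercept
  n s m, so collinear points stay collinear.\<close>

lemma to_E_add: "to_E (P + R) = ec_add E (to_E P) (to_E R)"
proof (cases P rule: pt_cases; cases R rule: pt_cases)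
  fix x1 y1 x2 y2
  assume P: "y1^2 = x1^3 - x1" "P = Pt x1 y1" and R: "y2^2 = x2^3 - x2" "R = Pt x2 y2"
  let ?n = "of_gint n"
  have cu: "(?n * s * y)^2 = (?n * x)^3 + - (?n^2) * (?n * x) + 0" if "y^2 = x^3 - x" for x y
    unfolding power_mult_distrib s2 that by (simp add: power2_eq_square power3_eq_cube algebra_simps)
  show ?thesis
  proof (cases "x1 = x2 \<and> y1 + y2 = 0")
    case True
    hence "y2 = - y1" by (simp add: add_eq_0_iff)
    thus ?thesis using True P R Pt_add_opposite[OF P(1)] by (simp add: to_E_Pt E_def) (simp add: to_E_def)
  next
    case False
    obtain l m x3 where *: "y1 = l * x1 + m" "y2 = l * x2 + m" "vieta (- 1) 0 l m x1 x2 x3"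
      "(- (l * x3 + m))^2 = x3^3 - x3" "Pt x1 y1 + Pt x2 y2 = Pt x3 (- (l * x3 + m))"
      by (rule Pt_add[OF P(1) R(1) False]) blast
    have "vieta (- (?n^2)) 0 (s * l) (?n * s * m) (?n * x1) (?n * x2) (?n * x3)"
    proof -
      have v: "x1 + x2 + x3 = l^2" "x1 * x2 + x2 * x3 + x3 * x1 = - 1 - 2 * l * m" "x1 * x2 * x3 = m^2"
        using *(3) by (simp_all add: vieta_def)
      have "?n * x1 + ?n * x2 + ?n * x3 = ?n * (x1 + x2 + x3)"
        "?n * x1 * (?n * x2) + ?n * x2 * (?n * x3) + ?n * x3 * (?n * x1) = ?n^2 * (x1 * x2 + x2 * x3 + x3 * x1)"
        "?n * x1 * (?n * x2) * (?n * x3) = ?n^3 * (x1 * x2 * x3)"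
        by (simp_all add: algebra_simps power2_eq_square power3_eq_cube)
      thus ?thesis unfolding vieta_def v s2(2)[symmetric] by (simp add: algebra_simps power2_eq_square power3_eq_cube)
    qed
    moreover have "?n * s * y1 = s * l * (?n * x1) + ?n * s * m" "?n * s * y2 = s * l * (?n * x2) + ?n * s * m"
      using *(1,2) by (simp_all add: algebra_simps)
    moreover have "\<not> (?n * x1 = ?n * x2 \<and> ?n * s * y1 + ?n * s * y2 = 0)"
      using False n0 s_nonzero by (simp flip: distrib_left)
    ultimately have "ec_add E (Affine (?n * x1) (?n * s * y1)) (Affine (?n * x2) (?n * s * y2)) =
        Affine (?n * x3) (- (s * l * (?n * x3) + ?n * s * m))"
      unfolding E_def by (intro ec_add_eqI' cu P R)
    moreover have "- (s * l * (?n * x3) + ?n * s * m) = ?n * s * (- (l * x3 + m))" by (simp add: algebra_simps)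
    ultimately show ?thesis using P R *(4,5) by (simp only: to_E_Pt)
  qed
qed (simp_all add: to_E_def E_def zero_add_pt add_zero_pt)

text \<open>Independence of T and iT. The coefficients are differences of the representatives 0 and
  1, whence the range from -1 to 1.\<close>

lemma two_torsion_combination:
  assumes "c \<in> {- 1, 0, 1}" "d \<in> {- 1, 0, 1}" "zmul c T + zmul d (imul T) = 0"
  shows "c = 0 \<and> d = 0"
proof -
  have T: "xc (imul T) = - 1" "imul T \<noteq> 0" "- T = T" "- imul T = imul T" "phi T \<noteq> 0"
  proof -
    show x: "xc (imul T) = - 1" by simp
    show "imul T \<noteq> 0"
    proof
      assume "imul T = 0"
      hence "xc (imul T) = xc 0" by (rule arg_cong)
      hence "- 1 = (0 :: complex)" unfolding x coords_zero .
      thus False by simp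
    qed
    show "- T = T" using T_two_torsion by (simp add: neg_eq_iff_add_eq_0)
    thus "- imul T = imul T" by (simp flip: imul_minus)
    show "phi T \<noteq> 0" unfolding phi_T by (rule Pt_neq_0) simp
  qed
  have s: "zmul c T = (if c = 0 then 0 else T)" "zmul d (imul T) = (if d = 0 then 0 else imul T)"
    using assms(1,2) T(3,4) by auto
  show ?thesis using assms(3) T unfolding s by (auto simp: phi_def split: if_splits)
qed

text \<open>The free part is Z[i] P0, with Z[i] read as pairs of integers, and the torsion part is
  spanned by T and iT. The map is built from the product to the points and inverted at the
  end.\<close>

lemma ec_group_iso:
  "ec_group E gaussian_rats \<cong>
     (integer_group \<times>\<times> integer_group) \<times>\<times> (integer_mod_group 2 \<times>\<times> integer_mod_group 2)"
proof -
  let ?Z = "(integer_group \<times>\<times> integer_group) \<times>\<times> (integer_mod_group 2 \<times>\<times> integer_mod_group 2)"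
  obtain P0 where P0: "P0 \<in> G" "\<And>P. P \<in> G \<Longrightarrow> \<exists>w. (P - gmul w P0) + (P - gmul w P0) = 0"
    "\<And>w. gmul w P0 + gmul w P0 = 0 \<Longrightarrow> w = 0"
    using generator by blast
  define g where "g = (\<lambda>((a, b), (c, d)). gmul (GInt a b) P0 + (zmul c T + zmul d (imul T)))"
  have gG: "g v \<in> G" for v
  proof -
    have "zmul c R \<in> G" if "R \<in> G" for c R using G_gmul[OF that, of "of_int c"] by (simp only: gmul_int)
    hence "gmul z P0 + (zmul c T + zmul d (imul T)) \<in> G" for z c d
      by (intro G_add G_gmul P0(1)) (simp_all add: T_G G_imul)
    thus ?thesis by (simp add: g_def split: prod.split)
  qed
  have iT: "imul T + imul T = 0" using T_two_torsion by (simp flip: imul_add)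
  have zmul_zero: "zmul k (0 :: pt) = 0" for k using zmul_distrib[of k 0 0] by simp
  have double: "zmul c T + zmul c T = 0" "zmul c (imul T) + zmul c (imul T) = 0" for c
    unfolding zmul_distrib[symmetric] T_two_torsion iT by (rule zmul_zero)+
  have mod: "zmul ((c + c') mod 2) R = zmul c R + zmul c' R" if R: "R + R = 0" for c c' and R :: pt
  proof -
    have "zmul (c + c') R = zmul (2 * ((c + c') div 2) + (c + c') mod 2) R" by simp
    also have "\<dots> = zmul ((c + c') div 2) (zmul 2 R) + zmul ((c + c') mod 2) R"
      by (simp only: zmul_add zmul_mult mult.commute[of 2])
    also have "zmul 2 R = 0" using zmul_add[of 1 1 R] R by simp
    finally have "zmul (c + c') R = zmul ((c + c') mod 2) R" by (simp only: zmul_zero add_0_left)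
    thus ?thesis by (simp only: zmul_add)
  qed
  have carrier: "carrier ?Z = (UNIV \<times> UNIV) \<times> ({0..<2} \<times> {0..<2})"
    by (simp add: DirProd_def carrier_integer_mod_group)
  have "to_E \<circ> g \<in> hom ?Z (ec_group E gaussian_rats)"
  proof (rule homI)
    fix v assume "v \<in> carrier ?Z"
    show "(to_E \<circ> g) v \<in> carrier (ec_group E gaussian_rats)"
      using gG[of v] to_E_image by (auto simp: ec_group_def)
  next
    fix v w assume "v \<in> carrier ?Z" "w \<in> carrier ?Z"
    obtain a b c d a' b' c' d' where vw: "v = ((a, b), (c, d))" "w = ((a', b'), (c', d'))"
      by (metis surj_pair)
    have "v \<otimes>\<^bsub>?Z\<^esub> w = ((a + a', b + b'), ((c + c') mod 2, (d + d') mod 2))" by (simp add: vw DirProd_def)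
    moreover have "GInt (a + a') (b + b') = GInt a b + GInt a' b'" by (simp add: gint_eq_iff)
    ultimately have "g (v \<otimes>\<^bsub>?Z\<^esub> w) = g v + g w"
      by (simp add: g_def vw gmul_add mod[OF T_two_torsion] mod[OF iT] add_ac)
    thus "(to_E \<circ> g) (v \<otimes>\<^bsub>?Z\<^esub> w) = (to_E \<circ> g) v \<otimes>\<^bsub>ec_group E gaussian_rats\<^esub> (to_E \<circ> g) w"
      by (simp add: to_E_add ec_group_def)
  qed
  moreover have "bij_betw (to_E \<circ> g) (carrier ?Z) (carrier (ec_group E gaussian_rats))"
  proof (rule bij_betw_trans)
    show "bij_betw to_E G (carrier (ec_group E gaussian_rats))"
      unfolding bij_betw_def using inj_on_subset[OF to_E_inj subset_UNIV] to_E_image by (simp add: ec_group_def)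
    show "bij_betw g (carrier ?Z) G"
    proof (rule bij_betw_imageI)
      show "inj_on g (carrier ?Z)"
      proof (rule inj_onI)
        fix v w assume v: "v \<in> carrier ?Z" "w \<in> carrier ?Z" and e: "g v = g w"
        obtain a b c d a' b' c' d' where vw: "v = ((a, b), (c, d))" "w = ((a', b'), (c', d'))"
          by (metis surj_pair)
        define z where "z = GInt a b - GInt a' b'"
        define t where "t = zmul (c - c') T + zmul (d - d') (imul T)"
        have zm: "zmul (k - l) R = zmul k R - zmul l R" for k l and R :: pt
          using zmul_add[of k "- l" R] by (simp add: zmul_uminus_left)
        have "gmul z P0 + t = g v - g w"
          by (simp add: g_def vw z_def t_def gmul_diff_left zm)
        hence zt: "gmul z P0 + t = 0" using e by simp
        \<comment> \<open>Doubling removes the torsion part, so the coefficient of P0 vanishes first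
          and the torsion coefficients can then be compared alone.\<close>
        have "t + t = 0" unfolding t_def using double[of "c - c'"] double[of "d - d'"] by (simp add: add_ac)
        moreover have "(gmul z P0 + t) + (gmul z P0 + t) = (gmul z P0 + gmul z P0) + (t + t)" by (simp only: add_ac)
        ultimately have "gmul z P0 + gmul z P0 = 0" using zt by simp
        hence z: "z = 0" by (rule P0(3))
        hence "t = 0" using zt by simp
        moreover have "c - c' \<in> {- 1, 0, 1}" "d - d' \<in> {- 1, 0, 1}" using v by (auto simp: vw carrier_integer_mod_group)
        ultimately have "c - c' = 0 \<and> d - d' = 0" unfolding t_def by (intro two_torsion_combination)
        thus "v = w" using z by (simp add: vw z_def gint_eq_iff)
      qed
      show "g ` carrier ?Z = G"
      proof (intro equalityI subsetI)
        fix P assume P: "P \<in> G"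
        obtain w where w: "(P - gmul w P0) + (P - gmul w P0) = 0" using P0(2)[OF P] by blast
        have "\<exists>c\<in>{0..<2}. \<exists>d\<in>{0..<2}. P - gmul w P0 = zmul c T + zmul d (imul T)"
        proof -
          from two_torsion_cases[OF w] consider "P - gmul w P0 = zmul 0 T + zmul 0 (imul T)" |
            "P - gmul w P0 = zmul 1 T + zmul 0 (imul T)" | "P - gmul w P0 = zmul 0 T + zmul 1 (imul T)" |
            "P - gmul w P0 = zmul 1 T + zmul 1 (imul T)" by auto
          thus ?thesis by cases (force simp del: zmul_simps)+
        qed
        then obtain c d where cd: "c \<in> {0..<2}" "d \<in> {0..<2}" "P - gmul w P0 = zmul c T + zmul d (imul T)" by blast
        have "P = g ((gre w, gim w), (c, d))" using cd(3) by (simp add: g_def algebra_simps)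
        moreover have "((gre w, gim w), (c, d)) \<in> carrier ?Z" using cd(1,2) by (simp add: carrier_integer_mod_group)
        ultimately show "P \<in> g ` carrier ?Z" by blast
      qed (use gG in blast)
    qed
  qed
  ultimately have "to_E \<circ> g \<in> iso ?Z (ec_group E gaussian_rats)" by (simp add: iso_def)
  hence "?Z \<cong> ec_group E gaussian_rats" by (auto simp: is_iso_def)
  moreover have "group ?Z" by (intro DirProd_group group_integer_group group_integer_mod_group)
  ultimately show ?thesis by (simp add: group.iso_sym)
qed

end

theorem theorem1p2:
  fixes \<beta> :: complex and k :: int and E :: "complex weierstrass"
  assumes "\<beta> \<in> gaussian_ints"
    and "k \<noteq> 0"
    and "\<forall>\<pi> \<in> {\<beta> + of_int k * (1 + \<i>), \<beta> + of_int k * \<i> * (1 + \<i>),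
                \<beta> - of_int k * (1 + \<i>), \<beta> - of_int k * \<i> * (1 + \<i>)}.
           gaussian_prime \<pi> \<and> gaussian_cong \<pi> (- 1 - 6 * \<i>) 16"
    and "E = Weierstrass 0 0 0 (- ((\<beta>^4 + 4 * of_int k^4)^2)) 0"
  shows "genuinely_defined_over gaussian_rats E \<and>
         ec_group E gaussian_rats \<cong>
           (integer_group \<times>\<times> integer_group) \<times>\<times> (integer_mod_group 2 \<times>\<times> integer_mod_group 2)"
proof -
  obtain be where be: "\<beta> = of_gint be" using assms(1) by (auto simp: gaussian_ints_iff)
  have e: "\<beta> + of_int k * (1 + \<i>) = of_gint (be + of_int k * (1 + gi))"
    "\<beta> + of_int k * \<i> * (1 + \<i>) = of_gint (be + gi * (of_int k * (1 + gi)))"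
    "\<beta> - of_int k * (1 + \<i>) = of_gint (be - of_int k * (1 + gi))"
    "\<beta> - of_int k * \<i> * (1 + \<i>) = of_gint (be - gi * (of_int k * (1 + gi)))"
    by (simp_all add: be mult_ac)
  interpret four_primes be k
  proof
    show "k \<noteq> 0" by fact
  qed (use assms(3) in \<open>unfold e, auto intro: good_of_gint\<close>)
  have "\<beta>^4 + 4 * of_int k^4 = of_gint n" by (simp add: n_eq be)
  hence "E = four_primes.E be k" unfolding E_def assms(4) by simp
  thus ?thesis using genuinely_defined ec_group_iso by simp
qed


end
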